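(* Let $d=3$, $T>0$, and let $h$ be a weak solution of the inviscid E-MHD equations $$h_t+\nabla\times\big[(\nabla\times h)\times h\big]=0,\qquad \mathrm{div}\,h=0$$ on $\mathbb{T}^3$ such that $\vec{j}=\mathrm{curl}\,h\in C([0,T];L^{3/2}(\mathbb{T}^3))$. If $h\in L^{3}(0,T;\underline{B}^{1/3}_{3,VMO}(\mathbb{T}^3))$, then for any $t\in[0,T]$ the magnetic helicity is invariant, i.e. $$\int_{\mathbb{T}^3}H(x,t)\cdot\mathrm{curl}\,H(x,t)\,dx=\int_{\mathbb{T}^3}H_0\cdot\mathrm{curl}\,H_0\,dx ,$$ where $H=\mathrm{curl}^{-1}h$ and $H_0=H(\cdot,0)$.
   Context: $\mathbb{T}^3$ is the three-dimensional torus (periodic boundary conditions). $H=\mathrm{curl}^{-1}h$ is the magnetic vector potential: the divergence-free (mean-zero) field with $\mathrm{curl}\,H=h$; for this to be defined on the torus, $h$ is taken to have zero spatial mean. The potential satisfies, for some scalar $p$, the magnetic vector potential equation $H_t+(\nabla\times h)\times h+\nabla p=0$, $\mathrm{div}\,H=0$, in the weak sense. Weak solution of E-MHD: a field $h$ that is (at least weakly) continuous from $[0,T]$ into $L^2(\mathbb{T}^3)$, is divergence-free in the sense of distributions, and satisfies, for every divergence-free test vector field $\varphi\in C_0^\infty((0,T)\times\mathbb{T}^3)$, $$\int_0^T\!\!\int_{\mathbb{T}^3}\Big(\partial_t\varphi\cdot h+\sum_{i,k}h_ih_k\,\partial_k(\nabla\times\varphi)_i\Big)dx\,dt=0 .$$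 The Besov-VMO space $L^r(0,T;\underline{B}^{\alpha}_{q,VMO}(\mathbb{T}^d))$ consists of $f\in L^r(0,T;L^q(\mathbb{T}^d))$ with $$\lim_{\varepsilon\to0}\frac1{\varepsilon^\alpha}\left(\int_0^T\Big[\int_{\mathbb{T}^d}\frac{1}{|B_\varepsilon(0)|}\int_{B_\varepsilon(0)}|f(x,t)-f(x-y,t)|^q\,dy\,dx\Big]^{r/q}dt\right)^{1/r}=0 .$$ *)

theory Defs
  imports "HOL-Analysis.Analysis"
begin

text \<open>
  The torus is \<open>\<real>\<^sup>d / \<int>\<^sup>d\<close>: a field on it is a 1-periodic function on \<open>real ^ 'n\<close>, and integrals
  over the torus are integrals over the unit cell. Elements of Lebesgue spaces are given by
  periodic Borel representatives; they are not identified up to null sets.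
\<close>

definition torus_cell :: "(real ^ 'n) set"
  where "torus_cell = cbox 0 1"

definition torus_periodic :: "(real ^ 'n \<Rightarrow> 'b) \<Rightarrow> bool"
  where "torus_periodic f \<longleftrightarrow> (\<forall>x i. f (x + axis i 1) = f x)"


section \<open>Classical differential operators and smooth fields\<close>

fun Ck :: "nat \<Rightarrow> ('a::euclidean_space \<Rightarrow> 'b::real_normed_vector) \<Rightarrow> bool"
  where
    "Ck 0 f \<longleftrightarrow> continuous_on UNIV f"
  | "Ck (Suc k) f \<longleftrightarrow> f differentiable_on UNIV \<and>
       (\<forall>b\<in>Basis. Ck k (\<lambda>x. frechet_derivative f (at x) b))"

definition smooth :: "('a::euclidean_space \<Rightarrow> 'b::real_normed_vector) \<Rightarrow> bool"
  where "smooth f \<longleftrightarrow> (\<forall>k. Ck k f)"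

definition partial :: "'n \<Rightarrow> (real ^ 'n \<Rightarrow> 'b::real_normed_vector) \<Rightarrow> real ^ 'n \<Rightarrow> 'b"
  where "partial i f x = frechet_derivative f (at x) (axis i 1)"

definition grad :: "(real ^ 'n \<Rightarrow> real) \<Rightarrow> real ^ 'n \<Rightarrow> real ^ 'n"
  where "grad f x = (\<chi> i. partial i f x)"

definition divergence :: "(real ^ 'n \<Rightarrow> real ^ 'n) \<Rightarrow> real ^ 'n \<Rightarrow> real"
  where "divergence f x = (\<Sum>i\<in>UNIV. partial i f x $ i)"

definition curl :: "(real ^ 3 \<Rightarrow> real ^ 3) \<Rightarrow> real ^ 3 \<Rightarrow> real ^ 3"
  where "curl f x = vector
    [partial 2 f x $ 3 - partial 3 f x $ 2,
     partial 3 f x $ 1 - partial 1 f x $ 3,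
     partial 1 f x $ 2 - partial 2 f x $ 1]"

definition torus_smooth :: "(real ^ 'n \<Rightarrow> 'b::real_normed_vector) set"
  where "torus_smooth = {\<phi>. torus_periodic \<phi> \<and> smooth \<phi>}"


section \<open>Function spaces\<close>

definition torus_Lp :: "real \<Rightarrow> (real ^ 'n \<Rightarrow> 'b::euclidean_space) set"
  where "torus_Lp p = {f. torus_periodic f \<and> f \<in> borel_measurable borel \<and>
    set_integrable lborel torus_cell (\<lambda>x. norm (f x) powr p)}"

definition torus_Lp_norm :: "real \<Rightarrow> (real ^ 'n \<Rightarrow> 'b::euclidean_space) \<Rightarrow> real"
  where "torus_Lp_norm p f = (LINT x:torus_cell|lborel. norm (f x) powr p) powr (1 / p)"

definition time_C_Lp :: "real \<Rightarrow> real \<Rightarrow> (real \<Rightarrow> real ^ 'n \<Rightarrow> 'b::euclidean_space) set"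
  where "time_C_Lp T p = {f. (\<forall>t\<in>{0..T}. f t \<in> torus_Lp p) \<and>
    (\<forall>s\<in>{0..T}. ((\<lambda>t. torus_Lp_norm p (\<lambda>x. f t x - f s x)) \<longlongrightarrow> 0) (at s within {0..T}))}"

definition time_weak_C_L2 :: "real \<Rightarrow> (real \<Rightarrow> real ^ 'n \<Rightarrow> 'b::euclidean_space) set"
  where "time_weak_C_L2 T = {f. (\<forall>t\<in>{0..T}. f t \<in> torus_Lp 2) \<and>
    (\<forall>g\<in>torus_Lp 2. continuous_on {0..T} (\<lambda>t. LINT x:torus_cell|lborel. f t x \<bullet> g x))}"

definition time_Lr_Lq ::
    "real \<Rightarrow> real \<Rightarrow> real \<Rightarrow> (real \<Rightarrow> real ^ 'n \<Rightarrow> 'b::euclidean_space) set"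
  where "time_Lr_Lq T r q = {f.
    case_prod f \<in> borel_measurable (restrict_space borel ({0<..<T} \<times> UNIV)) \<and>
    (AE t in lborel. t \<in> {0<..<T} \<longrightarrow> f t \<in> torus_Lp q) \<and>
    set_integrable lborel {0<..<T} (\<lambda>t. torus_Lp_norm q (f t) powr r)}"

definition mean_increment ::
    "real \<Rightarrow> real \<Rightarrow> (real ^ 'n \<Rightarrow> 'b::euclidean_space) \<Rightarrow> real"
  where "mean_increment q \<epsilon> f =
    (LINT x:torus_cell|lborel.
       1 / measure lborel (ball (0 :: real ^ 'n) \<epsilon>) *
       (LINT y:ball 0 \<epsilon>|lborel. norm (f x - f (x - y)) powr q))"

definition Besov_VMO ::
    "real \<Rightarrow> real \<Rightarrow> real \<Rightarrow> real \<Rightarrow> (real \<Rightarrow> real ^ 'n \<Rightarrow> 'b::euclidean_space) set"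
  where "Besov_VMO T r \<alpha> q = {f \<in> time_Lr_Lq T r q.
    ((\<lambda>\<epsilon>. 1 / \<epsilon> powr \<alpha> *
        (LINT t:{0<..<T}|lborel. mean_increment q \<epsilon> (f t) powr (r / q)) powr (1 / r))
      \<longlongrightarrow> 0) (at_right 0)}"


section \<open>Distributional operators on the torus\<close>

definition weak_div_free :: "(real ^ 'n \<Rightarrow> real ^ 'n) \<Rightarrow> bool"
  where "weak_div_free f \<longleftrightarrow> f \<in> torus_Lp 1 \<and>
    (\<forall>\<psi>\<in>torus_smooth. (LINT x:torus_cell|lborel. f x \<bullet> grad \<psi> x) = 0)"

definition has_weak_curl :: "(real ^ 3 \<Rightarrow> real ^ 3) \<Rightarrow> (real ^ 3 \<Rightarrow> real ^ 3) \<Rightarrow> bool"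
  where "has_weak_curl f g \<longleftrightarrow> f \<in> torus_Lp 1 \<and> g \<in> torus_Lp 1 \<and>
    (\<forall>\<phi>\<in>torus_smooth. (LINT x:torus_cell|lborel. f x \<bullet> curl \<phi> x) =
       (LINT x:torus_cell|lborel. g x \<bullet> \<phi> x))"

text \<open>The weak curl is determined up to a null set, so integrals do not see the choice.\<close>

definition weak_curl :: "(real ^ 3 \<Rightarrow> real ^ 3) \<Rightarrow> real ^ 3 \<Rightarrow> real ^ 3"
  where "weak_curl f = (SOME g. has_weak_curl f g)"

definition mean_zero :: "(real ^ 'n \<Rightarrow> real ^ 'n) \<Rightarrow> bool"
  where "mean_zero f \<longleftrightarrow> (LINT x:torus_cell|lborel. f x) = 0"

text \<open>
  \<open>is_curl_inverse h H\<close> says that \<open>H\<close> is (a representative of) \<open>curl\<inverse> h\<close>. For divergence-free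
  mean-zero \<open>h \<in> L\<^sup>2\<close> such an \<open>H\<close> exists and is unique up to null sets.
\<close>

definition is_curl_inverse :: "(real ^ 3 \<Rightarrow> real ^ 3) \<Rightarrow> (real ^ 3 \<Rightarrow> real ^ 3) \<Rightarrow> bool"
  where "is_curl_inverse h H \<longleftrightarrow>
    H \<in> torus_Lp 2 \<and> mean_zero H \<and> weak_div_free H \<and> has_weak_curl H h"


section \<open>Weak solutions of the inviscid E-MHD equations\<close>

text \<open>Divergence-free fields in \<open>C\<^sub>0\<^sup>\<infinity>((0,T) \<times> \<T>\<^sup>3)\<close>: compact support is a condition on time only.\<close>

definition emhd_test :: "real \<Rightarrow> (real \<Rightarrow> real ^ 3 \<Rightarrow> real ^ 3) set"
  where "emhd_test T = {\<phi>. smooth (case_prod \<phi>) \<and> (\<forall>t. torus_periodic (\<phi> t)) \<and>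
    (\<exists>a b. 0 < a \<and> b < T \<and> (\<forall>t x. t \<notin> {a..b} \<longrightarrow> \<phi> t x = 0)) \<and>
    (\<forall>t x. divergence (\<phi> t) x = 0)}"

definition emhd_weak_solution :: "real \<Rightarrow> (real \<Rightarrow> real ^ 3 \<Rightarrow> real ^ 3) \<Rightarrow> bool"
  where "emhd_weak_solution T h \<longleftrightarrow>
    h \<in> time_weak_C_L2 T \<and>
    (\<forall>t\<in>{0..T}. weak_div_free (h t)) \<and>
    (\<forall>\<phi>\<in>emhd_test T.
      (LINT t:{0<..<T}|lborel. LINT x:torus_cell|lborel.
         vector_derivative (\<lambda>s. \<phi> s x) (at t) \<bullet> h t x +
         (\<Sum>i\<in>UNIV. \<Sum>k\<in>UNIV. h t x $ i * h t x $ k * partial k (curl (\<phi> t)) x $ i)) = 0)"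

end

theory Submission
  imports Defs
begin

text \<open>
  Mollify in space with kernels \<open>k\<close> that are normalised powers of \<open>\<Prod>\<^sub>i (1 + cos (2\<pi> y\<^sub>i)) / 2\<close>. They are
  trigonometric polynomials of the form \<open>k (x - z) = (\<Sum>j. a\<^sub>j x a\<^sub>j z)\<close>, concentrate at scale
  \<open>n\<^sup>-\<^sup>1\<^sup>/\<^sup>2\<close>, and reduce every statement about a mollified field to finitely many scalar functions of time,
  which weak continuity makes continuous.

  Put \<open>B s t = \<integral> h s \<bullet> (k * H t)\<close>. Since \<open>curl (k * H) = k * h\<close> and \<open>curl\<close> is symmetric, \<open>B\<close> is
  symmetric, and the weak equation tested with \<open>\<theta>(s) (k * H t)\<close> gives its increments in the first
  argument. Hence \<open>B t t - B 0 0 = 2 \<integral>\<^sub>0\<^sup>t \<Pi>\<close> with the flux \<open>\<Pi> = \<integral> h\<^sub>i h\<^sub>l \<partial>\<^sub>l (k * h)\<^sub>i\<close>. The divergence-free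
  condition puts the flux into the form of Duchon and Robert,
  \<open>-4 \<Pi> = \<integral>\<integral> grad k (x - z) \<bullet> (h x - h z) |h x - h z|\<^sup>2\<close>,
  which the Besov-VMO condition, summed over dyadic scales, sends to zero. Finally \<open>B t t\<close> tends to
  the helicity at time \<open>t\<close> because translations are continuous in \<open>L\<^sup>2\<close>.
\<close>

section \<open>Calculus of smooth functions\<close>

text \<open>Nothing is assumed about \<open>H\<close> as a function of time, so the diagonal of
  \<open>B\<close> cannot be obtained by testing with a moving field. The second time is frozen, and
  the two times are made equal only afterwards. The nonlinear term must then be compared at two
  nearby times. For a separable kernel it is a finite sum of products of an integrable function of
  the first time and a continuous function of the second, and uniform continuity closes the gap.

  The exponents balance exactly. With s = sqrt n, the gradient of the kernel has size s^4 near
  radius 1/s. The cubes of the increments, integrated over time, over the torus and over shifts in a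
  ball of radius r, amount to o(r^4): a factor r^3 comes from the volume and o(r) from cubing the
  exponent 1/3. A mere O(r^4) would only bound the flux; the vanishing limit in the Besov-VMO
  condition makes it disappear. The kernel is not supported near the origin, so its tail has to be
  summed over dyadic scales, which works for any decay faster than the fourth power.\<close>

lemma Ck_SucI:
  assumes "\<And>x. (f has_derivative D x) (at x)" "\<And>b. b \<in> Basis \<Longrightarrow> Ck k (\<lambda>x. D x b)"
  shows "Ck (Suc k) f"
proof -
  have "f differentiable_on UNIV"
    using assms(1) by (auto simp: differentiable_on_def differentiable_def)
  moreover have "frechet_derivative f (at x) = D x" for x
    using frechet_derivative_at[OF assms(1)] by simp
  ultimately show ?thesis
    using assms(2) by simp
qed

lemma Ck_differentiable: "Ck (Suc k) f \<Longrightarrow> (f has_derivative frechet_derivative f (at x)) (at x)"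
  by (auto simp: differentiable_on_def frechet_derivative_works)

lemma Ck_SucD: "Ck (Suc k) f \<Longrightarrow> Ck k f"
proof (induction k arbitrary: f)
  case 0
  then show ?case
    by (simp add: differentiable_imp_continuous_on)
next
  case (Suc k)
  show ?case
    by (rule Ck_SucI[OF Ck_differentiable[OF Suc.prems]])
      (use Suc in auto)
qed

lemma Ck_const: "Ck k (\<lambda>x. c)"
proof (induction k arbitrary: c)
  case (Suc k)
  show ?case
    by (rule Ck_SucI[where D = "\<lambda>x b. 0"]) (auto intro: Suc)
qed auto

lemma Ck_add: "Ck k f \<Longrightarrow> Ck k g \<Longrightarrow> Ck k (\<lambda>x. f x + g x)"
proof (induction k arbitrary: f g)
  case (Suc k)
  show ?case
    by (rule Ck_SucI[OF has_derivative_add[OF Ck_differentiable[OF Suc.prems(1)]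
            Ck_differentiable[OF Suc.prems(2)]]])
      (use Suc in auto)
qed (auto intro: continuous_on_add)

lemma Ck_sum: "(\<And>i. i \<in> I \<Longrightarrow> Ck k (f i)) \<Longrightarrow> Ck k (\<lambda>x. \<Sum>i\<in>I. f i x)"
  by (induction I rule: infinite_finite_induct) (auto intro: Ck_const Ck_add)

text \<open>The product rule leaves one factor undifferentiated, so the induction needs each factor
  at the lower order too; this is what \<open>Ck_SucD\<close> is for.\<close>

lemma Ck_scaleR: "Ck k f \<Longrightarrow> Ck k g \<Longrightarrow> Ck k (\<lambda>x. f x *\<^sub>R g x)"
proof (induction k arbitrary: f g)
  case (Suc k)
  show ?case
    by (rule Ck_SucI[OF has_derivative_scaleR[OF Ck_differentiable[OF Suc.prems(1)]
            Ck_differentiable[OF Suc.prems(2)]]])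
      (use Suc Ck_SucD[OF Suc.prems(1)] Ck_SucD[OF Suc.prems(2)] in \<open>auto intro!: Ck_add\<close>)
qed (auto intro: continuous_on_scaleR)

text \<open>\<open>Ck\<close> speaks only of derivatives along basis vectors, while
  \<open>L b\<close> is in general not one. Linearity of the derivative rewrites the chain rule as a
  combination of basis derivatives with constant coefficients, to which the induction hypothesis
  applies.\<close>

lemma Ck_compose_linear:
  fixes L :: "'a::euclidean_space \<Rightarrow> 'b::euclidean_space"
  assumes "bounded_linear L"
  shows "Ck k f \<Longrightarrow> Ck k (\<lambda>x. f (L x))"
proof (induction k arbitrary: f)
  case 0
  then show ?case
    by (auto intro: continuous_on_compose2 linear_continuous_on[OF assms])
next
  case (Suc k)
  have d: "((\<lambda>x. f (L x)) has_derivative (\<lambda>b. frechet_derivative f (at (L x)) (L b))) (at x)" for x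
    using diff_chain_at[OF bounded_linear_imp_has_derivative[OF assms] Ck_differentiable[OF Suc.prems, of "L x"]]
    by (simp add: o_def)
  show ?case
  proof (rule Ck_SucI[OF d])
    fix b :: 'a
    assume "b \<in> Basis"
    have "frechet_derivative f (at (L x)) (L b)
        = (\<Sum>c\<in>Basis. (L b \<bullet> c) *\<^sub>R frechet_derivative f (at (L x)) c)" for x
    proof -
      interpret linear "frechet_derivative f (at (L x))"
        using has_derivative_linear[OF Ck_differentiable[OF Suc.prems]] .
      show ?thesis
        by (subst (1) euclidean_representation[symmetric]) (simp add: sum scale)
    qed
    moreover have "Ck k (\<lambda>x. \<Sum>c\<in>Basis. (L b \<bullet> c) *\<^sub>R frechet_derivative f (at (L x)) c)"
      using Suc by (intro Ck_sum Ck_scaleR Ck_const Suc.IH) auto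
    ultimately show "Ck k (\<lambda>x. frechet_derivative f (at (L x)) (L b))"
      by simp
  qed
qed

lemma Ck_real_SucI:
  fixes f :: "real \<Rightarrow> 'b::real_normed_vector"
  assumes "\<And>x. (f has_vector_derivative f' x) (at x)" "Ck k f'"
  shows "Ck (Suc k) f"
  using assms by (intro Ck_SucI[where D = "\<lambda>x b. b *\<^sub>R f' x"]) (auto simp: has_vector_derivative_def)

lemma smooth_const: "smooth (\<lambda>x. c)"
  by (simp add: smooth_def Ck_const)

lemma smooth_add: "smooth f \<Longrightarrow> smooth g \<Longrightarrow> smooth (\<lambda>x. f x + g x)"
  by (simp add: smooth_def Ck_add)

lemma smooth_sum: "(\<And>i. i \<in> I \<Longrightarrow> smooth (f i)) \<Longrightarrow> smooth (\<lambda>x. \<Sum>i\<in>I. f i x)"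
  by (simp add: smooth_def Ck_sum)

lemma smooth_scaleR: "smooth f \<Longrightarrow> smooth g \<Longrightarrow> smooth (\<lambda>x. f x *\<^sub>R g x)"
  by (simp add: smooth_def Ck_scaleR)

lemma smooth_compose_linear:
  fixes L :: "'a::euclidean_space \<Rightarrow> 'b::euclidean_space"
  shows "bounded_linear L \<Longrightarrow> smooth f \<Longrightarrow> smooth (\<lambda>x. f (L x))"
  by (simp add: smooth_def Ck_compose_linear)

lemma smooth_differentiable: "smooth f \<Longrightarrow> (f has_derivative frechet_derivative f (at x)) (at x)"
  using Ck_differentiable unfolding smooth_def by blast

lemma smooth_continuous_on: "smooth f \<Longrightarrow> continuous_on A f"
  using Ck.simps(1) continuous_on_subset unfolding smooth_def by blast

lemma smooth_frechet_derivative: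
  assumes "smooth f" "b \<in> Basis"
  shows "smooth (\<lambda>x. frechet_derivative f (at x) b)"
  using assms Ck.simps(2) unfolding smooth_def by blast

lemma smooth_realI:
  fixes f :: "real \<Rightarrow> 'b::real_normed_vector"
  assumes "\<And>x. (f has_vector_derivative f' x) (at x)" "smooth f'"
  shows "smooth f"
  unfolding smooth_def
proof
  fix k
  show "Ck k f"
    using assms Ck_real_SucI Ck_SucD unfolding smooth_def by blast
qed

text \<open>Differentiation shifts the phase by pi/2 and multiplies by \<open>a\<close>. With an
  arbitrary phase the family is closed under derivatives, so one induction covers both sine and
  cosine.\<close>

lemma Ck_sin_cos: "Ck k (\<lambda>x::real. sin (a * x + b))"
proof (induction k arbitrary: b)
  case 0
  show ?case
    by (auto intro!: continuous_intros)
next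
  case (Suc k)
  show ?case
  proof (rule Ck_real_SucI)
    show "((\<lambda>x. sin (a * x + b)) has_vector_derivative a *\<^sub>R sin (a * x + (b + pi/2))) (at x)" for x
      by (auto simp: has_real_derivative_iff_has_vector_derivative[symmetric] cos_sin_eq sin_add
          intro!: derivative_eq_intros)
        (simp add: cos_add sin_diff cos_diff algebra_simps)
    show "Ck k (\<lambda>x. a *\<^sub>R sin (a * x + (b + pi/2)))"
      by (intro Ck_scaleR Ck_const Suc)
  qed
qed

lemma smooth_sin: "smooth (\<lambda>x::real. sin (a * x + b))"
  by (simp add: smooth_def Ck_sin_cos)

lemma smooth_cos: "smooth (\<lambda>x::real. cos (a * x))"
  using smooth_sin[of a "pi/2"] by (simp add: sin_add)

section \<open>Integration over the torus\<close>

text \<open>Every positive extended bound lies above a positive real one, so real tolerances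
  suffice. Limits are kept in \<open>ennreal\<close> throughout, where integrals need no
  integrability and may be exchanged freely.\<close>

lemma ennreal_tendsto_0I:
  fixes u :: "'a \<Rightarrow> ennreal"
  assumes "\<And>e::real. 0 < e \<Longrightarrow> eventually (\<lambda>n. u n \<le> ennreal e) F"
  shows "(u \<longlongrightarrow> 0) F"
proof (rule order_tendstoI)
  fix a :: ennreal
  assume "0 < a"
  then obtain b where b: "0 < b" "b < a"
    using dense by blast
  then have "b < top"
    by (meson order_less_le_trans top_greatest)
  with b have "0 < enn2real b" "ennreal (enn2real b) = b"
    by (simp_all add: enn2real_positive_iff)
  with assms[of "enn2real b"] show "eventually (\<lambda>n. u n < a) F"
    using b(2) by (auto elim!: eventually_mono)
qed auto

lemma ennreal_tendsto_0D:
  fixes u :: "'a \<Rightarrow> ennreal"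
  assumes "(u \<longlongrightarrow> 0) F" "0 < e"
  shows "eventually (\<lambda>n. u n \<le> ennreal e) F"
  using order_tendstoD(2)[OF assms(1), of "ennreal e"] assms(2) by (auto elim: eventually_mono)

lemma nn_integral_lborel_translate:
  fixes f :: "'a::euclidean_space \<Rightarrow> ennreal"
  assumes [measurable]: "f \<in> borel_measurable borel"
  shows "(\<integral>\<^sup>+x. f (x + c) \<partial>lborel) = (\<integral>\<^sup>+x. f x \<partial>lborel)"
  by (subst (2) lborel_distr_plus[of c, symmetric]) (simp add: nn_integral_distr add.commute)

lemma nn_integral_lborel_reflect:
  fixes f :: "'a::euclidean_space \<Rightarrow> ennreal"
  assumes [measurable]: "f \<in> borel_measurable borel"
  shows "(\<integral>\<^sup>+x. f (c - x) \<partial>lborel) = (\<integral>\<^sup>+x. f x \<partial>lborel)"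
  by (subst (2) lborel_affine[of "-1" c]) (simp_all add: nn_integral_distr density_1)

section \<open>Lattice translations, tilings by unit cells, and changes of variable for periodic
  integrands\<close>

lemma torus_periodic_add_axis_int:
  assumes "torus_periodic f"
  shows "f (x + of_int k *\<^sub>R axis i 1) = f x"
proof -
  have 1: "f (x + of_nat k *\<^sub>R axis i 1) = f x" for x and k :: nat
  proof (induction k)
    case (Suc k)
    have "f (x + of_nat (Suc k) *\<^sub>R axis i 1) = f ((x + of_nat k *\<^sub>R axis i 1) + axis i 1)"
      by (simp add: algebra_simps)
    then show ?case
      using assms Suc unfolding torus_periodic_def by metis
  qed simp
  show ?thesis
  proof (cases "k \<ge> 0")
    case True
    then show ?thesis
      using 1[of x "nat k"] by simp
  next
    case False
    then show ?thesis
      using 1[of "x + of_int k *\<^sub>R axis i 1" "nat (- k)"] by simp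
  qed
qed

definition lattice_vec :: "int ^ 'n \<Rightarrow> real ^ 'n"
  where "lattice_vec m = (\<chi> i. of_int (m $ i))"

lemma torus_periodic_lattice:
  fixes f :: "real ^ 'n::finite \<Rightarrow> 'b"
  assumes "torus_periodic f"
  shows "f (x + lattice_vec m) = f x"
proof -
  have "f (x + (\<Sum>i\<in>S. of_int (m $ i) *\<^sub>R axis i 1)) = f x" if "finite S" for S :: "'n set"
    using that
  proof (induction S)
    case (insert i S)
    then show ?case
      using torus_periodic_add_axis_int[OF assms, of "x + (\<Sum>i\<in>S. of_int (m $ i) *\<^sub>R axis i 1)" "m $ i" i]
      by (simp add: algebra_simps)
  qed simp
  from this[of UNIV] have "f (x + (\<Sum>i\<in>UNIV. of_int (m $ i) *\<^sub>R axis i 1)) = f x"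
    by simp
  moreover have "(\<Sum>i\<in>UNIV. of_int (m $ i) *\<^sub>R axis i 1) = lattice_vec m"
    by (auto simp: vec_eq_iff lattice_vec_def axis_def if_distrib[of "(*) _"] cong: if_cong)
  ultimately show ?thesis
    by simp
qed

text \<open>Half open, so that the integer translates partition the space exactly; closed cells
  overlap on their faces. The difference is a null set.\<close>

definition half_open_cell :: "real ^ 'n \<Rightarrow> (real ^ 'n) set"
  where "half_open_cell a = {x. \<forall>i. a $ i \<le> x $ i \<and> x $ i < a $ i + 1}"

lemma half_open_cell_borel [measurable]: "half_open_cell (a :: real ^ 'n::finite) \<in> sets borel"
proof -
  have "half_open_cell a = (\<Inter>i. {x. a $ i \<le> x $ i} \<inter> {x. x $ i < a $ i + 1})"
    by (auto simp: half_open_cell_def)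
  also have "\<dots> \<in> sets borel"
  proof (intro sets.finite_INT sets.Int)
    fix i
    show "{x. a $ i \<le> x $ i} \<in> sets borel"
      by (rule borel_closed, rule closed_Collect_le) (auto intro: continuous_on_component)
    show "{x. x $ i < a $ i + 1} \<in> sets borel"
      by (rule borel_open, rule open_Collect_less) (auto intro: continuous_on_component)
  qed auto
  finally show ?thesis .
qed

lemma AE_half_open_cell:
  "AE x in lborel. x \<in> cbox a (a + 1) \<longleftrightarrow> x \<in> half_open_cell (a :: real ^ 'n::finite)"
proof (rule AE_I'[OF null_sets_cbox_Diff_box[of a "a + 1"]])
  show "{x \<in> space lborel. (x \<in> cbox a (a + 1)) \<noteq> (x \<in> half_open_cell a)} \<subseteq> cbox a (a + 1) - box a (a + 1)"
    by (auto simp: mem_box_cart half_open_cell_def intro: less_imp_le)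
qed

lemma nn_integral_half_open_cell:
  "(\<integral>\<^sup>+x\<in>cbox a (a + 1). F x \<partial>lborel) = (\<integral>\<^sup>+x\<in>half_open_cell (a :: real ^ 'n::finite). F x \<partial>lborel)"
  by (rule nn_integral_cong_AE) (use AE_half_open_cell[of a] in \<open>auto simp: indicator_def\<close>)

text \<open>Exactly one integer vector moves \<open>x\<close> into the cell, namely the one given by
  the negated floors. Stating this as an integral for counting measure allows it to be inserted as a
  factor 1 and exchanged with the integral in space.\<close>

lemma half_open_cell_tiling:
  fixes x :: "real ^ 'n::finite"
  shows "(\<integral>\<^sup>+m. indicator (half_open_cell a) (x + lattice_vec m) \<partial>count_space UNIV) = (1::ennreal)"
proof -
  have "x + lattice_vec m \<in> half_open_cell a \<longleftrightarrow> m = (\<chi> i. - \<lfloor>x $ i - a $ i\<rfloor>)" for m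
  proof -
    have "(a $ i \<le> x $ i + of_int k \<and> x $ i + of_int k < a $ i + 1) \<longleftrightarrow> k = - \<lfloor>x $ i - a $ i\<rfloor>" for i k
      by linarith
    then show ?thesis
      by (simp add: half_open_cell_def lattice_vec_def vec_eq_iff)
  qed
  then have "(\<integral>\<^sup>+m. indicator (half_open_cell a) (x + lattice_vec m) \<partial>count_space UNIV)
      = (\<integral>\<^sup>+m. indicator {\<chi> i. - \<lfloor>x $ i - a $ i\<rfloor>} m \<partial>count_space UNIV)"
    by (intro nn_integral_cong) (auto simp: indicator_def)
  then show ?thesis
    by (simp add: one_ennreal_def)
qed

text \<open>Both cells tile the space under integer translations, so the integral over one can be cut
  into pieces that reassemble to the other.\<close>

lemma nn_integral_torus_shift:
  fixes F :: "real ^ 'n::finite \<Rightarrow> ennreal"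
  assumes [measurable]: "F \<in> borel_measurable borel" and per: "torus_periodic F"
  shows "(\<integral>\<^sup>+x\<in>cbox a (a + 1). F x \<partial>lborel) = (\<integral>\<^sup>+x\<in>torus_cell. F x \<partial>lborel)"
proof -
  have [measurable]: "(\<lambda>x. x + v) \<in> borel_measurable borel" for v :: "real ^ 'n"
    by simp
  let ?Q = half_open_cell
  have tile: "(\<integral>\<^sup>+m. c * indicator (?Q b) (x + lattice_vec m) \<partial>count_space UNIV) = c" for b x and c :: ennreal
    by (simp add: nn_integral_cmult half_open_cell_tiling)
  have tile': "(\<integral>\<^sup>+m. c * indicator (?Q b) (x - lattice_vec m) \<partial>count_space UNIV) = c" for b x and c :: ennreal
  proof -
    have "(\<integral>\<^sup>+m. c * indicator (?Q b) (x - lattice_vec m) \<partial>count_space UNIV)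
        = (\<integral>\<^sup>+m. c * indicator (?Q b) (x + lattice_vec (- m)) \<partial>count_space UNIV)"
      by (intro nn_integral_cong) (simp add: lattice_vec_def indicator_def half_open_cell_def)
    also have "\<dots> = (\<integral>\<^sup>+m. c * indicator (?Q b) (x + lattice_vec m) \<partial>count_space UNIV)"
      by (rule nn_integral_bij_count_space[of uminus]) (auto intro!: bijI' intro: exI[of _ "- _"])
    finally show ?thesis
      by (simp add: tile)
  qed
  have "(\<integral>\<^sup>+x\<in>?Q a. F x \<partial>lborel)
      = (\<integral>\<^sup>+x. \<integral>\<^sup>+m. (F x * indicator (?Q a) x) * indicator (?Q 0) (x - lattice_vec m) \<partial>count_space UNIV \<partial>lborel)"
    by (subst tile') simp
  also have "\<dots> = (\<integral>\<^sup>+m. \<integral>\<^sup>+x. (F x * indicator (?Q a) x) * indicator (?Q 0) (x - lattice_vec m) \<partial>lborel \<partial>count_space UNIV)"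
    by (rule nn_integral_count_space_nn_integral) auto
  also have "\<dots> = (\<integral>\<^sup>+m. \<integral>\<^sup>+x. (F x * indicator (?Q 0) x) * indicator (?Q a) (x + lattice_vec m) \<partial>lborel \<partial>count_space UNIV)"
  proof (rule nn_integral_cong)
    fix m :: "int ^ 'n"
    have "(\<integral>\<^sup>+x. (F x * indicator (?Q a) x) * indicator (?Q 0) (x - lattice_vec m) \<partial>lborel)
        = (\<integral>\<^sup>+x. (F (x + lattice_vec m) * indicator (?Q a) (x + lattice_vec m)) * indicator (?Q 0) (x + lattice_vec m - lattice_vec m) \<partial>lborel)"
      by (rule nn_integral_lborel_translate[symmetric]) measurable
    then show "(\<integral>\<^sup>+x. (F x * indicator (?Q a) x) * indicator (?Q 0) (x - lattice_vec m) \<partial>lborel)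
        = (\<integral>\<^sup>+x. (F x * indicator (?Q 0) x) * indicator (?Q a) (x + lattice_vec m) \<partial>lborel)"
      by (simp add: torus_periodic_lattice[OF per] mult_ac)
  qed
  also have "\<dots> = (\<integral>\<^sup>+x. \<integral>\<^sup>+m. (F x * indicator (?Q 0) x) * indicator (?Q a) (x + lattice_vec m) \<partial>count_space UNIV \<partial>lborel)"
    by (rule nn_integral_count_space_nn_integral[symmetric]) auto
  also have "\<dots> = (\<integral>\<^sup>+x\<in>?Q 0. F x \<partial>lborel)"
    by (subst tile) simp
  finally show ?thesis
    using nn_integral_half_open_cell[of F 0] by (simp add: torus_cell_def nn_integral_half_open_cell)
qed

lemma torus_cell_borel [measurable]: "torus_cell \<in> sets borel"
  by (simp add: torus_cell_def)

lemma nn_integral_torus_translate: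
  fixes F :: "real ^ 'n::finite \<Rightarrow> ennreal"
  assumes [measurable]: "F \<in> borel_measurable borel" and per: "torus_periodic F"
  shows "(\<integral>\<^sup>+x\<in>torus_cell. F (x + c) \<partial>lborel) = (\<integral>\<^sup>+x\<in>torus_cell. F x \<partial>lborel)"
proof -
  have "(\<integral>\<^sup>+x\<in>cbox c (c + 1). F x \<partial>lborel)
      = (\<integral>\<^sup>+x. F (x + c) * indicator (cbox c (c + 1)) (x + c) \<partial>lborel)"
    by (rule nn_integral_lborel_translate[symmetric]) measurable
  also have "\<dots> = (\<integral>\<^sup>+x\<in>torus_cell. F (x + c) \<partial>lborel)"
    by (intro nn_integral_cong) (auto simp: torus_cell_def indicator_def mem_box_cart algebra_simps)
  finally show ?thesis
    using nn_integral_torus_shift[OF assms, of c] by simp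
qed

text \<open>The kernel is estimated in terms of the Euclidean norm of its argument, which is
  possible only if the representative is close to the origin. In this cell every coordinate is at
  most 1/2 in absolute value.\<close>

definition centred_cell :: "(real ^ 'n) set"
  where "centred_cell = cbox (\<chi> i. - 1/2) (\<chi> i. 1/2)"

lemma centred_cell_borel [measurable]: "centred_cell \<in> sets borel"
  by (simp add: centred_cell_def)

lemma nn_integral_centred_cell:
  fixes F :: "real ^ 'n::finite \<Rightarrow> ennreal"
  assumes [measurable]: "F \<in> borel_measurable borel" and per: "torus_periodic F"
  shows "(\<integral>\<^sup>+x\<in>centred_cell. F x \<partial>lborel) = (\<integral>\<^sup>+x\<in>torus_cell. F x \<partial>lborel)"
proof -
  have "(\<chi> i. - 1/2) + 1 = ((\<chi> i. 1/2) :: real ^ 'n)"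
    by (simp add: vec_eq_iff)
  then show ?thesis
    using nn_integral_torus_shift[OF assms, of "\<chi> i. - 1/2"] by (simp add: centred_cell_def)
qed

text \<open>Reflection in \<open>x\<close> carries the unit cell to the cell with corner
  \<open>x - 1\<close>, and by periodicity all unit cells give the same integral. So the increment
  variable may always be taken in the centred cell.\<close>

lemma nn_integral_torus_convolution:
  fixes F :: "real ^ 'n::finite \<Rightarrow> ennreal"
  assumes [measurable]: "F \<in> borel_measurable borel" and per: "torus_periodic F"
  shows "(\<integral>\<^sup>+z\<in>torus_cell. F (x - z) \<partial>lborel) = (\<integral>\<^sup>+y\<in>centred_cell. F y \<partial>lborel)"
proof -
  have "(\<integral>\<^sup>+y\<in>cbox (x - 1) (x - 1 + 1). F y \<partial>lborel)
      = (\<integral>\<^sup>+z. F (x - z) * indicator (cbox (x - 1) (x - 1 + 1)) (x - z) \<partial>lborel)"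
    by (rule nn_integral_lborel_reflect[symmetric]) measurable
  also have "\<dots> = (\<integral>\<^sup>+z\<in>torus_cell. F (x - z) \<partial>lborel)"
    by (intro nn_integral_cong) (auto simp: torus_cell_def indicator_def mem_box_cart algebra_simps)
  finally show ?thesis
    using nn_integral_torus_shift[OF assms, of "x - 1"] nn_integral_centred_cell[OF assms] by metis
qed

text \<open>The closure of \<open>S\<close> is compact and hence covered by finitely many open unit
  boxes, each contributing at most one torus integral.\<close>

lemma nn_integral_torus_bounded:
  fixes F :: "real ^ 'n::finite \<Rightarrow> ennreal"
  assumes [measurable]: "F \<in> borel_measurable borel" "S \<in> sets borel" and per: "torus_periodic F"
    and fin: "(\<integral>\<^sup>+x\<in>torus_cell. F x \<partial>lborel) < \<infinity>" and "bounded S"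
  shows "(\<integral>\<^sup>+x\<in>S. F x \<partial>lborel) < \<infinity>"
proof -
  have c: "compact (closure S)"
    using \<open>bounded S\<close> by (simp add: compact_closure)
  have "closure S \<subseteq> (\<Union>a\<in>UNIV. box a (a + 1))"
  proof
    fix x :: "real ^ 'n"
    have "x \<in> box (x - (\<chi> i. 1/2)) (x - (\<chi> i. 1/2) + 1)"
      by (auto simp: mem_box_cart)
    then show "x \<in> (\<Union>a\<in>UNIV. box a (a + 1))"
      by blast
  qed
  then obtain D where D: "finite D" "closure S \<subseteq> (\<Union>a\<in>D. box a (a + 1))"
    using compactE_image[OF c, of UNIV "\<lambda>a. box a (a + 1)"] by auto
  have "(\<integral>\<^sup>+x\<in>S. F x \<partial>lborel) \<le> (\<integral>\<^sup>+x. (\<Sum>a\<in>D. F x * indicator (cbox a (a + 1)) x) \<partial>lborel)"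
  proof (rule nn_integral_mono)
    fix x
    show "F x * indicator S x \<le> (\<Sum>a\<in>D. F x * indicator (cbox a (a + 1)) x)"
    proof (cases "x \<in> S")
      case True
      then obtain a where a: "a \<in> D" "x \<in> box a (a + 1)"
        using D(2) closure_subset[of S] by blast
      then have "F x * indicator (cbox a (a + 1)) x \<le> (\<Sum>a\<in>D. F x * indicator (cbox a (a + 1)) x)"
        by (intro member_le_sum) (auto simp: D)
      moreover have "x \<in> cbox a (a + 1)"
        using a box_subset_cbox by blast
      ultimately show ?thesis
        using True by (simp add: indicator_def)
    qed simp
  qed
  also have "\<dots> = (\<Sum>a\<in>D. \<integral>\<^sup>+x\<in>cbox a (a + 1). F x \<partial>lborel)"
    by (rule nn_integral_sum) measurable
  also have "\<dots> < \<infinity>"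
    using fin by (simp add: nn_integral_torus_shift[OF assms(1) per] ennreal_mult_less_top of_nat_less_top)
  finally show ?thesis .
qed

section \<open>Continuity of translations\<close>

text \<open>A point of an open set stays in it under all sufficiently small shifts, so the integrand
  tends to 0 pointwise and is dominated by the indicator of \<open>U\<close>. Openness is essential
  for the pointwise limit.\<close>

lemma nn_integral_translation_indicator_open:
  fixes U :: "'a::euclidean_space set"
  assumes "open U" "emeasure lborel U < \<infinity>" "Y \<longlonglongrightarrow> 0"
  shows "(\<lambda>n. \<integral>\<^sup>+x. indicator U x * indicator (- U) (x - Y n) \<partial>lborel) \<longlonglongrightarrow> 0"
proof -
  have [measurable]: "U \<in> sets borel"
    using \<open>open U\<close> by simp
  have "(\<lambda>n. \<integral>\<^sup>+x. indicator U x * indicator (- U) (x - Y n) \<partial>lborel) \<longlonglongrightarrow> (\<integral>\<^sup>+x. 0 \<partial>(lborel :: 'a measure))"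
  proof (rule nn_integral_dominated_convergence[where w = "indicator U"])
    show "AE x in lborel. (\<lambda>n. indicator U x * indicator (- U) (x - Y n)) \<longlonglongrightarrow> (0::ennreal)"
    proof (rule AE_I2)
      fix x :: 'a
      show "(\<lambda>n. indicator U x * indicator (- U) (x - Y n)) \<longlonglongrightarrow> (0::ennreal)"
      proof (cases "x \<in> U")
        case True
        have "(\<lambda>n. x - Y n) \<longlonglongrightarrow> x - 0"
          by (intro tendsto_intros assms)
        then have "eventually (\<lambda>n. x - Y n \<in> U) sequentially"
          using topological_tendstoD[OF _ \<open>open U\<close>] True by fastforce
        then have "eventually (\<lambda>n. indicator U x * indicator (- U) (x - Y n) = (0::ennreal)) sequentially"
          by eventually_elim simp
        then show ?thesis
          by (rule tendsto_eventually)
      qed simp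
    qed
    show "(\<integral>\<^sup>+x. indicator U x \<partial>lborel) < \<infinity>"
      using assms by simp
  qed (auto simp: indicator_def)
  then show ?thesis
    by simp
qed

text \<open>Induction over integrable functions. The property survives approximation in the mean,
  and outer regularity approximates a set of finite measure by an open one, for which the previous
  lemma applies.\<close>

lemma nn_integral_translation_tendsto:
  fixes f :: "'a::euclidean_space \<Rightarrow> 'b::euclidean_space"
  assumes "integrable lborel f" "Y \<longlonglongrightarrow> 0"
  shows "(\<lambda>n. \<integral>\<^sup>+x. ennreal (norm (f (x - Y n) - f x)) \<partial>lborel) \<longlonglongrightarrow> 0"
proof -
  \<comment> \<open>Closedness under approximation: the error of replacing \<open>f\<close> by
    \<open>g\<close> is the same before and after the shift, because Lebesgue measure is translation
    invariant. This gives three terms of size \<open>e/3\<close>.\<close>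
  have approx: "(\<lambda>n. \<integral>\<^sup>+x. ennreal (norm (f (x - Y n) - f x)) \<partial>lborel) \<longlonglongrightarrow> 0"
    if f: "f \<in> borel_measurable borel"
      and g: "\<And>e::real. e > 0 \<Longrightarrow> \<exists>g \<in> borel_measurable borel. (\<integral>\<^sup>+x. ennreal (norm (f x - g x)) \<partial>lborel) \<le> ennreal e \<and>
           (\<lambda>n. \<integral>\<^sup>+x. ennreal (norm (g (x - Y n) - g x)) \<partial>lborel) \<longlonglongrightarrow> 0"
    for f :: "'a \<Rightarrow> 'b"
  proof (rule ennreal_tendsto_0I)
    fix e :: real
    assume "0 < e"
    then obtain g where [measurable]: "g \<in> borel_measurable borel"
      and e: "(\<integral>\<^sup>+x. ennreal (norm (f x - g x)) \<partial>lborel) \<le> ennreal (e/3)"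
      and lim: "(\<lambda>n. \<integral>\<^sup>+x. ennreal (norm (g (x - Y n) - g x)) \<partial>lborel) \<longlonglongrightarrow> 0"
      using g[of "e/3"] by auto
    note [measurable] = f
    from ennreal_tendsto_0D[OF lim, of "e/3"] \<open>0 < e\<close>
    have "eventually (\<lambda>n. (\<integral>\<^sup>+x. ennreal (norm (g (x - Y n) - g x)) \<partial>lborel) \<le> ennreal (e/3)) sequentially"
      by simp
    then show "eventually (\<lambda>n. (\<integral>\<^sup>+x. ennreal (norm (f (x - Y n) - f x)) \<partial>lborel) \<le> ennreal e) sequentially"
    proof eventually_elim
      fix n
      assume n: "(\<integral>\<^sup>+x. ennreal (norm (g (x - Y n) - g x)) \<partial>lborel) \<le> ennreal (e/3)"
      have "(\<integral>\<^sup>+x. ennreal (norm (f (x - Y n) - f x)) \<partial>lborel)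
          \<le> (\<integral>\<^sup>+x. ennreal (norm (f (x - Y n) - g (x - Y n))) + (ennreal (norm (g (x - Y n) - g x)) + ennreal (norm (f x - g x))) \<partial>lborel)"
        by (intro nn_integral_mono, simp add: ennreal_plus[symmetric] del: ennreal_plus) norm
      also have "\<dots> = (\<integral>\<^sup>+x. ennreal (norm (f (x - Y n) - g (x - Y n))) \<partial>lborel)
          + ((\<integral>\<^sup>+x. ennreal (norm (g (x - Y n) - g x)) \<partial>lborel) + (\<integral>\<^sup>+x. ennreal (norm (f x - g x)) \<partial>lborel))"
        by (subst nn_integral_add; (subst nn_integral_add)?) auto
      also have "(\<integral>\<^sup>+x. ennreal (norm (f (x - Y n) - g (x - Y n))) \<partial>lborel) = (\<integral>\<^sup>+x. ennreal (norm (f x - g x)) \<partial>lborel)"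
        using nn_integral_lborel_translate[of "\<lambda>x. ennreal (norm (f x - g x))" "- Y n"] by simp
      also have "(\<integral>\<^sup>+x. ennreal (norm (f x - g x)) \<partial>lborel) + ((\<integral>\<^sup>+x. ennreal (norm (g (x - Y n) - g x)) \<partial>lborel)
          + (\<integral>\<^sup>+x. ennreal (norm (f x - g x)) \<partial>lborel)) \<le> ennreal (e/3) + (ennreal (e/3) + ennreal (e/3))"
        by (intro add_mono e n)
      also have "\<dots> = ennreal e"
        using \<open>0 < e\<close> by (simp add: ennreal_plus[symmetric] del: ennreal_plus)
      finally show "(\<integral>\<^sup>+x. ennreal (norm (f (x - Y n) - f x)) \<partial>lborel) \<le> ennreal e" .
    qed
  qed
  show ?thesis
    using assms(1)
  proof (induction)
    case (base A c)
    have A [measurable]: "A \<in> sets borel"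
      using base by simp
    show ?case
    proof (rule approx)
      fix e :: real
      assume "e > 0"
      \<comment> \<open>Adding 1 in the denominator keeps the tolerance meaningful when
        \<open>c\<close> is 0.\<close>
      define e' where "e' = e / (norm c + 1)"
      have e': "e' > 0" "norm c * e' \<le> e"
        using \<open>e > 0\<close> by (auto simp: e'_def field_simps add_pos_nonneg)
      obtain U where U: "open U" "A \<subseteq> U" "emeasure lborel (U - A) < e'"
        using outer_regular_lborel[OF A e'(1)] .
      have [measurable]: "U \<in> sets borel"
        using U by simp
      have "emeasure lborel U \<le> emeasure lborel A + emeasure lborel (U - A)"
        using emeasure_subadditive[of A lborel "U - A"] U(2) by (simp add: Un_absorb1)
      also have "\<dots> < \<infinity>"
        using base order.strict_trans[OF U(3) ennreal_less_top] by (auto simp: less_top)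
      finally have fin: "emeasure lborel U < \<infinity>" .
      show "\<exists>g\<in>borel_measurable borel. (\<integral>\<^sup>+x. ennreal (norm (indicat_real A x *\<^sub>R c - g x)) \<partial>lborel) \<le> ennreal e \<and>
           (\<lambda>n. \<integral>\<^sup>+x. ennreal (norm (g (x - Y n) - g x)) \<partial>lborel) \<longlonglongrightarrow> 0"
      proof (intro bexI[of _ "\<lambda>x. indicat_real U x *\<^sub>R c"] conjI)
        have "(\<integral>\<^sup>+x. ennreal (norm (indicat_real A x *\<^sub>R c - indicat_real U x *\<^sub>R c)) \<partial>lborel)
           = (\<integral>\<^sup>+x. ennreal (norm c) * indicator (U - A) x \<partial>lborel)"
          using U(2) by (intro nn_integral_cong) (auto simp: indicator_def)
        also have "\<dots> = ennreal (norm c) * emeasure lborel (U - A)"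
          by (simp add: nn_integral_cmult)
        also have "\<dots> \<le> ennreal (norm c) * ennreal e'"
          using U(3) by (intro mult_left_mono) auto
        also have "\<dots> \<le> ennreal e"
          using e' by (simp add: ennreal_mult'[symmetric] ennreal_leI)
        finally show "(\<integral>\<^sup>+x. ennreal (norm (indicat_real A x *\<^sub>R c - indicat_real U x *\<^sub>R c)) \<partial>lborel) \<le> ennreal e" .
        have "(\<integral>\<^sup>+x. ennreal (norm (indicat_real U (x - Y n) *\<^sub>R c - indicat_real U x *\<^sub>R c)) \<partial>lborel)
            = ennreal (norm c) * ((\<integral>\<^sup>+x. indicator U x * indicator (- U) (x - Y n) \<partial>lborel)
              + (\<integral>\<^sup>+x. indicator U x * indicator (- U) (x - - Y n) \<partial>lborel))" for n
        proof -
          have "(\<integral>\<^sup>+x. ennreal (norm (indicat_real U (x - Y n) *\<^sub>R c - indicat_real U x *\<^sub>R c)) \<partial>lborel)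
            = (\<integral>\<^sup>+x. ennreal (norm c) * (indicator U x * indicator (- U) (x - Y n) + indicator U (x - Y n) * indicator (- U) x) \<partial>lborel)"
            by (intro nn_integral_cong) (auto simp: indicator_def)
          also have "\<dots> = ennreal (norm c) * ((\<integral>\<^sup>+x. indicator U x * indicator (- U) (x - Y n) \<partial>lborel)
              + (\<integral>\<^sup>+x. indicator U (x - Y n) * indicator (- U) x \<partial>lborel))"
            by (subst nn_integral_cmult, measurable) (subst nn_integral_add, auto)
          \<comment> \<open>Translating by \<open>Y n\<close> turns the points that enter
            \<open>U\<close> into points that leave it under the opposite shift, so both halves of
            the symmetric difference are covered by the lemma on open sets.\<close>
          also have "(\<integral>\<^sup>+x. indicator U (x - Y n) * indicator (- U) x \<partial>lborel)
              = (\<integral>\<^sup>+x. indicator U (x + Y n - Y n) * indicator (- U) (x + Y n) \<partial>lborel)"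
            by (rule nn_integral_lborel_translate[symmetric]) measurable
          finally show ?thesis
            by simp
        qed
        moreover have "(\<lambda>n. ennreal (norm c) * ((\<integral>\<^sup>+x. indicator U x * indicator (- U) (x - Y n) \<partial>lborel)
              + (\<integral>\<^sup>+x. indicator U x * indicator (- U) (x - - Y n) \<partial>lborel))) \<longlonglongrightarrow> ennreal (norm c) * (0 + 0)"
          by (intro tendsto_intros ennreal_tendsto_cmult nn_integral_translation_indicator_open U fin assms(2)
              tendsto_eq_rhs[OF tendsto_minus[OF assms(2)]]) auto
        ultimately show "(\<lambda>n. \<integral>\<^sup>+x. ennreal (norm (indicat_real U (x - Y n) *\<^sub>R c - indicat_real U x *\<^sub>R c)) \<partial>lborel) \<longlonglongrightarrow> 0"
          by simp
      qed simp
    qed simp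
  next
    case (add f g)
    have [measurable]: "f \<in> borel_measurable borel" "g \<in> borel_measurable borel"
      using add by auto
    have "(\<lambda>n. (\<integral>\<^sup>+x. ennreal (norm (f (x - Y n) - f x)) \<partial>lborel) + (\<integral>\<^sup>+x. ennreal (norm (g (x - Y n) - g x)) \<partial>lborel)) \<longlonglongrightarrow> 0 + 0"
      by (intro tendsto_intros add)
    then have lim: "(\<lambda>n. (\<integral>\<^sup>+x. ennreal (norm (f (x - Y n) - f x)) \<partial>lborel) + (\<integral>\<^sup>+x. ennreal (norm (g (x - Y n) - g x)) \<partial>lborel)) \<longlonglongrightarrow> 0"
      by simp
    show ?case
    proof (rule tendsto_sandwich[OF _ _ tendsto_const lim])
      have "(\<integral>\<^sup>+x. ennreal (norm (f (x - Y n) + g (x - Y n) - (f x + g x))) \<partial>lborel)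
        \<le> (\<integral>\<^sup>+x. ennreal (norm (f (x - Y n) - f x)) \<partial>lborel) + (\<integral>\<^sup>+x. ennreal (norm (g (x - Y n) - g x)) \<partial>lborel)" for n
        by (subst nn_integral_add[symmetric], simp, simp, intro nn_integral_mono)
          (simp add: ennreal_plus[symmetric] del: ennreal_plus, norm)
      then show "eventually (\<lambda>n. (\<integral>\<^sup>+x. ennreal (norm (f (x - Y n) + g (x - Y n) - (f x + g x))) \<partial>lborel)
        \<le> (\<integral>\<^sup>+x. ennreal (norm (f (x - Y n) - f x)) \<partial>lborel) + (\<integral>\<^sup>+x. ennreal (norm (g (x - Y n) - g x)) \<partial>lborel)) sequentially"
        by simp
    qed simp
  next
    case (lim f s)
    have [measurable]: "f \<in> borel_measurable borel" "\<And>i. s i \<in> borel_measurable borel"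
      using lim by auto
    have bound: "norm (s i x) \<le> 2 * norm (f x)" and pointwise: "(\<lambda>i. s i x) \<longlonglongrightarrow> f x" for i x
      using lim by simp_all
    have "(\<lambda>i. \<integral>\<^sup>+x. ennreal (norm (f x - s i x)) \<partial>lborel) \<longlonglongrightarrow> (\<integral>\<^sup>+x. 0 \<partial>(lborel :: 'a measure))"
    proof (rule nn_integral_dominated_convergence[where w = "\<lambda>x. ennreal (3 * norm (f x))"])
      show "AE x in lborel. ennreal (norm (f x - s i x)) \<le> ennreal (3 * norm (f x))" for i
      proof (intro AE_I2 ennreal_leI)
        fix x
        show "norm (f x - s i x) \<le> 3 * norm (f x)"
          using norm_triangle_ineq4[of "f x" "s i x"] bound[of i x] by simp
      qed
      show "(\<integral>\<^sup>+x. ennreal (3 * norm (f x)) \<partial>lborel) < \<infinity>"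
        using lim by (simp add: integrable_iff_bounded ennreal_mult nn_integral_cmult ennreal_mult_less_top)
      show "AE x in lborel. (\<lambda>i. ennreal (norm (f x - s i x))) \<longlonglongrightarrow> 0"
      proof (rule AE_I2)
        fix x
        have "(\<lambda>i. ennreal (norm (f x - s i x))) \<longlonglongrightarrow> ennreal (norm (f x - f x))"
          by (intro tendsto_intros tendsto_ennrealI pointwise)
        then show "(\<lambda>i. ennreal (norm (f x - s i x))) \<longlonglongrightarrow> 0"
          by simp
      qed
    qed auto
    then have "(\<lambda>i. \<integral>\<^sup>+x. ennreal (norm (f x - s i x)) \<partial>lborel) \<longlonglongrightarrow> 0"
      by simp
    then have small: "eventually (\<lambda>i. (\<integral>\<^sup>+x. ennreal (norm (f x - s i x)) \<partial>lborel) \<le> ennreal e) sequentially"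
      if "0 < e" for e
      using that by (rule ennreal_tendsto_0D)
    have trans: "(\<lambda>n. \<integral>\<^sup>+x. ennreal (norm (s i (x - Y n) - s i x)) \<partial>lborel) \<longlonglongrightarrow> 0" for i
      using lim by simp
    show ?case
    proof (rule approx)
      fix e :: real
      assume "0 < e"
      from eventually_happens[OF small[OF this]] obtain i
        where "(\<integral>\<^sup>+x. ennreal (norm (f x - s i x)) \<partial>lborel) \<le> ennreal e"
        by auto
      then show "\<exists>g\<in>borel_measurable borel. (\<integral>\<^sup>+x. ennreal (norm (f x - g x)) \<partial>lborel) \<le> ennreal e \<and>
          (\<lambda>n. \<integral>\<^sup>+x. ennreal (norm (g (x - Y n) - g x)) \<partial>lborel) \<longlonglongrightarrow> 0"
        using trans[of i] by (intro bexI[of _ "s i"]) auto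
    qed simp
  qed
qed

lemma torus_translation_tendsto:
  fixes f :: "real ^ 'n::finite \<Rightarrow> 'b::euclidean_space"
  assumes [measurable]: "f \<in> borel_measurable borel" and per: "torus_periodic f"
    and fin: "(\<integral>\<^sup>+x\<in>torus_cell. norm (f x) \<partial>lborel) < \<infinity>" and Y: "Y \<longlonglongrightarrow> 0"
  shows "(\<lambda>n. \<integral>\<^sup>+x\<in>torus_cell. ennreal (norm (f (x - Y n) - f x)) \<partial>lborel) \<longlonglongrightarrow> 0"
proof -
  \<comment> \<open>This cube contains every shift of the unit cell by a vector of norm below 1, so
    cutting \<open>f\<close> off outside it changes nothing on the cell once \<open>Y n\<close> is
    small.\<close>
  define S :: "(real ^ 'n) set" where "S = cbox (\<chi> i. -1) (\<chi> i. 2)"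
  have [measurable]: "S \<in> sets borel"
    by (simp add: S_def)
  define f' where "f' x = indicat_real S x *\<^sub>R f x" for x
  have [measurable]: "f' \<in> borel_measurable borel"
    by (simp add: f'_def[abs_def])
  have "(\<integral>\<^sup>+x\<in>S. ennreal (norm (f x)) \<partial>lborel) < \<infinity>"
    by (rule nn_integral_torus_bounded)
      (use per fin in \<open>auto simp: S_def torus_periodic_def bounded_cbox\<close>)
  also have "(\<integral>\<^sup>+x\<in>S. ennreal (norm (f x)) \<partial>lborel) = (\<integral>\<^sup>+x. ennreal (norm (f' x)) \<partial>lborel)"
    by (intro nn_integral_cong) (auto simp: f'_def indicator_def)
  finally have "integrable lborel f'"
    by (simp add: integrable_iff_bounded)
  note lim = nn_integral_translation_tendsto[OF this Y]
  have "eventually (\<lambda>n. dist (Y n) 0 < 1) sequentially"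
    using tendstoD[OF Y, of 1] by simp
  then have "eventually (\<lambda>n. (\<integral>\<^sup>+x\<in>torus_cell. ennreal (norm (f (x - Y n) - f x)) \<partial>lborel)
       \<le> (\<integral>\<^sup>+x. ennreal (norm (f' (x - Y n) - f' x)) \<partial>lborel)) sequentially"
  proof eventually_elim
    fix n
    assume "dist (Y n) 0 < 1"
    then have "\<bar>Y n $ i\<bar> < 1" for i
      using component_le_norm_cart[of "Y n" i] by simp
    then have "x \<in> S" "x - Y n \<in> S" if "x \<in> torus_cell" for x
      using that unfolding S_def torus_cell_def mem_box_cart
      by (auto simp: abs_less_iff algebra_simps) (smt (verit) zero_index one_index)+
    then show "(\<integral>\<^sup>+x\<in>torus_cell. ennreal (norm (f (x - Y n) - f x)) \<partial>lborel)
       \<le> (\<integral>\<^sup>+x. ennreal (norm (f' (x - Y n) - f' x)) \<partial>lborel)"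
      by (intro nn_integral_mono) (auto simp: f'_def indicator_def)
  qed
  then show ?thesis
    by (intro tendsto_sandwich[OF _ _ tendsto_const lim]) auto
qed

section \<open>Separable trigonometric kernels\<close>

text \<open>The same factor appears in both variables. This builds in the symmetry of the kernel and
  turns the associated bilinear form into a sum of inner products of coefficients, each of which is
  an integral against a fixed smooth function.\<close>

definition separable_kernel :: "(real ^ 'n \<Rightarrow> real) \<Rightarrow> bool"
  where "separable_kernel k \<longleftrightarrow> (\<exists>L. set L \<subseteq> torus_smooth \<and> (\<forall>x z. k (x - z) = (\<Sum>a\<leftarrow>L. a x * a z)))"

lemma torus_smooth_const: "(\<lambda>x. c) \<in> torus_smooth"
  by (simp add: torus_smooth_def torus_periodic_def smooth_const)

lemma torus_smooth_scaleR:
  "f \<in> torus_smooth \<Longrightarrow> g \<in> torus_smooth \<Longrightarrow> (\<lambda>x. f x *\<^sub>R g x) \<in> torus_smooth"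
  by (simp add: torus_smooth_def torus_periodic_def smooth_scaleR)

lemma torus_smooth_mult:
  fixes f g :: "real ^ 'n::finite \<Rightarrow> real"
  shows "f \<in> torus_smooth \<Longrightarrow> g \<in> torus_smooth \<Longrightarrow> (\<lambda>x. f x * g x) \<in> torus_smooth"
  using torus_smooth_scaleR[of f g] by simp

lemma torus_smooth_sum:
  "(\<And>i. i \<in> I \<Longrightarrow> f i \<in> torus_smooth) \<Longrightarrow> (\<lambda>x. \<Sum>i\<in>I. f i x) \<in> torus_smooth"
  by (auto simp: torus_smooth_def torus_periodic_def intro!: smooth_sum)

lemma torus_smooth_coordinate:
  assumes "smooth f" "\<And>t. f (t + 1) = f t"
  shows "(\<lambda>x :: real ^ 'n::finite. f (x $ i)) \<in> torus_smooth"
proof -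
  have "f (x $ i + axis j 1 $ i) = f (x $ i)" for x :: "real ^ 'n" and j
    using assms(2) by (simp add: axis_def)
  moreover have "smooth (\<lambda>x :: real ^ 'n. f (x $ i))"
    using smooth_compose_linear[OF bounded_linear_vec_nth assms(1)] .
  ultimately show ?thesis
    by (simp add: torus_smooth_def torus_periodic_def)
qed

text \<open>Equal factors can represent only a nonnegative constant; each of them is its square
  root.\<close>

lemma separable_kernel_const: "0 \<le> c \<Longrightarrow> separable_kernel (\<lambda>y. c)"
  unfolding separable_kernel_def
  by (intro exI[of _ "[\<lambda>x. sqrt c]"]) (auto simp: torus_smooth_const)

text \<open>The addition theorem splits the cosine of a difference into cosine times cosine plus
  sine times sine, which is already of the required form; the constant 1 contributes one more
  factor.\<close>

lemma separable_kernel_cos: "separable_kernel (\<lambda>y :: real ^ 'n::finite. 1 + cos (2 * pi * y $ i))"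
  unfolding separable_kernel_def
proof (intro exI[of _ "[\<lambda>x. 1, \<lambda>x. cos (2 * pi * x $ i), \<lambda>x. sin (2 * pi * x $ i)]"] conjI)
  show "set [\<lambda>x. 1, \<lambda>x. cos (2 * pi * x $ i), \<lambda>x. sin (2 * pi * x $ i)] \<subseteq> (torus_smooth :: (real ^ 'n \<Rightarrow> real) set)"
    using torus_smooth_coordinate[OF smooth_cos[of "2 * pi"], of i]
      torus_smooth_coordinate[OF smooth_sin[of "2 * pi" 0], of i]
    by (simp add: torus_smooth_const sin_add cos_add distrib_left)
qed (simp add: cos_diff right_diff_distrib)

lemma separable_kernel_mult:
  fixes k l :: "real ^ 'n::finite \<Rightarrow> real"
  assumes "separable_kernel k" "separable_kernel l"
  shows "separable_kernel (\<lambda>y. k y * l y)"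
proof -
  obtain L M where L: "set L \<subseteq> torus_smooth" "\<And>x z. k (x - z) = (\<Sum>a\<leftarrow>L. a x * a z)"
    and M: "set M \<subseteq> torus_smooth" "\<And>x z. l (x - z) = (\<Sum>a\<leftarrow>M. a x * a z)"
    using assms unfolding separable_kernel_def by blast
  let ?N = "concat (map (\<lambda>a. map (\<lambda>b x. a x * b x) M) L)"
  have inner: "(\<Sum>c\<leftarrow>map (\<lambda>b x. a x * b x) M. c x * c z) = a x * a z * (\<Sum>b\<leftarrow>M. b x * b z)"
    for a :: "real ^ 'n \<Rightarrow> real" and x z
    by (induction M) (simp_all add: algebra_simps)
  have "(\<Sum>c\<leftarrow>?N. c x * c z) = (\<Sum>a\<leftarrow>L. a x * a z) * (\<Sum>b\<leftarrow>M. b x * b z)" for x z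
    using inner by (induction L) (simp_all add: algebra_simps)
  moreover have "set ?N \<subseteq> torus_smooth"
    using L(1) M(1) by (auto intro!: torus_smooth_mult)
  ultimately show ?thesis
    unfolding separable_kernel_def using L(2) M(2) by (intro exI[of _ ?N]) simp
qed

lemma separable_kernel_power:
  fixes k :: "real ^ 'n::finite \<Rightarrow> real"
  shows "separable_kernel k \<Longrightarrow> separable_kernel (\<lambda>y. k y ^ n)"
  by (induction n) (auto intro: separable_kernel_mult separable_kernel_const)

lemma separable_kernel_prod:
  fixes k :: "'i \<Rightarrow> real ^ 'n::finite \<Rightarrow> real"
  shows "(\<And>i. i \<in> I \<Longrightarrow> separable_kernel (k i)) \<Longrightarrow> separable_kernel (\<lambda>y. \<Prod>i\<in>I. k i y)"
  by (induction I rule: infinite_finite_induct) (auto intro: separable_kernel_mult separable_kernel_const)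

lemma separable_kernelE:
  assumes "separable_kernel k"
  obtains m and a :: "nat \<Rightarrow> real ^ 'n \<Rightarrow> real"
  where "\<And>j. a j \<in> torus_smooth" "\<And>x z. k (x - z) = (\<Sum>j<m. a j x * a j z)"
proof -
  obtain L where L: "set L \<subseteq> torus_smooth" "\<And>x z. k (x - z) = (\<Sum>a\<leftarrow>L. a x * a z)"
    using assms unfolding separable_kernel_def by blast
  \<comment> \<open>Indices beyond the list receive the zero function, so that smoothness of
    \<open>a j\<close> holds for every \<open>j\<close> without a range condition.\<close>
  let ?a = "\<lambda>j. if j < length L then L ! j else (\<lambda>x. 0)"
  show ?thesis
  proof (rule that)
    show "?a j \<in> torus_smooth" for j
      using L(1) nth_mem by (auto intro: torus_smooth_const)
    show "k (x - z) = (\<Sum>j<length L. ?a j x * ?a j z)" for x z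
      unfolding L(2) by (simp add: sum_list_sum_nth atLeast0LessThan)
  qed
qed

section \<open>The kernels\<close>

text \<open>This is cos(pi t)^(2n), a nonnegative trigonometric polynomial of period 1 with its
  peaks at the integers. For large \<open>n\<close> it resembles a Gaussian of width of order
  n^(-1/2) around each of them.\<close>

definition cos_kernel1 :: "nat \<Rightarrow> real \<Rightarrow> real"
  where "cos_kernel1 n t = ((1 + cos (2 * pi * t)) / 2) ^ n"

definition cos_kernel_mass :: "nat \<Rightarrow> real"
  where "cos_kernel_mass n = (LINT y:torus_cell|lborel. \<Prod>i\<in>UNIV. cos_kernel1 n ((y :: real ^ 3) $ i))"

definition cos_kernel :: "nat \<Rightarrow> real ^ 3 \<Rightarrow> real"
  where "cos_kernel n y = (\<Prod>i\<in>UNIV. cos_kernel1 n (y $ i)) / cos_kernel_mass n"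

section \<open>Gaussian bounds for the kernel from above and a lower bound for its mass\<close>

lemma cos_kernel1_nonneg: "0 \<le> cos_kernel1 n t"
proof -
  have "0 \<le> 1 + cos (2 * pi * t)"
    using cos_ge_minus_one[of "2 * pi * t"] by linarith
  then show ?thesis
    unfolding cos_kernel1_def by (intro zero_le_power divide_nonneg_pos) auto
qed

text \<open>Maclaurin expansion of order 4, whose remainder contains a cosine and is therefore at
  most x^4/24; negative arguments follow by evenness.\<close>

lemma cos_upper_bound:
  fixes x :: real
  shows "cos x \<le> 1 - x ^ 2 / 2 + x ^ 4 / 24"
proof -
  have *: "cos x \<le> 1 - x ^ 2 / 2 + x ^ 4 / 24" if pos: "x > 0" for x :: real
  proof -
    obtain t where t: "cos x = (\<Sum>m<4. cos_coeff m * x ^ m) + (cos (t + 1/2 * real 4 * pi) / fact 4) * x ^ 4"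
      using Maclaurin_cos_expansion2[OF pos, of 4] by auto
    have "cos (t + 1/2 * real 4 * pi) / fact 4 * x ^ 4 \<le> 1 / fact 4 * x ^ 4"
      by (intro mult_right_mono divide_right_mono) auto
    moreover have "(\<Sum>m<4. cos_coeff m * x ^ m) = 1 - x ^ 2 / 2"
      by (simp add: numeral_eq_Suc cos_coeff_Suc sin_coeff_Suc)
    ultimately show ?thesis
      unfolding t by (simp add: fact_numeral)
  qed
  show ?thesis
    using *[of x] *[of "- x"] by (cases x "0::real" rule: linorder_cases) auto
qed

lemma pi_square_bounds: "9 \<le> pi ^ 2" "pi ^ 2 \<le> 10"
proof -
  have "3 \<le> pi" "pi \<le> 3.15"
    using pi_approx by auto
  then have "3 ^ 2 \<le> pi ^ 2" "pi ^ 2 \<le> 3.15 ^ 2"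
    by (intro power_mono; simp)+
  then show "9 \<le> pi ^ 2" "pi ^ 2 \<le> 10"
    by (simp_all add: power_divide)
qed

text \<open>On the centred interval (1 + cos(2 pi t))/2 is at most 1 - t^2, hence at most exp(-t^2);
  the n-th power gives the claim.\<close>

lemma cos_kernel1_le_exp:
  assumes "\<bar>t\<bar> \<le> 1/2"
  shows "cos_kernel1 n t \<le> exp (- real n * t ^ 2)"
proof -
  have t: "t ^ 2 \<le> 1/4"
    using power_mono[OF assms, of 2] by (simp add: power2_eq_square)
  have "cos (2 * pi * t) \<le> 1 - (2 * pi * t) ^ 2 / 2 + (2 * pi * t) ^ 4 / 24"
    by (rule cos_upper_bound)
  also have "\<dots> = 1 - 2 * (pi ^ 2 * t ^ 2) * (1 - pi ^ 2 * t ^ 2 / 3)"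
    by (simp add: field_simps power2_eq_square power4_eq_xxxx)
  \<comment> \<open>Since pi^2 t^2 is at most 10/4, the bracket is at least 1/6; and pi^2 t^2 is at
    least 9 t^2. The product is at least (3/2) t^2, more than needed.\<close>
  also have "\<dots> \<le> 1 - 2 * t ^ 2"
  proof -
    have "pi ^ 2 * t ^ 2 \<le> 10 * (1/4)"
      by (intro mult_mono t pi_square_bounds) auto
    moreover have "9 * t ^ 2 \<le> pi ^ 2 * t ^ 2"
      by (intro mult_right_mono pi_square_bounds) auto
    ultimately have "(9 * t ^ 2) * (1/6) \<le> (pi ^ 2 * t ^ 2) * (1 - pi ^ 2 * t ^ 2 / 3)"
      using zero_le_power2[of t] by (intro mult_mono[of "9 * t ^ 2" "pi ^ 2 * t ^ 2" "1/6"]) linarith+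
    moreover have "0 \<le> t ^ 2"
      by simp
    ultimately show ?thesis
      by linarith
  qed
  finally have "(1 + cos (2 * pi * t)) / 2 \<le> 1 + (- (t ^ 2))"
    by simp
  also have "\<dots> \<le> exp (- (t ^ 2))"
    by (rule exp_ge_add_one_self)
  finally have "(1 + cos (2 * pi * t)) / 2 \<le> exp (- (t ^ 2))" .
  moreover have "0 \<le> (1 + cos (2 * pi * t)) / 2"
    using cos_kernel1_nonneg[of 1 t] by (simp add: cos_kernel1_def)
  ultimately have "cos_kernel1 n t \<le> exp (- (t ^ 2)) ^ n"
    unfolding cos_kernel1_def by (intro power_mono) auto
  then show ?thesis
    by (simp add: exp_of_nat_mult[symmetric])
qed

text \<open>The base equals 1 - sin(pi t)^2, and the width 1/(5 sqrt n) makes pi^2 t^2 at most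
  10/(25 n) = 2/(5n). Bernoulli's inequality then leaves 3/5 after taking the n-th power.\<close>

lemma cos_kernel1_ge:
  assumes "n \<ge> 1" "0 \<le> t" "t \<le> 1 / (5 * sqrt n)"
  shows "1/2 \<le> cos_kernel1 n t"
proof -
  have "t ^ 2 \<le> (1 / (5 * sqrt n)) ^ 2"
    using assms by (intro power_mono) auto
  then have t: "t ^ 2 \<le> 1 / (25 * n)"
    using assms(1) by (simp add: power_divide power_mult_distrib)
  have "pi ^ 2 * t ^ 2 \<le> 10 * (1 / (25 * n))"
    by (intro mult_mono t pi_square_bounds) auto
  then have b: "pi ^ 2 * t ^ 2 \<le> 2 / (5 * n)"
    by simp
  have "1 - cos (2 * pi * t) = 2 * sin (pi * t) ^ 2"
    using cos_double_sin[of "pi * t"] by (simp add: mult_ac)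
  moreover have "sin (pi * t) ^ 2 \<le> (pi * t) ^ 2"
    using abs_sin_x_le_abs_x[of "pi * t"] by (simp add: abs_le_square_iff)
  ultimately have "1 + (- (2 / (5 * n))) \<le> (1 + cos (2 * pi * t)) / 2"
    using b by (simp add: power_mult_distrib)
  moreover have nb: "- 1 \<le> - (2 / (5 * real n))"
  proof -
    have "2 / (5 * real n) \<le> 2 / 5"
      using assms(1) by (intro divide_left_mono) auto
    then show ?thesis
      by linarith
  qed
  ultimately have "(1 + (- (2 / (5 * n)))) ^ n \<le> cos_kernel1 n t"
    unfolding cos_kernel1_def by (intro power_mono) auto
  moreover have "1 + real n * (- (2 / (5 * n))) \<le> (1 + (- (2 / (5 * n)))) ^ n"
    using nb by (intro Bernoulli_inequality) simp
  moreover have "1 + real n * (- (2 / (5 * n))) = 3/5"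
    using assms(1) by (simp add: field_simps)
  ultimately show ?thesis
    by linarith
qed

lemma continuous_on_cos_kernel1 [continuous_intros]:
  fixes f :: "'a::t2_space \<Rightarrow> real"
  shows "continuous_on S f \<Longrightarrow> continuous_on S (\<lambda>x. cos_kernel1 n (f x))"
  unfolding cos_kernel1_def
  by (intro continuous_on_power continuous_on_divide continuous_on_add continuous_on_cos continuous_on_mult continuous_on_const) auto

text \<open>On the cube of side 1/(5 sqrt n) at the origin each of the three factors is at least
  1/2. The constant is 8 for the factors times 5^3 for the volume.\<close>

lemma cos_kernel_mass_ge:
  assumes "n \<ge> 1"
  shows "1 / (1000 * sqrt n ^ 3) \<le> cos_kernel_mass n"
proof -
  define \<delta> where "\<delta> = 1 / (5 * sqrt n)"
  define S :: "(real ^ 3) set" where "S = cbox 0 (\<chi> i. \<delta>)"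
  have "1 \<le> 5 * sqrt n"
    using real_sqrt_ge_one[of n] assms by linarith
  then have \<delta>: "0 < \<delta>" "\<delta> \<le> 1"
    unfolding \<delta>_def using assms by (auto simp: divide_le_eq)
  have S: "S \<subseteq> torus_cell"
    using \<delta> by (auto simp: S_def torus_cell_def mem_box_cart) (meson order_trans)
  have "1/8 * measure lborel S = (LINT y:S|lborel. 1/8 :: real)"
    by (simp add: S_def set_lebesgue_integral_def)
  also have "\<dots> \<le> cos_kernel_mass n"
    unfolding cos_kernel_mass_def set_lebesgue_integral_def
  proof (rule integral_mono)
    show "integrable lborel (\<lambda>y. indicat_real S y *\<^sub>R (1/8 :: real))"
      unfolding S_def by (intro integrable_scaleR_left integrable_real_indicator emeasure_lborel_cbox_finite) auto
    show "integrable lborel (\<lambda>y :: real ^ 3. indicat_real torus_cell y *\<^sub>R (\<Prod>i\<in>UNIV. cos_kernel1 n (y $ i)))"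
      unfolding torus_cell_def set_integrable_def[symmetric]
      by (intro borel_integrable_compact[unfolded set_integrable_def[symmetric]] continuous_intros) auto
    fix y :: "real ^ 3"
    show "indicat_real S y *\<^sub>R (1/8 :: real) \<le> indicat_real torus_cell y *\<^sub>R (\<Prod>i\<in>UNIV. cos_kernel1 n (y $ i))"
    proof (cases "y \<in> S")
      case True
      then have "1/2 \<le> cos_kernel1 n (y $ i)" for i
        using cos_kernel1_ge[OF assms] by (auto simp: S_def mem_box_cart \<delta>_def)
      then have "(\<Prod>i\<in>(UNIV :: 3 set). 1/2) \<le> (\<Prod>i\<in>UNIV. cos_kernel1 n (y $ i))"
        by (intro prod_mono) auto
      then show ?thesis
        using True S by (auto simp: indicator_def power_divide)
    qed (simp add: prod_nonneg cos_kernel1_nonneg)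
  qed
  also have "measure lborel S = \<delta> ^ 3"
    using \<delta> by (simp add: S_def content_cbox_if_cart interval_eq_empty_cart)
  finally show ?thesis
    by (simp add: \<delta>_def power_divide power_mult_distrib)
qed

lemma cos_kernel_mass_pos: "n \<ge> 1 \<Longrightarrow> 0 < cos_kernel_mass n"
  by (rule order.strict_trans2[OF _ cos_kernel_mass_ge]) (auto simp: zero_less_mult_iff)

lemma separable_cos_kernel:
  assumes "n \<ge> 1"
  shows "separable_kernel (cos_kernel n)"
proof -
  have "separable_kernel (\<lambda>y. (1 / cos_kernel_mass n) * (\<Prod>i\<in>UNIV. ((1/2) * (1 + cos (2 * pi * (y :: real ^ 3) $ i))) ^ n))"
    using cos_kernel_mass_pos[OF assms]
    by (intro separable_kernel_mult separable_kernel_prod separable_kernel_power separable_kernel_const separable_kernel_cos) auto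
  then show ?thesis
    by (simp add: cos_kernel_def[abs_def] cos_kernel1_def)
qed

lemma cos_kernel_nonneg: "0 \<le> cos_kernel n y"
proof -
  have "0 \<le> cos_kernel_mass n"
    unfolding cos_kernel_mass_def set_lebesgue_integral_def
    by (intro integral_nonneg_AE AE_I2) (simp add: prod_nonneg cos_kernel1_nonneg)
  then show ?thesis
    by (simp add: cos_kernel_def prod_nonneg cos_kernel1_nonneg)
qed

lemma centred_cell_abs: "y \<in> centred_cell \<Longrightarrow> \<bar>y $ i\<bar> \<le> 1/2"
  by (auto simp: centred_cell_def mem_box_cart abs_le_iff) (smt (verit) field_sum_of_halves)

lemma norm_vec_square: "norm (y :: real ^ 'n::finite) ^ 2 = (\<Sum>i\<in>UNIV. (y $ i) ^ 2)"
  by (simp add: norm_vec_def L2_set_def sum_nonneg)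

lemma prod_cos_kernel1_le_exp:
  fixes y :: "real ^ 3"
  assumes "y \<in> centred_cell"
  shows "(\<Prod>i\<in>UNIV. cos_kernel1 n (y $ i)) \<le> exp (- real n * norm y ^ 2)"
proof -
  have "\<bar>y $ i\<bar> \<le> 1/2" for i
    using assms by (rule centred_cell_abs)
  then have "(\<Prod>i\<in>UNIV. cos_kernel1 n (y $ i)) \<le> (\<Prod>i\<in>UNIV. exp (- real n * (y $ i) ^ 2))"
    by (intro prod_mono conjI cos_kernel1_nonneg cos_kernel1_le_exp)
  then show ?thesis
    by (simp add: exp_sum[symmetric] norm_vec_square sum_distrib_left)
qed

lemma inverse_mass_le: "n \<ge> 1 \<Longrightarrow> 1 / cos_kernel_mass n \<le> 1000 * sqrt n ^ 3"
  using cos_kernel_mass_ge[of n] cos_kernel_mass_pos[of n] by (simp add: field_simps)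

lemma cos_kernel_le_exp:
  assumes "y \<in> centred_cell" "n \<ge> 1"
  shows "cos_kernel n y \<le> 1000 * sqrt n ^ 3 * exp (- ((sqrt n * norm y) ^ 2))"
proof -
  have "(1 / cos_kernel_mass n) * (\<Prod>i\<in>UNIV. cos_kernel1 n (y $ i)) \<le> (1000 * sqrt n ^ 3) * exp (- real n * norm y ^ 2)"
    using assms by (intro mult_mono inverse_mass_le prod_cos_kernel1_le_exp) (auto simp: prod_nonneg cos_kernel1_nonneg)
  then show ?thesis
    by (simp add: cos_kernel_def power_mult_distrib)
qed

text \<open>From exp(u^2) \<ge> (u^2/2)^2 the Gaussian is at most 4/u^4 with u = sqrt n times the
  norm. Against the normalisation (sqrt n)^3 this leaves one negative power of sqrt n, so the kernel
  tends to 0 uniformly away from the origin.\<close>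

lemma cos_kernel_away_bound:
  assumes "y \<in> centred_cell" "n \<ge> 1" "\<delta> > 0" "\<delta> \<le> norm y"
  shows "cos_kernel n y \<le> 4000 / (sqrt n * \<delta> ^ 4)"
proof -
  define u where "u = sqrt n * norm y"
  have "0 < norm y"
    using assms by linarith
  then have u: "u > 0" "sqrt n * \<delta> \<le> u"
    using assms by (simp_all add: u_def)
  have "(u ^ 2 / 2) ^ 2 \<le> (1 + u ^ 2 / 2) ^ 2"
    by (intro power_mono) auto
  also have "\<dots> \<le> exp (u ^ 2)"
    using exp_ge_one_plus_x_over_n_power_n[of 2 "u ^ 2"] order_trans[of "-2" 0 "u ^ 2"] by simp
  finally have "exp (- (u ^ 2)) \<le> 4 / u ^ 4"
    using u by (simp add: exp_minus field_simps power2_eq_square power4_eq_xxxx)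
  also have "\<dots> \<le> 4 / (sqrt n * \<delta>) ^ 4"
    using u assms by (intro divide_left_mono power_mono mult_pos_pos) auto
  finally have "1000 * sqrt n ^ 3 * exp (- (u ^ 2)) \<le> 1000 * sqrt n ^ 3 * (4 / (sqrt n * \<delta>) ^ 4)"
    by (intro mult_left_mono) auto
  also have "\<dots> = 4000 / (sqrt n * \<delta> ^ 4)"
    using assms by (simp add: field_simps eval_nat_numeral)
  finally show ?thesis
    using cos_kernel_le_exp[OF assms(1,2)] by (simp add: u_def)
qed

section \<open>Size and decay of the gradient of the kernel\<close>

lemma cos_kernel1_derivative:
  "(cos_kernel1 n has_real_derivative
     (real n * ((1 + cos (2 * pi * t)) / 2) ^ (n - 1) * (- pi * sin (2 * pi * t)))) (at t)"
  unfolding cos_kernel1_def[abs_def] by (auto intro!: derivative_eq_intros)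

lemma partial_cos_kernel:
  "partial k (cos_kernel n) y =
     (real n * ((1 + cos (2 * pi * y $ k)) / 2) ^ (n - 1) * (- pi * sin (2 * pi * y $ k)))
       * (\<Prod>j\<in>UNIV - {k}. cos_kernel1 n (y $ j)) / cos_kernel_mass n"
proof -
  let ?d = "\<lambda>t. real n * ((1 + cos (2 * pi * t)) / 2) ^ (n - 1) * (- pi * sin (2 * pi * t))"
  have "((\<lambda>y. cos_kernel1 n (y $ i)) has_derivative (\<lambda>v. ?d (y $ i) * v $ i)) (at y)" for i :: 3
    using has_derivative_compose[OF bounded_linear_imp_has_derivative[OF bounded_linear_vec_nth]
        cos_kernel1_derivative[unfolded has_field_derivative_def, of n "y $ i"]] .
  then have "((\<lambda>y. \<Prod>i\<in>UNIV. cos_kernel1 n (y $ i)) has_derivative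
      (\<lambda>v. \<Sum>i\<in>UNIV. (?d (y $ i) * v $ i) * (\<Prod>j\<in>UNIV - {i}. cos_kernel1 n (y $ j)))) (at y)"
    by (rule has_derivative_prod)
  then have "(cos_kernel n has_derivative
      (\<lambda>v. (\<Sum>i\<in>UNIV. (?d (y $ i) * v $ i) * (\<Prod>j\<in>UNIV - {i}. cos_kernel1 n (y $ j))) / cos_kernel_mass n)) (at y)"
    unfolding cos_kernel_def[abs_def] divide_inverse by (rule has_derivative_mult_left)
  from frechet_derivative_at[OF this, symmetric]
  have "partial k (cos_kernel n) y = (\<Sum>i\<in>UNIV. (?d (y $ i) * axis k 1 $ i) * (\<Prod>j\<in>UNIV - {i}. cos_kernel1 n (y $ j))) / cos_kernel_mass n"
    by (simp add: partial_def)
  also have "(\<Sum>i\<in>UNIV. (?d (y $ i) * axis k 1 $ i) * (\<Prod>j\<in>UNIV - {i}. cos_kernel1 n (y $ j)))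
      = (\<Sum>i\<in>UNIV. if i = k then ?d (y $ i) * (\<Prod>j\<in>UNIV - {i}. cos_kernel1 n (y $ j)) else 0)"
    by (intro sum.cong) (auto simp: axis_def)
  also have "\<dots> = ?d (y $ k) * (\<Prod>j\<in>UNIV - {k}. cos_kernel1 n (y $ j))"
    by (subst sum.delta) auto
  finally show ?thesis .
qed

text \<open>A majorant, up to a constant, of u exp(-u^2). The exponent 5 is one more than the power
  of the radius by which the increments are controlled, so that the sum over dyadic scales is
  geometric.\<close>

definition decay :: "real \<Rightarrow> real"
  where "decay u = (if u \<le> 1 then 1 else 1 / u ^ 5)"

text \<open>For u above 1, exp(u^2) \<ge> (u^2/3)^3 = u^6/27, which is the source of the
  constant.\<close>

lemma gaussian_le_decay:
  assumes "u \<ge> 0"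
  shows "u * exp (- (u ^ 2)) \<le> 27 * decay u"
proof (cases "u \<le> 1")
  case True
  have "u * exp (- (u ^ 2)) \<le> 1 * 1"
    using True assms by (intro mult_mono) auto
  then show ?thesis
    using True by (simp add: decay_def)
next
  case False
  have "(u ^ 2 / 3) ^ 3 \<le> (1 + u ^ 2 / 3) ^ 3"
    by (intro power_mono) auto
  also have "\<dots> \<le> exp (u ^ 2)"
    using exp_ge_one_plus_x_over_n_power_n[of 3 "u ^ 2"] order_trans[of "-3" 0 "u ^ 2"] by simp
  finally show ?thesis
    using False by (simp add: decay_def exp_minus field_simps eval_nat_numeral)
qed

text \<open>The derivative produces a factor \<open>n\<close>, and the sine produces a factor of the
  norm. Writing s = sqrt n, the bound s^3 n (norm y) equals s^4 (s norm y), so the factor of the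
  norm is absorbed into the Gaussian in the scaled variable.\<close>

lemma partial_cos_kernel_bound:
  assumes y: "y \<in> centred_cell" and n: "n \<ge> 1"
  shows "\<bar>partial k (cos_kernel n) y\<bar> \<le> 2000000 * sqrt n ^ 4 * decay (sqrt n * norm y)"
proof -
  have y2: "\<bar>y $ i\<bar> \<le> 1/2" for i
    using y by (rule centred_cell_abs)
  have "norm y ^ 2 \<le> (\<Sum>i\<in>(UNIV :: 3 set). (1/2) ^ 2)"
    unfolding norm_vec_square by (intro sum_mono) (metis y2 abs_ge_zero power2_abs power_mono)
  then have ny: "norm y ^ 2 \<le> 1"
    by (simp add: power2_eq_square)
  have "\<bar>sin (2 * pi * y $ k)\<bar> \<le> \<bar>2 * pi * y $ k\<bar>"
    by (rule abs_sin_x_le_abs_x)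
  also have "\<dots> \<le> 2 * pi * norm y"
    using component_le_norm_cart[of y k] by (simp add: abs_mult)
  finally have "pi * \<bar>sin (2 * pi * y $ k)\<bar> \<le> pi * (2 * pi * norm y)"
    by (intro mult_left_mono) auto
  also have "\<dots> = 2 * pi ^ 2 * norm y"
    by (simp add: power2_eq_square)
  also have "\<dots> \<le> 20 * norm y"
    using pi_square_bounds by (intro mult_right_mono) auto
  finally have s: "pi * \<bar>sin (2 * pi * y $ k)\<bar> \<le> 20 * norm y" .
  \<comment> \<open>Differentiation lowers one exponent to \<open>n - 1\<close>. The missing
    Gaussian factor is exp of the square of one coordinate, at most exp 1 and so at most 3.\<close>
  have e: "cos_kernel1 (n - 1) (y $ k) * (\<Prod>j\<in>UNIV - {k}. cos_kernel1 n (y $ j)) \<le> 3 * exp (- real n * norm y ^ 2)"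
  proof -
    have "cos_kernel1 (n - 1) (y $ k) * (\<Prod>j\<in>UNIV - {k}. cos_kernel1 n (y $ j))
        \<le> exp (- real (n - 1) * (y $ k) ^ 2) * (\<Prod>j\<in>UNIV - {k}. exp (- real n * (y $ j) ^ 2))"
      by (intro mult_mono prod_mono conjI cos_kernel1_nonneg cos_kernel1_le_exp y2 prod_nonneg) auto
    also have "\<dots> = exp ((y $ k) ^ 2) * (exp (- real n * (y $ k) ^ 2) * (\<Prod>j\<in>UNIV - {k}. exp (- real n * (y $ j) ^ 2)))"
      using n by (simp add: mult_exp_exp of_nat_diff algebra_simps flip: mult.assoc)
    also have "\<dots> = exp ((y $ k) ^ 2) * exp (- real n * norm y ^ 2)"
      by (subst prod.remove[symmetric, of UNIV k "\<lambda>j. exp (- real n * (y $ j) ^ 2)"])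
        (simp_all add: exp_sum[symmetric] norm_vec_square sum_distrib_left)
    also have "\<dots> \<le> 3 * exp (- real n * norm y ^ 2)"
    proof (intro mult_right_mono)
      have "(y $ k) ^ 2 \<le> 1"
        using ny component_le_norm_cart[of y k] by (metis abs_ge_zero order_trans power2_abs power_mono)
      then have "exp ((y $ k) ^ 2) \<le> exp 1"
        by simp
      then show "exp ((y $ k) ^ 2) \<le> 3"
        using exp_le by linarith
    qed auto
    finally show ?thesis .
  qed
  have "\<bar>partial k (cos_kernel n) y\<bar> = (1 / cos_kernel_mass n) *
     (real n * (pi * \<bar>sin (2 * pi * y $ k)\<bar>) * (cos_kernel1 (n - 1) (y $ k) * (\<Prod>j\<in>UNIV - {k}. cos_kernel1 n (y $ j))))"
    unfolding partial_cos_kernel cos_kernel1_def[symmetric]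
    using cos_kernel_mass_pos[OF n] cos_kernel1_nonneg[of "n - 1" "y $ k"]
    by (simp add: abs_mult abs_prod cos_kernel1_nonneg mult.assoc)
  also have "\<dots> \<le> (1000 * sqrt n ^ 3) * (real n * (20 * norm y) * (3 * exp (- real n * norm y ^ 2)))"
    using cos_kernel_mass_pos[OF n]
    by (intro mult_mono inverse_mass_le n s e mult_nonneg_nonneg prod_nonneg) (auto simp: cos_kernel1_nonneg)
  \<comment> \<open>The constant is 1000 from the mass, 20 from the sine and 3 from the lowered
    exponent; times 27 it stays below 2000000.\<close>
  also have "\<dots> = 60000 * sqrt n ^ 4 * ((sqrt n * norm y) * exp (- ((sqrt n * norm y) ^ 2)))"
    by (simp add: eval_nat_numeral) (simp add: algebra_simps real_sqrt_mult_self)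
  also have "\<dots> \<le> 60000 * sqrt n ^ 4 * (27 * decay (sqrt n * norm y))"
    by (intro mult_left_mono gaussian_le_decay) auto
  also have "\<dots> \<le> 2000000 * sqrt n ^ 4 * decay (sqrt n * norm y)"
    by (simp add: mult_right_mono decay_def)
  finally show ?thesis .
qed

section \<open>The normalised measure of the torus\<close>

text \<open>The set integrals of the statement become integrals for a finite measure of total mass
  1, to which Tonelli, product measures and constant bounds apply directly.\<close>

definition torus_measure :: "(real ^ 'n) measure"
  where "torus_measure = density lborel (indicator torus_cell)"

lemma space_torus_measure [simp]: "space torus_measure = UNIV"
  by (simp add: torus_measure_def)

lemma sets_torus_measure [simp, measurable_cong]: "sets torus_measure = sets borel"
  by (simp add: torus_measure_def)

lemma nn_integral_torus_measure:
  assumes "f \<in> borel_measurable borel"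
  shows "(\<integral>\<^sup>+x. f x \<partial>torus_measure) = (\<integral>\<^sup>+x\<in>torus_cell. f x \<partial>lborel)"
  unfolding torus_measure_def using assms by (subst nn_integral_density) (auto simp: mult.commute)

lemma torus_measure_density:
  "torus_measure = density lborel (\<lambda>x. ennreal (indicator torus_cell x))"
  by (simp add: torus_measure_def ennreal_indicator)

lemma integrable_torus_measure_iff:
  fixes f :: "real ^ 'n::finite \<Rightarrow> 'b::{banach, second_countable_topology}"
  assumes "f \<in> borel_measurable borel"
  shows "integrable torus_measure f \<longleftrightarrow> set_integrable lborel torus_cell f"
  unfolding torus_measure_density set_integrable_def using assms
  by (subst integrable_density) auto

lemma integral_torus_measure:
  fixes f :: "real ^ 'n::finite \<Rightarrow> 'b::{banach, second_countable_topology}"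
  assumes "f \<in> borel_measurable borel"
  shows "(LINT x:torus_cell|lborel. f x) = (LINT x|torus_measure. f x)"
  unfolding torus_measure_density set_lebesgue_integral_def using assms
  by (subst integral_density) auto

lemma emeasure_torus_measure_UNIV: "emeasure (torus_measure :: (real ^ 'n::finite) measure) UNIV = 1"
proof -
  have "emeasure lborel (cbox 0 (1 :: real ^ 'n)) = 1"
  proof -
    have "(1 :: real ^ 'n) \<bullet> b = 1" if "b \<in> Basis" for b
      using that by (auto simp: Basis_vec_def inner_axis)
    then show ?thesis
      by (simp add: emeasure_lborel_cbox_eq prod.neutral)
  qed
  then show ?thesis
    by (simp add: torus_measure_def emeasure_density torus_cell_def)
qed

interpretation torus_measure: finite_measure torus_measure
  by standard (simp add: emeasure_torus_measure_UNIV)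

interpretation torus_pair: pair_sigma_finite torus_measure torus_measure ..

interpretation torus_lborel_pair: pair_sigma_finite torus_measure lborel ..

lemma nn_integral_torus_measure_translate:
  fixes F :: "real ^ 'n::finite \<Rightarrow> ennreal"
  assumes [measurable]: "F \<in> borel_measurable borel" and "torus_periodic F"
  shows "(\<integral>\<^sup>+x. F (x - c) \<partial>torus_measure) = (\<integral>\<^sup>+x. F x \<partial>torus_measure)"
  using nn_integral_torus_translate[OF assms, of "- c"] by (simp add: nn_integral_torus_measure)

definition centred_measure :: "(real ^ 'n) measure"
  where "centred_measure = density lborel (indicator centred_cell)"

lemma space_centred_measure [simp]: "space centred_measure = UNIV"
  by (simp add: centred_measure_def)

lemma sets_centred_measure [simp, measurable_cong]: "sets centred_measure = sets borel"
  by (simp add: centred_measure_def)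

lemma nn_integral_centred_measure:
  assumes "f \<in> borel_measurable borel"
  shows "(\<integral>\<^sup>+x. f x \<partial>centred_measure) = (\<integral>\<^sup>+x\<in>centred_cell. f x \<partial>lborel)"
  unfolding centred_measure_def using assms by (subst nn_integral_density) (auto simp: mult.commute)

lemma AE_centred_measure: "AE y in centred_measure. y \<in> centred_cell"
  unfolding centred_measure_def by (subst AE_density) (auto intro!: AE_I2 simp: indicator_def split: if_splits)

lemma nn_integral_torus_measure_convolution:
  fixes F :: "real ^ 'n::finite \<Rightarrow> ennreal"
  assumes [measurable]: "F \<in> borel_measurable borel" and "torus_periodic F"
  shows "(\<integral>\<^sup>+z. F (x - z) \<partial>torus_measure) = (\<integral>\<^sup>+y. F y \<partial>centred_measure)"
  using nn_integral_torus_convolution[OF assms]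
  by (simp add: nn_integral_torus_measure nn_integral_centred_measure)

lemma nn_integral_centred_eq_torus:
  fixes F :: "real ^ 'n::finite \<Rightarrow> ennreal"
  assumes [measurable]: "F \<in> borel_measurable borel" and "torus_periodic F"
  shows "(\<integral>\<^sup>+y. F y \<partial>centred_measure) = (\<integral>\<^sup>+x. F x \<partial>torus_measure)"
  using nn_integral_centred_cell[OF assms]
  by (simp add: nn_integral_torus_measure nn_integral_centred_measure)

lemma emeasure_centred_measure_UNIV: "emeasure (centred_measure :: (real ^ 'n::finite) measure) UNIV = 1"
  using nn_integral_centred_eq_torus[of "\<lambda>_ :: real ^ 'n. 1"] emeasure_torus_measure_UNIV
  by (simp add: torus_periodic_def)

interpretation centred_measure: finite_measure centred_measure
  by standard (simp add: emeasure_centred_measure_UNIV)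

interpretation torus_centred_pair: pair_sigma_finite torus_measure centred_measure ..

section \<open>Smooth functions on the torus\<close>

lemma torus_smoothD:
  assumes "f \<in> torus_smooth"
  shows "torus_periodic f" "smooth f" "continuous_on UNIV f" "f \<in> borel_measurable borel"
    "(f has_derivative frechet_derivative f (at x)) (at x)"
proof -
  show p: "torus_periodic f" and s: "smooth f"
    using assms by (simp_all add: torus_smooth_def)
  show c: "continuous_on UNIV f"
    using s by (rule smooth_continuous_on)
  show "f \<in> borel_measurable borel"
    using c by (rule borel_measurable_continuous_onI)
  show "(f has_derivative frechet_derivative f (at x)) (at x)"
    using s by (rule smooth_differentiable)
qed

text \<open>Subtracting the floors of the coordinates moves any point into the compact unit
  cell.\<close>

lemma torus_smooth_bounded:
  fixes f :: "real ^ 'n::finite \<Rightarrow> 'b::euclidean_space"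
  assumes "f \<in> torus_smooth"
  obtains B where "\<And>x. norm (f x) \<le> B"
proof -
  have "compact (f ` torus_cell)"
    unfolding torus_cell_def
    by (intro compact_continuous_image continuous_on_subset[OF torus_smoothD(3)[OF assms]]) auto
  from compact_imp_bounded[OF this] obtain B where B: "\<And>x. x \<in> torus_cell \<Longrightarrow> norm (f x) \<le> B"
    by (auto simp: bounded_iff)
  have "norm (f x) \<le> B" for x
  proof -
    let ?y = "x + lattice_vec (\<chi> i. - \<lfloor>x $ i\<rfloor>)"
    have "?y \<in> torus_cell"
      unfolding torus_cell_def mem_box_cart lattice_vec_def by (simp, intro allI conjI) linarith+
    then show ?thesis
      using B[of ?y] by (simp add: torus_periodic_lattice[OF torus_smoothD(1)[OF assms]])
  qed
  then show ?thesis
    by (rule that)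
qed

lemma torus_smooth_partial:
  fixes f :: "real ^ 'n::finite \<Rightarrow> 'b::euclidean_space"
  assumes "f \<in> torus_smooth"
  shows "partial i f \<in> torus_smooth"
proof -
  have "smooth (\<lambda>x. frechet_derivative f (at x) (axis i 1))"
    using torus_smoothD(2)[OF assms] by (rule smooth_frechet_derivative) simp
  moreover have "frechet_derivative f (at (x + axis j 1)) = frechet_derivative f (at x)" for x j
  proof -
    have "((\<lambda>x. f (x + axis j 1)) has_derivative frechet_derivative f (at (x + axis j 1))) (at x)"
      using diff_chain_at[OF has_derivative_add_const[OF has_derivative_ident] torus_smoothD(5)[OF assms], of "axis j 1" x]
      by (simp add: o_def)
    then have "(f has_derivative frechet_derivative f (at (x + axis j 1))) (at x)"
      using torus_smoothD(1)[OF assms] by (simp add: torus_periodic_def)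
    then show ?thesis
      by (rule frechet_derivative_at)
  qed
  ultimately show ?thesis
    by (simp add: torus_smooth_def torus_periodic_def partial_def[abs_def])
qed

lemma partial_eqI: "(f has_derivative D) (at x) \<Longrightarrow> partial i f x = D (axis i 1)"
  using frechet_derivative_at[of f D x] by (simp add: partial_def)

lemma partial_sum_scaleR:
  fixes a :: "'j \<Rightarrow> real ^ 'n::finite \<Rightarrow> real" and c :: "'j \<Rightarrow> 'b::euclidean_space"
  assumes "\<And>j. j \<in> J \<Longrightarrow> a j \<in> torus_smooth"
  shows "partial i (\<lambda>x. \<Sum>j\<in>J. a j x *\<^sub>R c j) x = (\<Sum>j\<in>J. partial i (a j) x *\<^sub>R c j)"
proof -
  have "((\<lambda>x. \<Sum>j\<in>J. a j x *\<^sub>R c j) has_derivative (\<lambda>v. \<Sum>j\<in>J. frechet_derivative (a j) (at x) v *\<^sub>R c j)) (at x)"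
    using torus_smoothD(5)[OF assms] by (intro has_derivative_sum has_derivative_scaleR_left) auto
  from partial_eqI[OF this, of i] show ?thesis
    by (simp add: partial_def)
qed

section \<open>Lebesgue spaces on the torus in terms of the normalised measure\<close>

lemma torus_Lp_D:
  assumes "f \<in> torus_Lp p"
  shows "torus_periodic f" "f \<in> borel_measurable borel"
    "integrable torus_measure (\<lambda>x. norm (f x) powr p)"
proof -
  show m: "torus_periodic f" "f \<in> borel_measurable borel"
    using assms by (auto simp: torus_Lp_def)
  then show "integrable torus_measure (\<lambda>x. norm (f x) powr p)"
    using assms by (subst integrable_torus_measure_iff) (auto simp: torus_Lp_def)
qed

lemma torus_L1_D: "f \<in> torus_Lp 1 \<Longrightarrow> integrable torus_measure f"
  using torus_Lp_D[of f 1]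
  by (subst integrable_norm_iff[symmetric]) (auto simp: measurable_cong_sets[OF sets_torus_measure refl])

lemma torus_L2_D: "f \<in> torus_Lp 2 \<Longrightarrow> integrable torus_measure (\<lambda>x. norm (f x) ^ 2)"
  using torus_Lp_D(3)[of f 2] by (simp add: powr_numeral)

lemma torus_L3_D: "f \<in> torus_Lp 3 \<Longrightarrow> integrable torus_measure (\<lambda>x. norm (f x) ^ 3)"
  using torus_Lp_D(3)[of f 3] by (simp add: powr_numeral)

lemma integrable_torus_L2:
  fixes f :: "real ^ 'n::finite \<Rightarrow> 'b::euclidean_space"
  assumes [measurable]: "f \<in> borel_measurable borel" and "integrable torus_measure (\<lambda>x. norm (f x) ^ 2)"
  shows "integrable torus_measure f"
proof (rule Bochner_Integration.integrable_bound)
  show "integrable torus_measure (\<lambda>x. 1 + norm (f x) ^ 2)"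
    using assms by simp
  show "AE x in torus_measure. norm (f x) \<le> norm (1 + norm (f x) ^ 2)"
  proof (rule AE_I2)
    fix x
    have "0 \<le> (norm (f x) - 1) ^ 2"
      by simp
    then have "2 * norm (f x) \<le> 1 + norm (f x) ^ 2"
      by (simp add: power2_eq_square algebra_simps)
    with norm_ge_zero[of "f x"] have "norm (f x) \<le> 1 + norm (f x) ^ 2"
      by linarith
    then show "norm (f x) \<le> norm (1 + norm (f x) ^ 2)"
      by simp
  qed
qed simp

lemma integrable_torus_smooth_scaleR:
  fixes f :: "real ^ 'n::finite \<Rightarrow> 'b::euclidean_space"
  assumes "a \<in> torus_smooth" and f: "integrable torus_measure f"
  shows "integrable torus_measure (\<lambda>x. a x *\<^sub>R f x)"
proof -
  obtain B where B: "\<And>x. norm (a x) \<le> B"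
    by (rule torus_smooth_bounded[OF assms(1)], rule that)
  note [measurable] = torus_smoothD(4)[OF assms(1)] borel_measurable_integrable[OF f]
  have "norm (a x *\<^sub>R f x) \<le> norm (B *\<^sub>R f x)" for x
    using B[of x] by (auto intro!: mult_right_mono)
  then show ?thesis
    by (intro Bochner_Integration.integrable_bound[OF integrable_scaleR_right[OF f, of B]]) auto
qed

lemma integrable_torus_smooth_inner:
  fixes f :: "real ^ 'n::finite \<Rightarrow> 'b::euclidean_space"
  assumes "a \<in> torus_smooth" and f: "integrable torus_measure f"
  shows "integrable torus_measure (\<lambda>x. f x \<bullet> a x)"
proof -
  obtain B where B: "\<And>x. norm (a x) \<le> B"
    by (rule torus_smooth_bounded[OF assms(1)], rule that)
  note [measurable] = torus_smoothD(4)[OF assms(1)] borel_measurable_integrable[OF f]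
  have "norm (f x \<bullet> a x) \<le> norm (B *\<^sub>R f x)" for x
    using order_trans[OF Cauchy_Schwarz_ineq2 mult_left_mono[OF B norm_ge_zero]] order_trans[OF norm_ge_zero B]
    by (simp add: mult.commute abs_of_nonneg)
  then show ?thesis
    by (intro Bochner_Integration.integrable_bound[OF integrable_scaleR_right[OF f, of B]]) auto
qed

section \<open>The kernels form an approximate identity\<close>

lemma cos_kernel_torus_smooth:
  assumes "n \<ge> 1"
  shows "cos_kernel n \<in> torus_smooth"
proof -
  obtain m and a :: "nat \<Rightarrow> real ^ 3 \<Rightarrow> real" where a: "\<And>j. a j \<in> torus_smooth"
    "\<And>x z. cos_kernel n (x - z) = (\<Sum>j<m. a j x * a j z)"
    by (rule separable_kernelE[OF separable_cos_kernel[OF assms]], rule that)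
  have "cos_kernel n = (\<lambda>x. \<Sum>j<m. a j x * a j 0)"
    using a(2)[of _ 0] by auto
  then show ?thesis
    using a(1) by (simp add: torus_smooth_sum torus_smooth_mult torus_smooth_const)
qed

lemma nn_integral_cos_kernel:
  assumes "n \<ge> 1"
  shows "(\<integral>\<^sup>+z. ennreal (cos_kernel n (x - z)) \<partial>torus_measure) = 1"
    "(\<integral>\<^sup>+y. ennreal (cos_kernel n y) \<partial>centred_measure) = 1"
proof -
  note K = torus_smoothD[OF cos_kernel_torus_smooth[OF assms]]
  note [measurable] = K(4)
  have "cos_kernel n \<in> borel_measurable torus_measure"
    by measurable
  moreover obtain B where "\<And>x. norm (cos_kernel n x) \<le> B"
    by (rule torus_smooth_bounded[OF cos_kernel_torus_smooth[OF assms]], rule that)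
  ultimately have int: "integrable torus_measure (cos_kernel n)"
    by (intro torus_measure.integrable_const_bound[of _ B]) auto
  have [measurable]: "(\<lambda>y :: real ^ 3. \<Prod>i\<in>UNIV. cos_kernel1 n (y $ i)) \<in> borel_measurable borel"
    by (intro borel_measurable_continuous_onI continuous_intros)
  have "(LINT y|torus_measure. cos_kernel n y) = (LINT y|torus_measure. (\<Prod>i\<in>UNIV. cos_kernel1 n ((y :: real ^ 3) $ i))) / cos_kernel_mass n"
    by (simp add: cos_kernel_def[abs_def])
  also have "\<dots> = 1"
    using cos_kernel_mass_pos[OF assms] by (simp add: cos_kernel_mass_def integral_torus_measure)
  finally have "(\<integral>\<^sup>+y. ennreal (cos_kernel n y) \<partial>torus_measure) = 1"
    by (subst nn_integral_eq_integral[OF int]) (auto simp: cos_kernel_nonneg)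
  moreover have per: "torus_periodic (\<lambda>y. ennreal (cos_kernel n y))"
    using K(1) by (simp add: torus_periodic_def)
  ultimately show c: "(\<integral>\<^sup>+y. ennreal (cos_kernel n y) \<partial>centred_measure) = 1"
    by (subst nn_integral_centred_eq_torus) auto
  show "(\<integral>\<^sup>+z. ennreal (cos_kernel n (x - z)) \<partial>torus_measure) = 1"
    using c nn_integral_torus_measure_convolution[OF _ per, of x] by simp
qed

text \<open>Within distance \<delta> of the origin \<sigma> is small and the kernel has mass at most
  one; further out the kernel itself is uniformly small and \<sigma> is bounded. The hypothesis is
  sequential because continuity of translations is proved along sequences.\<close>

lemma cos_kernel_approximate_identity:
  fixes \<sigma> :: "real ^ 3 \<Rightarrow> ennreal"
  assumes [measurable]: "\<sigma> \<in> borel_measurable borel"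
    and bound: "\<And>y. \<sigma> y \<le> ennreal M"
    and seq: "\<And>Y. Y \<longlonglongrightarrow> 0 \<Longrightarrow> (\<lambda>n. \<sigma> (Y n)) \<longlonglongrightarrow> 0"
  shows "(\<lambda>n. \<integral>\<^sup>+y. ennreal (cos_kernel n y) * \<sigma> y \<partial>centred_measure) \<longlonglongrightarrow> 0"
proof (rule ennreal_tendsto_0I)
  fix e :: real
  assume e: "0 < e"
  have M: "\<sigma> y \<le> ennreal (max M 0)" for y
    using bound[of y] by (rule order_trans) (simp add: ennreal_leI)
  have "(\<sigma> \<longlongrightarrow> 0) (at 0)"
    unfolding tendsto_at_iff_sequentially using seq by (auto simp: o_def)
  from ennreal_tendsto_0D[OF this, of "e/2"] e obtain \<delta> where \<delta>: "\<delta> > 0"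
    "\<And>y. y \<noteq> 0 \<Longrightarrow> dist y 0 < \<delta> \<Longrightarrow> \<sigma> y \<le> ennreal (e/2)"
    by (auto simp: eventually_at)
  \<comment> \<open>The limit at 0 does not see the value there; the constant zero sequence
    does.\<close>
  have "(\<lambda>n. \<sigma> 0) \<longlonglongrightarrow> 0"
    by (rule seq) simp
  then have "\<sigma> 0 = 0"
    by (simp add: LIMSEQ_const_iff)
  with \<delta>(2) have \<delta>2: "\<sigma> y \<le> ennreal (e/2)" if "norm y < \<delta>" for y
    using that by (cases "y = 0") auto
  have "(\<lambda>n. 4000 / (sqrt (real n) * \<delta> ^ 4) * max M 0) \<longlonglongrightarrow> 0"
  proof -
    have "filterlim (\<lambda>n. sqrt (real n)) at_infinity sequentially"
      by (intro filterlim_at_top_imp_at_infinity filterlim_compose[OF sqrt_at_top filterlim_real_sequentially])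
    then have "(\<lambda>n. 4000 / \<delta> ^ 4 * max M 0 / sqrt (real n)) \<longlonglongrightarrow> 0"
      by (intro tendsto_divide_0[OF tendsto_const])
    then show ?thesis
      by (simp add: mult_ac)
  qed
  then have "eventually (\<lambda>n. 4000 / (sqrt (real n) * \<delta> ^ 4) * max M 0 < e/2) sequentially"
    using e by (intro order_tendstoD) auto
  then show "eventually (\<lambda>n. (\<integral>\<^sup>+y. ennreal (cos_kernel n y) * \<sigma> y \<partial>centred_measure) \<le> ennreal e) sequentially"
    using eventually_ge_at_top[of 1]
  proof eventually_elim
    fix n :: nat
    assume n: "4000 / (sqrt (real n) * \<delta> ^ 4) * max M 0 < e/2" "n \<ge> 1"
    note [measurable] = torus_smoothD(4)[OF cos_kernel_torus_smooth[OF n(2)]]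
    have "(\<integral>\<^sup>+y. ennreal (cos_kernel n y) * \<sigma> y \<partial>centred_measure)
        \<le> (\<integral>\<^sup>+y. ennreal (cos_kernel n y) * ennreal (e/2) + ennreal (e/2) \<partial>centred_measure)"
    proof (rule nn_integral_mono_AE, rule AE_mp[OF AE_centred_measure], rule AE_I2, rule impI)
      fix y :: "real ^ 3"
      assume y: "y \<in> centred_cell"
      show "ennreal (cos_kernel n y) * \<sigma> y \<le> ennreal (cos_kernel n y) * ennreal (e/2) + ennreal (e/2)"
      proof (cases "norm y < \<delta>")
        case True
        then show ?thesis
          using \<delta>2 by (intro order_trans[OF _ add_increasing2[OF _ order_refl]] mult_left_mono) auto
      next
        case False
        then have "ennreal (cos_kernel n y) * \<sigma> y \<le> ennreal (4000 / (sqrt (real n) * \<delta> ^ 4)) * ennreal (max M 0)"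
          using n \<delta>(1) cos_kernel_away_bound[OF y, of n \<delta>] by (intro mult_mono M ennreal_leI) auto
        also have "\<dots> \<le> ennreal (e/2)"
          using n(1) by (simp add: ennreal_mult''[symmetric] ennreal_leI)
        finally show ?thesis
          by (rule order_trans) simp
      qed
    qed
    also have "\<dots> = ennreal (e/2) + ennreal (e/2)"
      using n(2) by (subst nn_integral_add) (auto simp: nn_integral_multc nn_integral_cos_kernel emeasure_centred_measure_UNIV)
    also have "\<dots> = ennreal e"
      using e by (simp add: ennreal_plus[symmetric] del: ennreal_plus)
    finally show "(\<integral>\<^sup>+y. ennreal (cos_kernel n y) * \<sigma> y \<partial>centred_measure) \<le> ennreal e" .
  qed
qed

text \<open>For fixed \<open>x\<close> the substitution y = x - z puts the increment into the
  centred cell, and Tonelli then isolates a modulus of translation. The weight \<open>w\<close> and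
  the function \<Phi> are free so as to serve mean convergence, the weighted pairing and the cubes
  of increments alike.\<close>

lemma convolution_increment_swap:
  fixes f :: "real ^ 3 \<Rightarrow> 'b::euclidean_space" and w :: "real ^ 3 \<Rightarrow> ennreal" and \<Phi> :: "'b \<Rightarrow> ennreal"
    and k :: "real ^ 3 \<Rightarrow> real"
  assumes [measurable]: "f \<in> borel_measurable borel" "w \<in> borel_measurable borel"
      "\<Phi> \<in> borel_measurable borel" "k \<in> borel_measurable borel"
    and per: "torus_periodic f" "torus_periodic k"
  shows "(\<integral>\<^sup>+x. \<integral>\<^sup>+z. ennreal (k (x - z)) * (w x * \<Phi> (f z - f x)) \<partial>torus_measure \<partial>torus_measure)
      = (\<integral>\<^sup>+y. ennreal (k y) * (\<integral>\<^sup>+x. w x * \<Phi> (f (x - y) - f x) \<partial>torus_measure) \<partial>centred_measure)"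
proof -
  have "(\<integral>\<^sup>+z. ennreal (k (x - z)) * (w x * \<Phi> (f z - f x)) \<partial>torus_measure)
      = (\<integral>\<^sup>+y. ennreal (k y) * (w x * \<Phi> (f (x - y) - f x)) \<partial>centred_measure)" for x
  proof -
    have "f (x - (y + axis i 1)) = f (x - y)" for y i
    proof -
      have "f (x - (y + axis i 1) + axis i 1) = f (x - (y + axis i 1))"
        using per(1) unfolding torus_periodic_def by blast
      then show ?thesis
        by simp
    qed
    then have "torus_periodic (\<lambda>y. ennreal (k y) * (w x * \<Phi> (f (x - y) - f x)))"
      using per(2) by (simp add: torus_periodic_def)
    from nn_integral_torus_measure_convolution[OF _ this, of x] show ?thesis
      by simp
  qed
  then have "(\<integral>\<^sup>+x. \<integral>\<^sup>+z. ennreal (k (x - z)) * (w x * \<Phi> (f z - f x)) \<partial>torus_measure \<partial>torus_measure)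
      = (\<integral>\<^sup>+x. \<integral>\<^sup>+y. ennreal (k y) * (w x * \<Phi> (f (x - y) - f x)) \<partial>centred_measure \<partial>torus_measure)"
    by simp
  also have "\<dots> = (\<integral>\<^sup>+y. \<integral>\<^sup>+x. ennreal (k y) * (w x * \<Phi> (f (x - y) - f x)) \<partial>torus_measure \<partial>centred_measure)"
    by (rule torus_centred_pair.Fubini'[symmetric]) measurable
  also have "\<dots> = (\<integral>\<^sup>+y. ennreal (k y) * (\<integral>\<^sup>+x. w x * \<Phi> (f (x - y) - f x) \<partial>torus_measure) \<partial>centred_measure)"
    by (intro nn_integral_cong nn_integral_cmult) measurable
  finally show ?thesis .
qed

text \<open>Truncation at height \<open>M\<close> reduces this to continuity in the mean: for the
  bounded part the square of an increment is at most 2M times its norm, and the remainder is small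
  in the square mean uniformly over all shifts.\<close>

lemma torus_translation_tendsto_L2:
  fixes f :: "real ^ 'n::finite \<Rightarrow> 'b::euclidean_space"
  assumes [measurable]: "f \<in> borel_measurable borel" and per: "torus_periodic f"
    and int: "integrable torus_measure (\<lambda>x. norm (f x) ^ 2)" and Y: "Y \<longlonglongrightarrow> 0"
  shows "(\<lambda>n. \<integral>\<^sup>+x. ennreal (norm (f (x - Y n) - f x) ^ 2) \<partial>torus_measure) \<longlonglongrightarrow> 0"
proof (rule ennreal_tendsto_0I)
  fix e :: real
  assume e: "0 < e"
  define g where "g M x = (if norm (f x) \<le> real M then f x else 0)" for M x
  define r where "r M x = f x - g M x" for M x
  have [measurable]: "g M \<in> borel_measurable borel" "r M \<in> borel_measurable borel" for M
    by (simp_all add: r_def[abs_def] g_def[abs_def])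
  have gb: "norm (g M x) \<le> real M" for M x
    by (simp add: g_def)
  have gper: "torus_periodic (g M)" and rper: "torus_periodic (r M)" for M
    using per by (simp_all add: torus_periodic_def g_def r_def)
  have "(\<lambda>M. \<integral>\<^sup>+x. ennreal (norm (r M x) ^ 2) \<partial>torus_measure) \<longlonglongrightarrow> (\<integral>\<^sup>+x. 0 \<partial>(torus_measure :: (real ^ 'n) measure))"
  proof (rule nn_integral_dominated_convergence[where w = "\<lambda>x. ennreal (norm (f x) ^ 2)"])
    show "(\<integral>\<^sup>+x. ennreal (norm (f x) ^ 2) \<partial>torus_measure) < \<infinity>"
      using int by (simp add: integrable_iff_bounded)
    show "AE x in torus_measure. (\<lambda>M. ennreal (norm (r M x) ^ 2)) \<longlonglongrightarrow> 0"
    proof (rule AE_I2)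
      fix x
      obtain N :: nat where N: "norm (f x) \<le> N"
        using real_arch_simple by blast
      have "eventually (\<lambda>M. ennreal (norm (r M x) ^ 2) = 0) sequentially"
        using eventually_ge_at_top[of N]
        by eventually_elim (use N in \<open>auto simp: r_def g_def\<close>)
      then show "(\<lambda>M. ennreal (norm (r M x) ^ 2)) \<longlonglongrightarrow> 0"
        by (rule tendsto_eventually)
    qed
  qed (auto simp: r_def g_def)
  then have "(\<lambda>M. \<integral>\<^sup>+x. ennreal (norm (r M x) ^ 2) \<partial>torus_measure) \<longlonglongrightarrow> 0"
    by simp
  \<comment> \<open>Each of the two remainder terms enters with factor 3, giving \<open>e/2\<close>
    together; the bounded part with factor 6M takes the other half.\<close>
  from ennreal_tendsto_0D[OF this, of "e/12"] e obtain M
    where M: "(\<integral>\<^sup>+x. ennreal (norm (r M x) ^ 2) \<partial>torus_measure) \<le> ennreal (e/12)"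
    by (auto dest: eventually_happens)
  have "(\<integral>\<^sup>+x. ennreal (norm (g M x)) \<partial>torus_measure) \<le> (\<integral>\<^sup>+x. ennreal M \<partial>(torus_measure :: (real ^ 'n) measure))"
    by (intro nn_integral_mono ennreal_leI gb)
  also have "\<dots> < \<infinity>"
    by (simp add: emeasure_torus_measure_UNIV)
  finally have "(\<integral>\<^sup>+x\<in>torus_cell. ennreal (norm (g M x)) \<partial>lborel) < \<infinity>"
    by (simp add: nn_integral_torus_measure)
  from torus_translation_tendsto[OF _ gper this Y]
  have "(\<lambda>n. \<integral>\<^sup>+x. ennreal (norm (g M (x - Y n) - g M x)) \<partial>torus_measure) \<longlonglongrightarrow> 0"
    by (simp add: nn_integral_torus_measure)
  from ennreal_tendsto_0D[OF this, of "e / (12 * (real M + 1))"] e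
  have "eventually (\<lambda>n. (\<integral>\<^sup>+x. ennreal (norm (g M (x - Y n) - g M x)) \<partial>torus_measure) \<le> ennreal (e / (12 * (real M + 1)))) sequentially"
    by (simp add: add_pos_nonneg)
  then show "eventually (\<lambda>n. (\<integral>\<^sup>+x. ennreal (norm (f (x - Y n) - f x) ^ 2) \<partial>torus_measure) \<le> ennreal e) sequentially"
  proof eventually_elim
    fix n
    assume n: "(\<integral>\<^sup>+x. ennreal (norm (g M (x - Y n) - g M x)) \<partial>torus_measure) \<le> ennreal (e / (12 * (real M + 1)))"
    have pt: "norm (f (x - y) - f x) ^ 2
        \<le> (6 * real M) * norm (g M (x - y) - g M x) + (3 * norm (r M (x - y)) ^ 2 + 3 * norm (r M x) ^ 2)" for x y
    proof -
      define A B C where "A = norm (g M (x - y) - g M x)" and "B = norm (r M (x - y))" and "C = norm (r M x)"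
      have "f (x - y) - f x = (g M (x - y) - g M x) + r M (x - y) - r M x"
        by (simp add: r_def)
      moreover have "norm (u + v - w) \<le> norm u + norm v + norm w" for u v w :: 'b
        by norm
      ultimately have "norm (f (x - y) - f x) \<le> A + B + C"
        by (metis A_def B_def C_def)
      then have "norm (f (x - y) - f x) ^ 2 \<le> (A + B + C) ^ 2"
        by (intro power_mono) auto
      also have "\<dots> \<le> 3 * A ^ 2 + (3 * B ^ 2 + 3 * C ^ 2)"
      proof -
        have "0 \<le> (A - B) ^ 2 + (B - C) ^ 2 + (A - C) ^ 2"
          by simp
        then show ?thesis
          by (simp add: power2_eq_square algebra_simps)
      qed
      also have "A ^ 2 \<le> 2 * real M * A"
        using norm_triangle_ineq4[of "g M (x - y)" "g M x"] gb[of M x] gb[of M "x - y"]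
        by (simp add: A_def power2_eq_square mult_right_mono)
      finally show ?thesis
        by (simp add: A_def B_def C_def)
    qed
    have "(\<integral>\<^sup>+x. ennreal (norm (f (x - Y n) - f x) ^ 2) \<partial>torus_measure)
       \<le> (\<integral>\<^sup>+x. ennreal (6 * real M) * ennreal (norm (g M (x - Y n) - g M x))
           + (3 * ennreal (norm (r M (x - Y n)) ^ 2) + 3 * ennreal (norm (r M x) ^ 2)) \<partial>torus_measure)"
    proof (rule nn_integral_mono)
      fix x
      have "ennreal (norm (f (x - Y n) - f x) ^ 2)
          \<le> ennreal ((6 * real M) * norm (g M (x - Y n) - g M x) + (3 * norm (r M (x - Y n)) ^ 2 + 3 * norm (r M x) ^ 2))"
        by (intro ennreal_leI pt)
      then show "ennreal (norm (f (x - Y n) - f x) ^ 2) \<le> ennreal (6 * real M) * ennreal (norm (g M (x - Y n) - g M x))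
           + (3 * ennreal (norm (r M (x - Y n)) ^ 2) + 3 * ennreal (norm (r M x) ^ 2))"
        by (simp add: ennreal_mult)
    qed
    also have "\<dots> = ennreal (6 * real M) * (\<integral>\<^sup>+x. ennreal (norm (g M (x - Y n) - g M x)) \<partial>torus_measure)
         + (3 * (\<integral>\<^sup>+x. ennreal (norm (r M (x - Y n)) ^ 2) \<partial>torus_measure) + 3 * (\<integral>\<^sup>+x. ennreal (norm (r M x) ^ 2) \<partial>torus_measure))"
      by (simp add: nn_integral_add nn_integral_cmult)
    also have "(\<integral>\<^sup>+x. ennreal (norm (r M (x - Y n)) ^ 2) \<partial>torus_measure) = (\<integral>\<^sup>+x. ennreal (norm (r M x) ^ 2) \<partial>torus_measure)"
      by (rule nn_integral_torus_measure_translate) (use rper in \<open>auto simp: torus_periodic_def\<close>)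
    also have "ennreal (6 * real M) * (\<integral>\<^sup>+x. ennreal (norm (g M (x - Y n) - g M x)) \<partial>torus_measure)
         + (3 * (\<integral>\<^sup>+x. ennreal (norm (r M x) ^ 2) \<partial>torus_measure) + 3 * (\<integral>\<^sup>+x. ennreal (norm (r M x) ^ 2) \<partial>torus_measure))
        \<le> ennreal (6 * real M) * ennreal (e / (12 * (real M + 1))) + (3 * ennreal (e/12) + 3 * ennreal (e/12))"
      by (intro add_mono mult_left_mono n M) auto
    also have "\<dots> = ennreal (6 * real M * (e / (12 * (real M + 1))) + (3 * (e/12) + 3 * (e/12)))"
    proof -
      have "ennreal a * ennreal X + (3 * ennreal Z + 3 * ennreal Z) = ennreal (a * X + (3 * Z + 3 * Z))"
        if "0 \<le> a" "0 \<le> X" "0 \<le> Z" for a X Z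
        using that by (simp only: ennreal_plus ennreal_mult ennreal_numeral mult_nonneg_nonneg add_nonneg_nonneg zero_le_numeral)
      then show ?thesis
        using e by simp
    qed
    also have "\<dots> \<le> ennreal e"
      using e by (intro ennreal_leI) (simp add: field_simps add_pos_nonneg)
    finally show "(\<integral>\<^sup>+x. ennreal (norm (f (x - Y n) - f x) ^ 2) \<partial>torus_measure) \<le> ennreal e" .
  qed
qed

text \<open>After the exchange the kernel is integrated against the modulus of translation, bounded
  by twice the norm of \<open>f\<close>. The index is \<open>Suc n\<close> because the kernel
  estimates need a positive exponent.\<close>

lemma cos_kernel_convolution_L1:
  fixes f :: "real ^ 3 \<Rightarrow> 'b::euclidean_space"
  assumes [measurable]: "f \<in> borel_measurable borel" and per: "torus_periodic f"
    and int: "integrable torus_measure f"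
  shows "(\<lambda>n. \<integral>\<^sup>+x. \<integral>\<^sup>+z. ennreal (cos_kernel (Suc n) (x - z)) * ennreal (norm (f z - f x)) \<partial>torus_measure \<partial>torus_measure) \<longlonglongrightarrow> 0"
proof -
  define \<sigma> where "\<sigma> y = (\<integral>\<^sup>+x. ennreal (norm (f (x - y) - f x)) \<partial>torus_measure)" for y
  have swap: "(\<integral>\<^sup>+x. \<integral>\<^sup>+z. ennreal (cos_kernel (Suc n) (x - z)) * ennreal (norm (f z - f x)) \<partial>torus_measure \<partial>torus_measure)
      = (\<integral>\<^sup>+y. ennreal (cos_kernel (Suc n) y) * \<sigma> y \<partial>centred_measure)" for n
    using convolution_increment_swap[of f "\<lambda>_. 1" "\<lambda>v. ennreal (norm v)" "cos_kernel (Suc n)"] per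
      torus_smoothD[OF cos_kernel_torus_smooth[of "Suc n"]]
    by (simp add: \<sigma>_def)
  have fin: "(\<integral>\<^sup>+x. ennreal (norm (f x)) \<partial>torus_measure) < \<infinity>"
    using int by (simp add: integrable_iff_bounded)
  have "\<sigma> y \<le> 2 * (\<integral>\<^sup>+x. ennreal (norm (f x)) \<partial>torus_measure)" for y
  proof -
    have "\<sigma> y \<le> (\<integral>\<^sup>+x. ennreal (norm (f (x - y))) + ennreal (norm (f x)) \<partial>torus_measure)"
      unfolding \<sigma>_def by (intro nn_integral_mono) (simp add: norm_triangle_ineq4 ennreal_leI flip: ennreal_plus)
    also have "\<dots> = (\<integral>\<^sup>+x. ennreal (norm (f (x - y))) \<partial>torus_measure) + (\<integral>\<^sup>+x. ennreal (norm (f x)) \<partial>torus_measure)"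
      by (rule nn_integral_add) measurable
    also have "(\<integral>\<^sup>+x. ennreal (norm (f (x - y))) \<partial>torus_measure) = (\<integral>\<^sup>+x. ennreal (norm (f x)) \<partial>torus_measure)"
      by (rule nn_integral_torus_measure_translate) (use per in \<open>auto simp: torus_periodic_def\<close>)
    finally show ?thesis
      by (simp add: mult_2)
  qed
  also have "2 * (\<integral>\<^sup>+x. ennreal (norm (f x)) \<partial>torus_measure) = ennreal (enn2real (2 * (\<integral>\<^sup>+x. ennreal (norm (f x)) \<partial>torus_measure)))"
    using fin by (simp add: ennreal_mult_less_top less_top)
  finally have bound: "\<sigma> y \<le> ennreal (enn2real (2 * (\<integral>\<^sup>+x. ennreal (norm (f x)) \<partial>torus_measure)))" for y .
  have [measurable]: "\<sigma> \<in> borel_measurable borel"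
    unfolding \<sigma>_def by measurable
  have "(\<lambda>n. \<integral>\<^sup>+y. ennreal (cos_kernel n y) * \<sigma> y \<partial>centred_measure) \<longlonglongrightarrow> 0"
  proof (rule cos_kernel_approximate_identity[OF _ bound])
    fix Y :: "nat \<Rightarrow> real ^ 3"
    assume "Y \<longlonglongrightarrow> 0"
    from torus_translation_tendsto[OF _ per _ this] fin
    show "(\<lambda>n. \<sigma> (Y n)) \<longlonglongrightarrow> 0"
      by (simp add: \<sigma>_def nn_integral_torus_measure)
  qed simp
  then show ?thesis
    unfolding swap by (rule LIMSEQ_Suc)
qed

text \<open>The weight is separated from the increment by Young's inequality, after which only
  continuity of translations in the square mean is needed.\<close>

lemma cos_kernel_convolution_L2:
  fixes f :: "real ^ 3 \<Rightarrow> 'b::euclidean_space" and g :: "real ^ 3 \<Rightarrow> 'c::euclidean_space"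
  assumes [measurable]: "f \<in> borel_measurable borel" "g \<in> borel_measurable borel" and per: "torus_periodic f"
    and int: "integrable torus_measure (\<lambda>x. norm (f x) ^ 2)" "integrable torus_measure (\<lambda>x. norm (g x) ^ 2)"
  shows "(\<lambda>n. \<integral>\<^sup>+x. \<integral>\<^sup>+z. ennreal (cos_kernel (Suc n) (x - z)) * (ennreal (norm (g x)) * ennreal (norm (f z - f x))) \<partial>torus_measure \<partial>torus_measure) \<longlonglongrightarrow> 0"
proof -
  define \<sigma> where "\<sigma> y = (\<integral>\<^sup>+x. ennreal (norm (g x)) * ennreal (norm (f (x - y) - f x)) \<partial>torus_measure)" for y
  define \<tau> where "\<tau> y = (\<integral>\<^sup>+x. ennreal (norm (f (x - y) - f x) ^ 2) \<partial>torus_measure)" for y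
  define F G where "F = (LINT x|torus_measure. norm (f x) ^ 2)" and "G = (LINT x|torus_measure. norm (g x) ^ 2)"
  have FG: "(\<integral>\<^sup>+x. ennreal (norm (f x) ^ 2) \<partial>torus_measure) = ennreal F"
      "(\<integral>\<^sup>+x. ennreal (norm (g x) ^ 2) \<partial>torus_measure) = ennreal G" "F \<ge> 0" "G \<ge> 0"
    unfolding F_def G_def by (auto intro!: nn_integral_eq_integral int)
  have swap: "(\<integral>\<^sup>+x. \<integral>\<^sup>+z. ennreal (cos_kernel (Suc n) (x - z)) * (ennreal (norm (g x)) * ennreal (norm (f z - f x))) \<partial>torus_measure \<partial>torus_measure)
      = (\<integral>\<^sup>+y. ennreal (cos_kernel (Suc n) y) * \<sigma> y \<partial>centred_measure)" for n
    using convolution_increment_swap[of f "\<lambda>x. ennreal (norm (g x))" "\<lambda>v. ennreal (norm v)" "cos_kernel (Suc n)"] per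
      torus_smoothD[OF cos_kernel_torus_smooth[of "Suc n"]]
    by (simp add: \<sigma>_def)
  \<comment> \<open>The parameter \<open>c\<close> is chosen later: small enough for the term with
    \<open>G\<close>, and only then is the shift taken small enough to compensate 1/c.\<close>
  have young: "\<sigma> y \<le> ennreal (c * G) + ennreal (1/c) * \<tau> y" if "c > 0" for c y
  proof -
    have "\<sigma> y \<le> (\<integral>\<^sup>+x. ennreal c * ennreal (norm (g x) ^ 2) + ennreal (1/c) * ennreal (norm (f (x - y) - f x) ^ 2) \<partial>torus_measure)"
      unfolding \<sigma>_def
    proof (rule nn_integral_mono)
      fix x
      define p q where "p = norm (g x)" and "q = norm (f (x - y) - f x)"
      have pq: "p \<ge> 0" "q \<ge> 0"
        by (simp_all add: p_def q_def)
      have "0 \<le> (c * p - q) ^ 2"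
        by simp
      then have "2 * (c * (p * q)) \<le> c * (c * p ^ 2) + q ^ 2"
        by (simp add: power2_eq_square algebra_simps)
      moreover have "0 \<le> c * (p * q)"
        using pq that by simp
      ultimately have "c * (p * q) \<le> c * (c * p ^ 2 + 1/c * q ^ 2)"
        using that by (simp add: distrib_left)
      then have "p * q \<le> c * p ^ 2 + 1/c * q ^ 2"
        using that by simp
      then have "ennreal (p * q) \<le> ennreal (c * p ^ 2 + 1/c * q ^ 2)"
        by (rule ennreal_leI)
      also have "\<dots> = ennreal c * ennreal (p ^ 2) + ennreal (1/c) * ennreal (q ^ 2)"
        using that by (simp add: ennreal_mult flip: ennreal_mult)
      finally show "ennreal (norm (g x)) * ennreal (norm (f (x - y) - f x))
          \<le> ennreal c * ennreal (norm (g x) ^ 2) + ennreal (1/c) * ennreal (norm (f (x - y) - f x) ^ 2)"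
        using pq by (simp add: ennreal_mult p_def q_def)
    qed
    also have "\<dots> = ennreal c * ennreal G + ennreal (1/c) * \<tau> y"
      by (simp add: nn_integral_add nn_integral_cmult \<tau>_def FG)
    finally show ?thesis
      using that FG by (simp add: ennreal_mult)
  qed
  have \<tau>_bound: "\<tau> y \<le> ennreal (4 * F)" for y
  proof -
    have "\<tau> y \<le> (\<integral>\<^sup>+x. 2 * ennreal (norm (f (x - y)) ^ 2) + 2 * ennreal (norm (f x) ^ 2) \<partial>torus_measure)"
      unfolding \<tau>_def
    proof (rule nn_integral_mono)
      fix x
      have "norm (f (x - y) - f x) ^ 2 \<le> (norm (f (x - y)) + norm (f x)) ^ 2"
        by (intro power_mono norm_triangle_ineq4) auto
      also have "\<dots> \<le> 2 * norm (f (x - y)) ^ 2 + 2 * norm (f x) ^ 2"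
        using zero_le_power2[of "norm (f (x - y)) - norm (f x)"] by (simp add: power2_eq_square algebra_simps)
      finally have "ennreal (norm (f (x - y) - f x) ^ 2) \<le> ennreal (2 * norm (f (x - y)) ^ 2 + 2 * norm (f x) ^ 2)"
        by (rule ennreal_leI)
      then show "ennreal (norm (f (x - y) - f x) ^ 2) \<le> 2 * ennreal (norm (f (x - y)) ^ 2) + 2 * ennreal (norm (f x) ^ 2)"
        by (simp add: ennreal_mult)
    qed
    also have "\<dots> = 2 * (\<integral>\<^sup>+x. ennreal (norm (f (x - y)) ^ 2) \<partial>torus_measure) + 2 * (\<integral>\<^sup>+x. ennreal (norm (f x) ^ 2) \<partial>torus_measure)"
      by (simp add: nn_integral_add nn_integral_cmult)
    also have "(\<integral>\<^sup>+x. ennreal (norm (f (x - y)) ^ 2) \<partial>torus_measure) = (\<integral>\<^sup>+x. ennreal (norm (f x) ^ 2) \<partial>torus_measure)"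
      by (rule nn_integral_torus_measure_translate) (use per in \<open>auto simp: torus_periodic_def\<close>)
    also have "2 * (\<integral>\<^sup>+x. ennreal (norm (f x) ^ 2) \<partial>torus_measure) + 2 * (\<integral>\<^sup>+x. ennreal (norm (f x) ^ 2) \<partial>torus_measure) = ennreal (4 * F)"
      using FG by (simp add: ennreal_mult flip: distrib_right)
    finally show ?thesis .
  qed
  have bound: "\<sigma> y \<le> ennreal (G + 4 * F)" for y
  proof -
    have "\<sigma> y \<le> ennreal G + ennreal (4 * F)"
      using young[of 1 y] \<tau>_bound[of y] by (auto intro: order_trans add_left_mono)
    then show ?thesis
      using FG by simp
  qed
  have [measurable]: "\<sigma> \<in> borel_measurable borel"
    unfolding \<sigma>_def by measurable
  have "(\<lambda>n. \<integral>\<^sup>+y. ennreal (cos_kernel n y) * \<sigma> y \<partial>centred_measure) \<longlonglongrightarrow> 0"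
  proof (rule cos_kernel_approximate_identity[OF _ bound])
    fix Y :: "nat \<Rightarrow> real ^ 3"
    assume Y: "Y \<longlonglongrightarrow> 0"
    show "(\<lambda>n. \<sigma> (Y n)) \<longlonglongrightarrow> 0"
    proof (rule ennreal_tendsto_0I)
      fix e :: real
      assume e: "0 < e"
      define c where "c = e / (2 * (G + 1))"
      have c: "c > 0" "c * G \<le> e/2"
        using e FG by (auto simp: c_def field_simps)
      have "(\<lambda>n. \<tau> (Y n)) \<longlonglongrightarrow> 0"
        unfolding \<tau>_def by (rule torus_translation_tendsto_L2[OF _ per int(1) Y]) simp
      from ennreal_tendsto_0D[OF this, of "c * (e/2)"] c e
      have "eventually (\<lambda>n. \<tau> (Y n) \<le> ennreal (c * (e/2))) sequentially"
        by simp
      then show "eventually (\<lambda>n. \<sigma> (Y n) \<le> ennreal e) sequentially"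
      proof eventually_elim
        fix n
        assume n: "\<tau> (Y n) \<le> ennreal (c * (e/2))"
        have "\<sigma> (Y n) \<le> ennreal (c * G) + ennreal (1/c) * \<tau> (Y n)"
          by (rule young) fact
        also have "\<dots> \<le> ennreal (e/2) + ennreal (1/c) * ennreal (c * (e/2))"
          using c by (intro add_mono mult_left_mono n ennreal_leI) auto
        also have "\<dots> = ennreal e"
          using c e by (simp add: ennreal_mult[symmetric] flip: ennreal_plus)
        finally show "\<sigma> (Y n) \<le> ennreal e" .
      qed
    qed
  qed simp
  then show ?thesis
    unfolding swap by (rule LIMSEQ_Suc)
qed

section \<open>Convolution with a separable kernel\<close>

lemma integrable_vec_nth:
  fixes f :: "'a \<Rightarrow> real ^ 'n::finite"
  shows "integrable M f \<Longrightarrow> integrable M (\<lambda>x. f x $ i)"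
  by (rule integrable_bounded_linear[OF bounded_linear_vec_nth])

lemma integral_vec_nth:
  fixes f :: "'a \<Rightarrow> real ^ 'n::finite"
  shows "integrable M f \<Longrightarrow> (LINT x|M. f x $ i) = (LINT x|M. f x) $ i"
  by (rule integral_bounded_linear[OF bounded_linear_vec_nth])

definition torus_conv :: "(real ^ 'n \<Rightarrow> real) \<Rightarrow> (real ^ 'n \<Rightarrow> 'b) \<Rightarrow> real ^ 'n \<Rightarrow> 'b::euclidean_space"
  where "torus_conv k f x = (LINT z|torus_measure. k (x - z) *\<^sub>R f z)"

text \<open>Fixes one separated expansion of the kernel, so that the coefficients of a field against
  the functions \<open>a j\<close> can be named and followed in time.\<close>

locale torus_kernel =
  fixes k :: "real ^ 'n::finite \<Rightarrow> real" and m :: nat and a :: "nat \<Rightarrow> real ^ 'n \<Rightarrow> real"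
  assumes smooth_a: "\<And>j. a j \<in> torus_smooth"
    and separated: "\<And>x z. k (x - z) = (\<Sum>j<m. a j x * a j z)"
begin

lemma kernel_commute: "k (z - x) = k (x - z)"
  by (simp add: separated mult.commute)

lemma kernel_torus_smooth: "k \<in> torus_smooth"
proof -
  have "k = (\<lambda>x. \<Sum>j<m. a j x * a j 0)"
    using separated[of _ 0] by auto
  then show ?thesis
    using smooth_a by (simp add: torus_smooth_sum torus_smooth_mult torus_smooth_const)
qed

lemma kernel_translate_torus_smooth: "(\<lambda>z. k (x - z)) \<in> torus_smooth"
  unfolding separated by (intro torus_smooth_sum torus_smooth_mult torus_smooth_const smooth_a)

lemma torus_conv_eq:
  fixes f :: "real ^ 'n \<Rightarrow> 'b::euclidean_space"
  assumes "integrable torus_measure f"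
  shows "torus_conv k f x = (\<Sum>j<m. a j x *\<^sub>R (LINT z|torus_measure. a j z *\<^sub>R f z))"
  unfolding torus_conv_def separated scaleR_sum_left using integrable_torus_smooth_scaleR[OF smooth_a assms]
  by (subst Bochner_Integration.integral_sum) (auto simp flip: scaleR_scaleR)

lemma torus_conv_torus_smooth:
  fixes f :: "real ^ 'n \<Rightarrow> 'b::euclidean_space"
  assumes "integrable torus_measure f"
  shows "torus_conv k f \<in> torus_smooth"
  unfolding torus_conv_eq[OF assms, abs_def]
  by (intro torus_smooth_sum torus_smooth_scaleR smooth_a torus_smooth_const)

lemma partial_kernel_shift:
  "partial i k (x - z) = (\<Sum>j<m. partial i (a j) x * a j z)"
proof -
  have "((\<lambda>x. k (x - z)) has_derivative frechet_derivative k (at (x - z))) (at x)"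
    using diff_chain_at[OF has_derivative_diff[OF has_derivative_ident has_derivative_const] torus_smoothD(5)[OF kernel_torus_smooth], of z x]
    by (simp add: o_def)
  from partial_eqI[OF this, of i] have "partial i k (x - z) = partial i (\<lambda>x. k (x - z)) x"
    by (simp add: partial_def)
  also have "\<dots> = (\<Sum>j<m. partial i (a j) x * a j z)"
    unfolding separated using partial_sum_scaleR[of "{..<m}" a i "\<lambda>j. a j z" x] smooth_a by simp
  finally show ?thesis .
qed

lemma partial_kernel_reflect: "partial i (\<lambda>z. k (x - z)) z = - partial i k (x - z)"
proof -
  have "((\<lambda>z. k (x - z)) has_derivative (\<lambda>v. frechet_derivative k (at (x - z)) (0 - v))) (at z)"
    using diff_chain_at[OF has_derivative_diff[OF has_derivative_const has_derivative_ident] torus_smoothD(5)[OF kernel_torus_smooth], of x z]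
    by (simp add: o_def)
  moreover have "linear (frechet_derivative k (at (x - z)))"
    using has_derivative_linear[OF torus_smoothD(5)[OF kernel_torus_smooth]] .
  ultimately show ?thesis
    using partial_eqI[of "\<lambda>z. k (x - z)" "\<lambda>v. frechet_derivative k (at (x - z)) (0 - v)" z i]
    by (simp add: partial_def linear_neg)
qed

text \<open>The separated form is symmetric in its two variables, so the kernel is even and its
  derivatives are odd.\<close>

lemma partial_kernel_odd: "partial i k (z - x) = - partial i k (x - z)"
proof -
  have "((\<lambda>z. k (z - x)) has_derivative frechet_derivative k (at (z - x))) (at z)"
    using diff_chain_at[OF has_derivative_diff[OF has_derivative_ident has_derivative_const] torus_smoothD(5)[OF kernel_torus_smooth], of x z]
    by (simp add: o_def)
  from partial_eqI[OF this, of i] have "partial i k (z - x) = partial i (\<lambda>z. k (z - x)) z"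
    by (simp add: partial_def)
  moreover have "(\<lambda>z. k (z - x)) = (\<lambda>z. k (x - z))"
    by (rule ext) (rule kernel_commute)
  ultimately show ?thesis
    by (simp add: partial_kernel_reflect)
qed

lemma grad_kernel_odd: "grad k (z - x) = - grad k (x - z)"
  by (simp add: grad_def vec_eq_iff partial_kernel_odd[of _ z x])

lemma grad_kernel_reflect: "grad (\<lambda>z. k (x - z)) z = - grad k (x - z)"
  using partial_kernel_reflect by (simp add: grad_def vec_eq_iff)

text \<open>The convolution is a finite combination of the functions \<open>a j\<close> with
  constant coefficients, so derivatives fall on these functions and no differentiation under an
  integral is involved.\<close>

lemma partial_torus_conv:
  fixes f :: "real ^ 'n \<Rightarrow> 'b::euclidean_space"
  assumes "integrable torus_measure f"
  shows "partial i (torus_conv k f) x = (\<Sum>j<m. partial i (a j) x *\<^sub>R (LINT z|torus_measure. a j z *\<^sub>R f z))"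
  using partial_sum_scaleR[of "{..<m}" a i "\<lambda>j. LINT z|torus_measure. a j z *\<^sub>R f z" x] smooth_a
  by (simp add: torus_conv_eq[OF assms, abs_def])

lemma partial_torus_conv':
  fixes f :: "real ^ 'n \<Rightarrow> 'b::euclidean_space"
  assumes "integrable torus_measure f"
  shows "partial i (torus_conv k f) x = (LINT z|torus_measure. partial i k (x - z) *\<^sub>R f z)"
  unfolding partial_kernel_shift scaleR_sum_left partial_torus_conv[OF assms]
  using integrable_torus_smooth_scaleR[OF smooth_a assms]
  by (subst Bochner_Integration.integral_sum) (auto simp flip: scaleR_scaleR)

lemma partial_kernel_torus_smooth: "(\<lambda>z. partial i k (x - z)) \<in> torus_smooth"
  unfolding partial_kernel_shift
  by (intro torus_smooth_sum torus_smooth_mult torus_smooth_const smooth_a)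

end

lemma torus_kernel_cos_kernel:
  assumes "n \<ge> 1"
  obtains m a where "torus_kernel (cos_kernel n) m a"
  by (rule separable_kernelE[OF separable_cos_kernel[OF assms]]) (rule that, unfold_locales, auto)

lemma integral_cos_kernel:
  assumes "n \<ge> 1"
  shows "integrable torus_measure (\<lambda>z. cos_kernel n (x - z))" "(LINT z|torus_measure. cos_kernel n (x - z)) = 1"
proof -
  note [measurable] = torus_smoothD(4)[OF cos_kernel_torus_smooth[OF assms]]
  have "has_bochner_integral torus_measure (\<lambda>z. cos_kernel n (x - z)) 1"
    using nn_integral_cos_kernel(1)[OF assms, of x]
    by (intro has_bochner_integral_nn_integral) (auto simp: cos_kernel_nonneg)
  then show "integrable torus_measure (\<lambda>z. cos_kernel n (x - z))" "(LINT z|torus_measure. cos_kernel n (x - z)) = 1"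
    by (auto simp: has_bochner_integral_iff)
qed

text \<open>Because the kernel has mass one, \<open>f x\<close> is its own average and the
  difference is an average of increments.\<close>

lemma norm_torus_conv_diff_le:
  fixes f :: "real ^ 3 \<Rightarrow> 'b::euclidean_space"
  assumes "n \<ge> 1" and f: "integrable torus_measure f"
  shows "ennreal (norm (torus_conv (cos_kernel n) f x - f x))
    \<le> (\<integral>\<^sup>+z. ennreal (cos_kernel n (x - z)) * ennreal (norm (f z - f x)) \<partial>torus_measure)"
proof -
  obtain m a where "torus_kernel (cos_kernel n) m a"
    using torus_kernel_cos_kernel[OF assms(1)] .
  then interpret torus_kernel "cos_kernel n" m a .
  have i1: "integrable torus_measure (\<lambda>z. cos_kernel n (x - z) *\<^sub>R f z)"
    by (rule integrable_torus_smooth_scaleR[OF kernel_translate_torus_smooth f])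
  have i2: "integrable torus_measure (\<lambda>z. cos_kernel n (x - z) *\<^sub>R f x)"
    using integral_cos_kernel(1)[OF assms(1)] by (rule integrable_scaleR_left)
  have "(LINT z|torus_measure. cos_kernel n (x - z) *\<^sub>R f x) = f x"
    using integral_cos_kernel[OF assms(1)] by simp
  then have "torus_conv (cos_kernel n) f x - f x = (LINT z|torus_measure. cos_kernel n (x - z) *\<^sub>R (f z - f x))"
    using Bochner_Integration.integral_diff[OF i1 i2] by (simp add: torus_conv_def scaleR_diff_right)
  moreover have "ennreal (norm (LINT z|torus_measure. cos_kernel n (x - z) *\<^sub>R (f z - f x)))
      \<le> (\<integral>\<^sup>+z. ennreal (norm (cos_kernel n (x - z) *\<^sub>R (f z - f x))) \<partial>torus_measure)"
    by (rule integral_norm_bound_ennreal)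
      (use Bochner_Integration.integrable_diff[OF i1 i2] in \<open>simp add: scaleR_diff_right\<close>)
  ultimately show ?thesis
    by (simp add: cos_kernel_nonneg ennreal_mult)
qed

text \<open>Testing with translates of the kernel times basis vectors shows that every mollification
  of \<open>g\<close> vanishes, and the mollifications converge to \<open>g\<close> in the mean. It
  serves to identify the weak curl, which is defined by a choice.\<close>

lemma torus_fundamental_lemma:
  fixes g :: "real ^ 3 \<Rightarrow> 'b::euclidean_space"
  assumes "g \<in> torus_Lp 1" and orth: "\<And>\<phi>. \<phi> \<in> torus_smooth \<Longrightarrow> (LINT x|torus_measure. g x \<bullet> \<phi> x) = 0"
  shows "AE x in torus_measure. g x = 0"
proof -
  note g = torus_Lp_D(1,2)[OF assms(1)] torus_L1_D[OF assms(1)]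
  note [measurable] = g(2)
  have conv0: "torus_conv (cos_kernel (Suc n)) g x = 0" for n x
  proof -
    obtain m a where "torus_kernel (cos_kernel (Suc n)) m a"
      using torus_kernel_cos_kernel[of "Suc n"] by auto
    then interpret torus_kernel "cos_kernel (Suc n)" m a .
    show ?thesis
    proof (rule euclidean_eqI)
      fix b :: 'b
      assume "b \<in> Basis"
      have "torus_conv (cos_kernel (Suc n)) g x \<bullet> b = (LINT z|torus_measure. (cos_kernel (Suc n) (x - z) *\<^sub>R g z) \<bullet> b)"
        unfolding torus_conv_def
        by (rule integral_inner_left[symmetric]) (rule integrable_torus_smooth_scaleR[OF kernel_translate_torus_smooth g(3)])
      also have "\<dots> = (LINT z|torus_measure. g z \<bullet> (cos_kernel (Suc n) (x - z) *\<^sub>R b))"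
        by simp
      also have "\<dots> = 0"
        by (intro orth torus_smooth_scaleR kernel_translate_torus_smooth torus_smooth_const)
      finally show "torus_conv (cos_kernel (Suc n)) g x \<bullet> b = 0 \<bullet> b"
        by simp
    qed
  qed
  have le: "(\<integral>\<^sup>+x. ennreal (norm (g x)) \<partial>torus_measure)
      \<le> (\<integral>\<^sup>+x. \<integral>\<^sup>+z. ennreal (cos_kernel (Suc n) (x - z)) * ennreal (norm (g z - g x)) \<partial>torus_measure \<partial>torus_measure)" for n
    using norm_torus_conv_diff_le[OF _ g(3), of "Suc n"] by (intro nn_integral_mono) (simp add: conv0)
  have "(\<integral>\<^sup>+x. ennreal (norm (g x)) \<partial>torus_measure) \<le> 0"
    by (rule LIMSEQ_le_const[OF cos_kernel_convolution_L1[OF g(2,1,3)]]) (use le in auto)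
  then show ?thesis
    by (simp add: nn_integral_0_iff_AE)
qed

text \<open>Only the pairing with a fixed square integrable field is needed, so the error is
  estimated with the weight \<open>norm (g x)\<close> inside the double integral and the mollified
  field never has to be bounded on its own.\<close>

lemma torus_conv_pairing_tendsto:
  fixes f g :: "real ^ 3 \<Rightarrow> 'b::euclidean_space"
  assumes f: "f \<in> torus_Lp 2" and g: "g \<in> torus_Lp 2"
  shows "(\<lambda>n. LINT x|torus_measure. g x \<bullet> torus_conv (cos_kernel (Suc n)) f x) \<longlonglongrightarrow> (LINT x|torus_measure. g x \<bullet> f x)"
proof -
  note f = torus_Lp_D(1,2)[OF f] torus_L2_D[OF f]
  note g = torus_Lp_D(1,2)[OF g] torus_L2_D[OF g]
  note [measurable] = f(2) g(2)
  have f1: "integrable torus_measure f" and g1: "integrable torus_measure g"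
    using f g by (auto intro: integrable_torus_L2)
  have i0: "integrable torus_measure (\<lambda>x. g x \<bullet> f x)"
  proof (rule Bochner_Integration.integrable_bound)
    show "integrable torus_measure (\<lambda>x. norm (f x) ^ 2 + norm (g x) ^ 2)"
      using f(3) g(3) by simp
    show "AE x in torus_measure. norm (g x \<bullet> f x) \<le> norm (norm (f x) ^ 2 + norm (g x) ^ 2)"
    proof (rule AE_I2)
      fix x
      have "norm (g x \<bullet> f x) \<le> norm (g x) * norm (f x)"
        using Cauchy_Schwarz_ineq2 by simp
      also have "\<dots> \<le> norm (f x) ^ 2 + norm (g x) ^ 2"
      proof -
        have "2 * (norm (g x) * norm (f x)) \<le> norm (f x) ^ 2 + norm (g x) ^ 2"
          using zero_le_power2[of "norm (f x) - norm (g x)"] by (simp add: power2_eq_square algebra_simps)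
        moreover have "0 \<le> norm (g x) * norm (f x)"
          by simp
        ultimately show ?thesis
          by linarith
      qed
      finally show "norm (g x \<bullet> f x) \<le> norm (norm (f x) ^ 2 + norm (g x) ^ 2)"
        by simp
    qed
  qed simp
  define E where "E n = (\<integral>\<^sup>+x. \<integral>\<^sup>+z. ennreal (cos_kernel (Suc n) (x - z)) * (ennreal (norm (g x)) * ennreal (norm (f z - f x))) \<partial>torus_measure \<partial>torus_measure)" for n
  have E: "E \<longlonglongrightarrow> 0"
    unfolding E_def by (rule cos_kernel_convolution_L2[OF f(2) g(2) f(1) f(3) g(3)])
  have le: "ennreal \<bar>(LINT x|torus_measure. g x \<bullet> torus_conv (cos_kernel (Suc n)) f x) - (LINT x|torus_measure. g x \<bullet> f x)\<bar> \<le> E n" for n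
  proof -
    obtain m a where "torus_kernel (cos_kernel (Suc n)) m a"
      using torus_kernel_cos_kernel[of "Suc n"] by auto
    then interpret torus_kernel "cos_kernel (Suc n)" m a .
    note [measurable] = torus_smoothD(4)[OF kernel_torus_smooth]
    have i1: "integrable torus_measure (\<lambda>x. g x \<bullet> torus_conv (cos_kernel (Suc n)) f x)"
      by (rule integrable_torus_smooth_inner[OF torus_conv_torus_smooth[OF f1] g1])
    have "(LINT x|torus_measure. g x \<bullet> torus_conv (cos_kernel (Suc n)) f x) - (LINT x|torus_measure. g x \<bullet> f x)
        = (LINT x|torus_measure. g x \<bullet> (torus_conv (cos_kernel (Suc n)) f x - f x))"
      using Bochner_Integration.integral_diff[OF i1 i0] by (simp add: inner_diff_right)
    also have "ennreal (norm \<dots>) \<le> (\<integral>\<^sup>+x. ennreal (norm (g x \<bullet> (torus_conv (cos_kernel (Suc n)) f x - f x))) \<partial>torus_measure)"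
      by (rule integral_norm_bound_ennreal)
        (use Bochner_Integration.integrable_diff[OF i1 i0] in \<open>simp add: inner_diff_right\<close>)
    also have "\<dots> \<le> E n"
      unfolding E_def
    proof (rule nn_integral_mono)
      fix x
      have "ennreal (norm (g x \<bullet> (torus_conv (cos_kernel (Suc n)) f x - f x)))
          \<le> ennreal (norm (g x) * norm (torus_conv (cos_kernel (Suc n)) f x - f x))"
        using Cauchy_Schwarz_ineq2 by (intro ennreal_leI) simp
      also have "\<dots> \<le> ennreal (norm (g x)) * (\<integral>\<^sup>+z. ennreal (cos_kernel (Suc n) (x - z)) * ennreal (norm (f z - f x)) \<partial>torus_measure)"
        using norm_torus_conv_diff_le[OF _ f1, of "Suc n" x] by (simp add: ennreal_mult mult_left_mono)
      also have "\<dots> = (\<integral>\<^sup>+z. ennreal (cos_kernel (Suc n) (x - z)) * (ennreal (norm (g x)) * ennreal (norm (f z - f x))) \<partial>torus_measure)"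
        by (subst nn_integral_cmult[symmetric]) (auto simp: mult_ac)
      finally show "ennreal (norm (g x \<bullet> (torus_conv (cos_kernel (Suc n)) f x - f x)))
          \<le> (\<integral>\<^sup>+z. ennreal (cos_kernel (Suc n) (x - z)) * (ennreal (norm (g x)) * ennreal (norm (f z - f x))) \<partial>torus_measure)" .
    qed
    finally show ?thesis
      by simp
  qed
  have "(\<lambda>n. ennreal \<bar>(LINT x|torus_measure. g x \<bullet> torus_conv (cos_kernel (Suc n)) f x) - (LINT x|torus_measure. g x \<bullet> f x)\<bar>) \<longlonglongrightarrow> 0"
    by (rule tendsto_sandwich[OF _ _ tendsto_const E]) (use le in auto)
  from this[folded ennreal_0] have "(\<lambda>n. \<bar>(LINT x|torus_measure. g x \<bullet> torus_conv (cos_kernel (Suc n)) f x) - (LINT x|torus_measure. g x \<bullet> f x)\<bar>) \<longlonglongrightarrow> 0"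
    by (rule tendsto_ennrealD) auto
  then show ?thesis
    by (simp add: LIM_zero_iff tendsto_rabs_zero_iff)
qed

section \<open>The Duchon--Robert identity\<close>

text \<open>The nonlinear term of the weak equation when the curl of the test field is the
  mollification of the same field.\<close>

definition kernel_flux :: "(real ^ 'n \<Rightarrow> real) \<Rightarrow> (real ^ 'n \<Rightarrow> real ^ 'n) \<Rightarrow> real"
  where "kernel_flux k f = (LINT x|torus_measure.
    (\<Sum>i\<in>UNIV. \<Sum>l\<in>UNIV. f x $ i * f x $ l * partial l (torus_conv k f) x $ i))"

context torus_kernel
begin

text \<open>Expand \<open>(G \<bullet> d) (d \<bullet> d)\<close> with \<open>d = f x - f z\<close> and \<open>G = grad k (x - z)\<close>. The terms with \<open>G \<bullet> f x\<close>
  and \<open>f x \<bullet> f x\<close> vanish because the kernel has constant mass, those with \<open>G \<bullet> f z\<close> and \<open>f x \<bullet> f x\<close>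
  because \<open>f\<close> is divergence-free, and the same holds with \<open>x\<close> and \<open>z\<close> exchanged since \<open>G\<close> is odd.
  Only the terms containing \<open>f x \<bullet> f z\<close> remain, and they are multiples of the flux.\<close>

lemma duchon_robert_bound:
  fixes f :: "real ^ 'n \<Rightarrow> real ^ 'n"
  assumes [measurable]: "f \<in> borel_measurable borel" and f3: "integrable torus_measure (\<lambda>x. norm (f x) ^ 3)"
    and f1: "integrable torus_measure f"
    and div_free: "\<And>\<psi>. \<psi> \<in> torus_smooth \<Longrightarrow> (LINT x|torus_measure. f x \<bullet> grad \<psi> x) = 0"
    and mass: "\<And>x. (LINT z|torus_measure. k (x - z)) = 1"
  shows "ennreal (4 * \<bar>kernel_flux k f\<bar>)
    \<le> (\<integral>\<^sup>+x. \<integral>\<^sup>+z. ennreal (norm (grad k (x - z))) * ennreal (norm (f z - f x) ^ 3) \<partial>torus_measure \<partial>torus_measure)"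
proof -
  let ?P = "torus_measure \<Otimes>\<^sub>M torus_measure :: ((real ^ 'n) \<times> (real ^ 'n)) measure"
  define G where "G x z = grad k (x - z)" for x z
  have one: "integrable torus_measure (\<lambda>x :: real ^ 'n. 1 :: real)"
    by simp
  have [measurable]: "grad k \<in> borel_measurable borel"
  proof -
    have "continuous_on UNIV (grad k)"
      unfolding grad_def
      by (intro continuous_on_vec_lambda torus_smoothD(3) torus_smooth_partial kernel_torus_smooth)
    then show ?thesis
      by (rule borel_measurable_continuous_onI)
  qed
  have [measurable]: "(\<lambda>p. G (fst p) (snd p)) \<in> borel_measurable (borel \<Otimes>\<^sub>M borel)"
    unfolding G_def by measurable
  obtain B where B: "\<And>x z. norm (G x z) \<le> B"
  proof -
    have "\<exists>b. \<forall>y. norm (partial i k y) \<le> b" for i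
      using torus_smooth_bounded[OF torus_smooth_partial[OF kernel_torus_smooth]] by metis
    then obtain b where b: "\<And>i y. norm (partial i k y) \<le> b i"
      by metis
    have "norm (G x z) \<le> (\<Sum>i\<in>UNIV. b i)" for x z
      unfolding G_def by (rule order_trans[OF norm_le_l1_cart]) (use b in \<open>auto simp: grad_def intro!: sum_mono\<close>)
    then show ?thesis
      by (rule that)
  qed
  then have B0: "B \<ge> 0"
    using norm_ge_zero order_trans by blast
  have odd: "G z x = - G x z" for x z
    unfolding G_def by (rule grad_kernel_odd)
  \<comment> \<open>The common integrable majorant of all trilinear terms: a product of three values
    of \<open>f\<close> at two points is at most the cube of the larger norm, hence at most the sum
    of the cubes.\<close>
  have N: "integrable ?P (\<lambda>p. B * (norm (f (fst p)) ^ 3 + norm (f (snd p)) ^ 3))"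
  proof -
    have *: "integrable ?P (\<lambda>p. norm (f (fst p)) ^ 3)"
    proof (subst integrable_iff_bounded, intro conjI)
      show "(\<lambda>p. norm (f (fst p)) ^ 3) \<in> borel_measurable ?P"
        by measurable
      have "(\<integral>\<^sup>+p. ennreal (norm (norm (f (fst p)) ^ 3)) \<partial>?P)
          = (\<integral>\<^sup>+x. \<integral>\<^sup>+z. ennreal (norm (f x) ^ 3) \<partial>(torus_measure :: (real ^ 'n) measure) \<partial>torus_measure)"
        by (subst torus_measure.nn_integral_fst[symmetric]) auto
      also have "\<dots> < \<infinity>"
        using f3 by (simp add: emeasure_torus_measure_UNIV integrable_iff_bounded)
      finally show "(\<integral>\<^sup>+p. ennreal (norm (norm (f (fst p)) ^ 3)) \<partial>?P) < \<infinity>" .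
    qed
    then have "integrable ?P (\<lambda>p. norm (f (snd p)) ^ 3)"
      using torus_pair.integrable_product_swap[of "\<lambda>p. norm (f (fst p)) ^ 3"] by (simp add: case_prod_beta')
    with * show ?thesis
      by simp
  qed
  \<comment> \<open>The eight trilinear terms are indexed by three flags, \<open>True\<close>
    standing for the value at \<open>x\<close> and \<open>False\<close> for the value at
    \<open>z\<close>. Exchanging the points negates all flags and, as the gradient is odd, the
    sign.\<close>
  define s where "s b x z = (if b then f x else f z)" for b and x z :: "real ^ 'n"
  define t where "t b c d x z = (G x z \<bullet> s b x z) * (s c x z \<bullet> s d x z)" for b c d x z
  have t_meas [measurable]: "(\<lambda>p. t b c d (fst p) (snd p)) \<in> borel_measurable (borel \<Otimes>\<^sub>M borel)" for b c d
    unfolding t_def s_def by measurable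
  have int: "integrable ?P (\<lambda>p. t b c d (fst p) (snd p))" for b c d
  proof (rule Bochner_Integration.integrable_bound[OF N])
    show "(\<lambda>p. t b c d (fst p) (snd p)) \<in> borel_measurable ?P"
      using t_meas by (simp add: measurable_cong_sets[OF sets_pair_measure_cong[OF sets_torus_measure sets_torus_measure] refl])
    show "AE p in ?P. norm (t b c d (fst p) (snd p)) \<le> norm (B * (norm (f (fst p)) ^ 3 + norm (f (snd p)) ^ 3))"
    proof (rule AE_I2)
      fix p :: "(real ^ 'n) \<times> (real ^ 'n)"
      obtain x z where p: "p = (x, z)"
        by (cases p)
      define \<mu> where "\<mu> = max (norm (f x)) (norm (f z))"
      have \<mu>: "norm (s b' x z) \<le> \<mu>" "0 \<le> \<mu>" for b'
        by (auto simp: s_def \<mu>_def le_max_iff_disj)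
      have "norm (t b c d x z) = \<bar>G x z \<bullet> s b x z\<bar> * \<bar>s c x z \<bullet> s d x z\<bar>"
        by (simp add: t_def abs_mult)
      also have "\<dots> \<le> (norm (G x z) * norm (s b x z)) * (norm (s c x z) * norm (s d x z))"
        by (intro mult_mono Cauchy_Schwarz_ineq2) auto
      also have "\<dots> \<le> (B * \<mu>) * (\<mu> * \<mu>)"
        by (intro mult_mono \<mu> B mult_nonneg_nonneg B0) auto
      also have "\<dots> = B * \<mu> ^ 3"
        by (simp add: power3_eq_cube)
      also have "\<dots> \<le> B * (norm (f x) ^ 3 + norm (f z) ^ 3)"
        by (intro mult_left_mono B0) (auto simp: \<mu>_def max_def)
      also have "\<dots> \<le> norm (B * (norm (f x) ^ 3 + norm (f z) ^ 3))"
        by simp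
      finally show "norm (t b c d (fst p) (snd p)) \<le> norm (B * (norm (f (fst p)) ^ 3 + norm (f (snd p)) ^ 3))"
        by (simp add: p)
    qed
  qed
  define J where "J b c d = (LINT p|?P. t b c d (fst p) (snd p))" for b c d
  have J_eq: "J b c d = (LINT x|torus_measure. LINT z|torus_measure. t b c d x z)" for b c d
    unfolding J_def using torus_pair.integral_fst'[OF int[of b c d]] by simp
  have J_swap: "J (\<not> b) (\<not> c) (\<not> d) = - J b c d" for b c d
  proof -
    have "J b c d = (LINT (x, z)|?P. t b c d z x)"
      unfolding J_def by (subst torus_pair.integral_product_swap[symmetric]) (auto simp: case_prod_beta' measurable_cong_sets[OF sets_pair_measure_cong[OF sets_torus_measure sets_torus_measure] refl])
    also have "\<dots> = (LINT p|?P. - t (\<not> b) (\<not> c) (\<not> d) (fst p) (snd p))"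
      unfolding t_def s_def by (auto simp: case_prod_beta' odd[of "snd _"] intro!: Bochner_Integration.integral_cong)
    finally show ?thesis
      by (simp add: J_def)
  qed
  have J_comm: "J b c d = J b d c" for b c d
    by (simp add: J_def t_def inner_commute)
  \<comment> \<open>The integral of a derivative of the kernel is the derivative of the mollified
    constant 1, which is constant.\<close>
  have int_G: "(LINT z|torus_measure. G x z) = 0" for x
  proof -
    have "(LINT z|torus_measure. partial i k (x - z)) = 0" for i
    proof -
      have "(LINT z|torus_measure. partial i k (x - z) *\<^sub>R (1 :: real)) = partial i (torus_conv k (\<lambda>_. 1 :: real)) x"
        by (rule partial_torus_conv'[symmetric]) (rule one)
      also have "torus_conv k (\<lambda>_. 1 :: real) = (\<lambda>_. 1)"
        by (simp add: torus_conv_def[abs_def] mass)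
      also have "partial i (\<lambda>_. 1 :: real) x = 0"
        by (simp add: partial_eqI[OF has_derivative_const])
      finally show ?thesis
        by simp
    qed
    moreover have "integrable torus_measure (\<lambda>z. G x z)"
      using B by (intro torus_measure.integrable_const_bound[of _ B]) (auto simp: G_def)
    ultimately show ?thesis
      by (simp add: vec_eq_iff flip: integral_vec_nth) (simp add: G_def grad_def)
  qed
  have "J True True True = 0"
  proof -
    have "(LINT z|torus_measure. t True True True x z) = 0" for x
    proof -
      have "integrable torus_measure (\<lambda>z. G x z)"
        using B by (intro torus_measure.integrable_const_bound[of _ B]) (auto simp: G_def)
      then show ?thesis
        by (simp add: t_def s_def int_G)
    qed
    then show ?thesis
      by (simp add: J_eq)
  qed
  moreover have "J False True True = 0"
  proof -
    have "(LINT z|torus_measure. t False True True x z) = 0" for x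
    proof -
      have "(LINT z|torus_measure. f z \<bullet> grad (\<lambda>z. k (x - z)) z) = 0"
        by (rule div_free) (rule kernel_translate_torus_smooth)
      then have "(LINT z|torus_measure. G x z \<bullet> f z) = 0"
        by (simp add: grad_kernel_reflect G_def inner_commute)
      then show ?thesis
        by (simp add: t_def s_def)
    qed
    then show ?thesis
      by (simp add: J_eq)
  qed
  ultimately have J0: "J True True True = 0" "J False True True = 0" "J False False False = 0" "J True False False = 0"
    using J_swap[of True True True] J_swap[of False True True] by simp_all
  have flux: "J True True False = kernel_flux k f"
    unfolding J_eq kernel_flux_def
  proof (rule Bochner_Integration.integral_cong[OF refl])
    fix x :: "real ^ 'n"
    have "(LINT z|torus_measure. t True True False x z)
        = (LINT z|torus_measure. (\<Sum>i\<in>UNIV. \<Sum>l\<in>UNIV. f x $ i * f x $ l * (partial l k (x - z) *\<^sub>R f z) $ i))"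
    proof (rule Bochner_Integration.integral_cong[OF refl])
      fix z
      have "t True True False x z = (\<Sum>i\<in>UNIV. f x $ i * f z $ i) * (\<Sum>l\<in>UNIV. partial l k (x - z) * f x $ l)"
        by (simp add: t_def s_def G_def grad_def inner_vec_def mult.commute)
      also have "\<dots> = (\<Sum>i\<in>UNIV. \<Sum>l\<in>UNIV. (f x $ i * f z $ i) * (partial l k (x - z) * f x $ l))"
        by (rule sum_product)
      also have "\<dots> = (\<Sum>i\<in>UNIV. \<Sum>l\<in>UNIV. f x $ i * f x $ l * (partial l k (x - z) *\<^sub>R f z) $ i)"
        by (intro sum.cong refl) (simp add: mult_ac)
      finally show "t True True False x z = \<dots>" .
    qed
    also have "\<dots> = (\<Sum>i\<in>UNIV. \<Sum>l\<in>UNIV. f x $ i * f x $ l * (LINT z|torus_measure. (partial l k (x - z) *\<^sub>R f z) $ i))"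
    proof -
      have "integrable torus_measure (\<lambda>z. partial l k (x - z) * f z $ i)" for i l
        using integrable_vec_nth[OF integrable_torus_smooth_scaleR[OF partial_kernel_torus_smooth f1], of l x i] by simp
      then show ?thesis
        by (simp add: Bochner_Integration.integral_sum Bochner_Integration.integrable_sum)
    qed
    also have "\<dots> = (\<Sum>i\<in>UNIV. \<Sum>l\<in>UNIV. f x $ i * f x $ l * partial l (torus_conv k f) x $ i)"
      by (simp only: partial_torus_conv'[OF f1]
          integral_vec_nth[OF integrable_torus_smooth_scaleR[OF partial_kernel_torus_smooth f1]])
    finally show "(LINT z|torus_measure. t True True False x z) = \<dots>" .
  qed
  have "(LINT p|?P. (G (fst p) (snd p) \<bullet> (f (fst p) - f (snd p))) * ((f (fst p) - f (snd p)) \<bullet> (f (fst p) - f (snd p))))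
      = (LINT p|?P. t True True True (fst p) (snd p) - 2 * t True True False (fst p) (snd p) + t True False False (fst p) (snd p)
          - t False True True (fst p) (snd p) + 2 * t False True False (fst p) (snd p) - t False False False (fst p) (snd p))"
    by (intro Bochner_Integration.integral_cong refl)
      (simp add: t_def s_def inner_diff_left inner_diff_right inner_commute algebra_simps)
  also have "\<dots> = J True True True - 2 * J True True False + J True False False
      - J False True True + 2 * J False True False - J False False False"
    unfolding J_def using int by simp
  \<comment> \<open>The first mixed term contributes -2 times the flux. The second, by exchange of
    the points and commutativity of the inner product, is minus the flux and contributes another
    -2.\<close>
  also have "\<dots> = - (4 * kernel_flux k f)"
    using J0 flux J_swap[of True False True] J_comm[of True False True] by simp
  finally have D: "- (4 * kernel_flux k f)
      = (LINT p|?P. (G (fst p) (snd p) \<bullet> (f (fst p) - f (snd p))) * ((f (fst p) - f (snd p)) \<bullet> (f (fst p) - f (snd p))))" ..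
  have "integrable ?P (\<lambda>p. t True True True (fst p) (snd p) - 2 * t True True False (fst p) (snd p) + t True False False (fst p) (snd p)
          - t False True True (fst p) (snd p) + 2 * t False True False (fst p) (snd p) - t False False False (fst p) (snd p))"
    using int by simp
  then have "integrable ?P (\<lambda>p. (G (fst p) (snd p) \<bullet> (f (fst p) - f (snd p))) * ((f (fst p) - f (snd p)) \<bullet> (f (fst p) - f (snd p))))"
    by (rule iffD1[OF Bochner_Integration.integrable_cong[OF refl], rotated])
      (simp add: t_def s_def inner_diff_left inner_diff_right inner_commute algebra_simps)
  from integral_norm_bound_ennreal[OF this]
  have "ennreal (norm (- (4 * kernel_flux k f)))
      \<le> (\<integral>\<^sup>+p. ennreal (norm ((G (fst p) (snd p) \<bullet> (f (fst p) - f (snd p))) * ((f (fst p) - f (snd p)) \<bullet> (f (fst p) - f (snd p))))) \<partial>?P)"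
    unfolding D .
  also have "\<dots> \<le> (\<integral>\<^sup>+p. ennreal (norm (G (fst p) (snd p))) * ennreal (norm (f (snd p) - f (fst p)) ^ 3) \<partial>?P)"
  proof (rule nn_integral_mono)
    fix p :: "(real ^ 'n) \<times> (real ^ 'n)"
    let ?v = "f (fst p) - f (snd p)"
    have "norm ((G (fst p) (snd p) \<bullet> ?v) * (?v \<bullet> ?v)) = \<bar>G (fst p) (snd p) \<bullet> ?v\<bar> * norm ?v ^ 2"
      by (simp add: abs_mult power2_norm_eq_inner)
    also have "\<dots> \<le> (norm (G (fst p) (snd p)) * norm ?v) * norm ?v ^ 2"
      by (intro mult_right_mono Cauchy_Schwarz_ineq2) auto
    also have "\<dots> = norm (G (fst p) (snd p)) * norm (f (snd p) - f (fst p)) ^ 3"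
      by (simp add: norm_minus_commute eval_nat_numeral)
    finally show "ennreal (norm ((G (fst p) (snd p) \<bullet> ?v) * (?v \<bullet> ?v)))
        \<le> ennreal (norm (G (fst p) (snd p))) * ennreal (norm (f (snd p) - f (fst p)) ^ 3)"
      by (simp add: ennreal_leI flip: ennreal_mult)
  qed
  also have "\<dots> = (\<integral>\<^sup>+x. \<integral>\<^sup>+z. ennreal (norm (G x z)) * ennreal (norm (f z - f x) ^ 3) \<partial>torus_measure \<partial>torus_measure)"
    by (subst torus_measure.nn_integral_fst[symmetric]) auto
  finally show ?thesis
    by (simp add: G_def abs_mult)
qed

end

section \<open>Smallness of the flux for Besov-VMO fields\<close>

text \<open>For 2^(j-1) \<le> u < 2^j the decay is at most 2^(-5(j-1)), whence the factor 32. In the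
  induction the old remainder either is paid for by the new layer or, if u lies beyond it, shrinks
  by the factor 32.\<close>

lemma decay_le_dyadic:
  assumes "u \<ge> 0"
  shows "decay u \<le> (\<Sum>j\<le>J. 32 / 2 ^ (5 * j) * indicator {..<2 ^ j} u) + 1 / 2 ^ (5 * J)"
proof (induction J)
  case 0
  have "decay u \<le> 1"
    by (simp add: decay_def divide_le_eq one_le_power)
  then show ?case
    by (simp add: add_increasing)
next
  case (Suc J)
  show ?case
  proof (cases "u < 2 ^ Suc J")
    case True
    then have "(32::real) / 2 ^ (5 * Suc J) * indicator {..<2 ^ Suc J} u = 1 / 2 ^ (5 * J)"
      by (simp add: power_add)
    then show ?thesis
      using Suc by (simp only: sum.atMost_Suc) (smt (verit) divide_nonneg_nonneg zero_le_power)
  next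
    case False
    have "2 ^ (5 * Suc J) = (2 ^ Suc J :: real) ^ 5"
      by (simp only: power_mult[symmetric] mult.commute)
    also have "\<dots> \<le> u ^ 5"
      using False by (intro power_mono) auto
    finally have "1 / u ^ 5 \<le> 1 / 2 ^ (5 * Suc J)"
      using False zero_less_power[of "2::real" "Suc J"] by (intro divide_left_mono mult_pos_pos zero_less_power) linarith+
    moreover have "1 < u"
      using False one_less_power[of "2::real" "Suc J"] by linarith
    moreover have "0 \<le> (\<Sum>j\<le>Suc J. (32::real) / 2 ^ (5 * j) * indicator {..<2 ^ j} u)"
      by (intro sum_nonneg) auto
    ultimately show ?thesis
      by (simp only: decay_def) (smt (verit))
  qed
qed

lemma norm_grad_cos_kernel_le:
  assumes "y \<in> centred_cell" "n \<ge> 1"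
  shows "norm (grad (cos_kernel n) y) \<le> 6000000 * sqrt n ^ 4 * decay (sqrt n * norm y)"
proof -
  have "norm (grad (cos_kernel n) y) \<le> (\<Sum>i\<in>UNIV. \<bar>grad (cos_kernel n) y $ i\<bar>)"
    by (rule norm_le_l1_cart)
  also have "\<dots> \<le> (\<Sum>i\<in>(UNIV :: 3 set). 2000000 * sqrt n ^ 4 * decay (sqrt n * norm y))"
    using partial_cos_kernel_bound[OF assms] by (intro sum_mono) (simp add: grad_def)
  finally show ?thesis
    by simp
qed

lemma dyadic_scale_exists:
  assumes "1 < (a::real)"
  obtains J :: nat where "2 ^ J < a" "a \<le> 2 ^ Suc J"
proof -
  have ex: "\<exists>j. a \<le> 2 ^ Suc j"
    using real_arch_pow[of 2 a] by (metis less_imp_le one_less_numeral_iff power_Suc0_right semiring_norm(76)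
        power_strict_increasing lessI order_less_trans)
  define J where "J = (LEAST j. a \<le> 2 ^ Suc j)"
  have "a \<le> 2 ^ Suc J"
    unfolding J_def by (rule LeastI_ex[OF ex])
  moreover have "2 ^ J < a"
  proof (cases J)
    case (Suc i)
    then have "\<not> a \<le> 2 ^ Suc i"
      using not_less_Least[of i "\<lambda>j. a \<le> 2 ^ Suc j"] by (simp add: J_def)
    then show ?thesis
      using Suc by simp
  qed (use assms in simp)
  ultimately show ?thesis
    by (rule that[rotated])
qed

lemma grad_cos_kernel_borel: "n \<ge> 1 \<Longrightarrow> grad (cos_kernel n) \<in> borel_measurable borel"
  unfolding grad_def
  by (intro borel_measurable_continuous_onI continuous_on_vec_lambda torus_smoothD(3) torus_smooth_partial
      cos_kernel_torus_smooth)

text \<open>With s = sqrt n, layer j of the gradient has height of order s^4/2^(5j) and lives in a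
  ball of radius 2^j/s, over which \<Gamma> has mass at most \<eta> (2^j/s)^4. The powers of s
  cancel and 2^(-j) remains. Beyond the radius where the hypothesis applies, the boundedness of
  \<Gamma> leaves a tail of order s^4/s^5.\<close>

lemma nn_integral_grad_cos_kernel_tendsto:
  fixes \<Gamma> :: "real ^ 3 \<Rightarrow> ennreal"
  assumes [measurable]: "\<Gamma> \<in> borel_measurable borel"
    and M: "\<And>y. \<Gamma> y \<le> ennreal M" "M \<ge> 0"
    and small: "\<And>\<eta>::real. \<eta> > 0 \<Longrightarrow> eventually (\<lambda>r. (\<integral>\<^sup>+y\<in>ball 0 r. \<Gamma> y \<partial>lborel) \<le> ennreal (\<eta> * r ^ 4)) (at_right 0)"
  shows "(\<lambda>n. \<integral>\<^sup>+y. ennreal (norm (grad (cos_kernel n) y)) * \<Gamma> y \<partial>centred_measure) \<longlonglongrightarrow> 0"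
proof (rule ennreal_tendsto_0I)
  fix e :: real
  assume e: "0 < e"
  define C :: real where "C = 6000000"
  \<comment> \<open>The layers sum to at most 32 C \<eta> times the geometric sum 2; the factor 128
    makes this \<open>e/2\<close>.\<close>
  define \<eta> where "\<eta> = e / (128 * C)"
  have \<eta>: "\<eta> > 0"
    using e by (simp add: \<eta>_def C_def)
  obtain \<delta> where \<delta>: "\<delta> > 0" "\<And>r. 0 < r \<Longrightarrow> r < \<delta> \<Longrightarrow> (\<integral>\<^sup>+y\<in>ball 0 r. \<Gamma> y \<partial>lborel) \<le> ennreal (\<eta> * r ^ 4)"
    using small[OF \<eta>] unfolding eventually_at_right_field by auto
  have lim: "filterlim (\<lambda>n. sqrt (real n)) at_top sequentially"
    by (rule filterlim_compose[OF sqrt_at_top filterlim_real_sequentially])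
  have "(\<lambda>n. C * (32 * M / \<delta> ^ 5) / sqrt (real n)) \<longlonglongrightarrow> 0"
    by (intro tendsto_divide_0[OF tendsto_const] filterlim_at_top_imp_at_infinity lim)
  then have "eventually (\<lambda>n. C * (32 * M / \<delta> ^ 5) / sqrt (real n) < e/2) sequentially"
    using e by (intro order_tendstoD) auto
  moreover have "eventually (\<lambda>n. 1 / \<delta> < sqrt (real n)) sequentially"
    using lim by (simp add: filterlim_at_top_dense)
  ultimately show "eventually (\<lambda>n. (\<integral>\<^sup>+y. ennreal (norm (grad (cos_kernel n) y)) * \<Gamma> y \<partial>centred_measure) \<le> ennreal e) sequentially"
    using eventually_ge_at_top[of 1]
  proof eventually_elim
    fix n :: nat
    assume n1: "C * (32 * M / \<delta> ^ 5) / sqrt (real n) < e/2" and n2: "1 / \<delta> < sqrt (real n)" and n: "1 \<le> n"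
    define s where "s = sqrt (real n)"
    have s: "s > 0" "1 < s * \<delta>"
      using n n2 \<delta>(1) by (simp_all add: s_def field_simps)
    note [measurable] = grad_cos_kernel_borel[OF n]
    \<comment> \<open>The last scale at which all balls still have radius below \<delta>. The upper
      inequality makes the remainder 2^(-5J) at most 32/(s \<delta>)^5.\<close>
    obtain J where J: "2 ^ J < s * \<delta>" "s * \<delta> \<le> 2 ^ Suc J"
      using dyadic_scale_exists[OF s(2)] by blast
    define c :: "nat \<Rightarrow> real" where "c j = C * s ^ 4 * (32 / 2 ^ (5 * j))" for j
    define d :: real where "d = C * s ^ 4 * (1 / 2 ^ (5 * J))"
    have cd: "c j \<ge> 0" "d \<ge> 0" for j
      using s by (simp_all add: c_def d_def C_def)
    have ptw: "norm (grad (cos_kernel n) y) \<le> (\<Sum>j\<le>J. c j * indicator (ball 0 (2 ^ j / s)) y) + d"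
      if "y \<in> centred_cell" for y
    proof -
      have "norm (grad (cos_kernel n) y) \<le> C * s ^ 4 * decay (s * norm y)"
        using norm_grad_cos_kernel_le[OF that n] by (simp add: C_def s_def)
      also have "\<dots> \<le> C * s ^ 4 * ((\<Sum>j\<le>J. 32 / 2 ^ (5 * j) * indicator {..<2 ^ j} (s * norm y)) + 1 / 2 ^ (5 * J))"
        using s by (intro mult_left_mono decay_le_dyadic) (auto simp: C_def)
      also have "\<dots> = (\<Sum>j\<le>J. c j * indicator {..<2 ^ j} (s * norm y)) + d"
        by (simp add: c_def d_def distrib_left sum_distrib_left mult.assoc)
      also have "(\<Sum>j\<le>J. c j * indicator {..<2 ^ j} (s * norm y)) = (\<Sum>j\<le>J. c j * indicator (ball 0 (2 ^ j / s)) y)"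
        using s by (intro sum.cong refl) (auto simp: indicator_def field_simps)
      finally show ?thesis .
    qed
    have "(\<integral>\<^sup>+y. ennreal (norm (grad (cos_kernel n) y)) * \<Gamma> y \<partial>centred_measure)
        \<le> (\<integral>\<^sup>+y. (\<Sum>j\<le>J. ennreal (c j) * (\<Gamma> y * indicator (ball 0 (2 ^ j / s)) y)) + ennreal d * \<Gamma> y \<partial>centred_measure)"
    proof (rule nn_integral_mono_AE, rule AE_mp[OF AE_centred_measure], rule AE_I2, rule impI)
      fix y :: "real ^ 3"
      assume y: "y \<in> centred_cell"
      have "ennreal (norm (grad (cos_kernel n) y)) * \<Gamma> y
          \<le> ennreal ((\<Sum>j\<le>J. c j * indicator (ball 0 (2 ^ j / s)) y) + d) * \<Gamma> y"
        by (intro mult_right_mono ennreal_leI ptw y) auto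
      also have "\<dots> = ((\<Sum>j\<le>J. ennreal (c j * indicator (ball 0 (2 ^ j / s)) y)) + ennreal d) * \<Gamma> y"
        using cd by (subst ennreal_plus) (auto intro!: sum_nonneg)
      also have "\<dots> = (\<Sum>j\<le>J. ennreal (c j) * (\<Gamma> y * indicator (ball 0 (2 ^ j / s)) y)) + ennreal d * \<Gamma> y"
      proof -
        have "ennreal (c j * indicator (ball 0 (2 ^ j / s)) y) * \<Gamma> y = ennreal (c j) * (\<Gamma> y * indicator (ball 0 (2 ^ j / s)) y)" for j
          by (simp add: indicator_def mult.commute)
        then show ?thesis
          by (simp add: distrib_right sum_distrib_right)
      qed
      finally show "ennreal (norm (grad (cos_kernel n) y)) * \<Gamma> y
          \<le> (\<Sum>j\<le>J. ennreal (c j) * (\<Gamma> y * indicator (ball 0 (2 ^ j / s)) y)) + ennreal d * \<Gamma> y" .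
    qed
    also have "\<dots> = (\<Sum>j\<le>J. ennreal (c j) * (\<integral>\<^sup>+y. \<Gamma> y * indicator (ball 0 (2 ^ j / s)) y \<partial>centred_measure)) + ennreal d * (\<integral>\<^sup>+y. \<Gamma> y \<partial>centred_measure)"
    proof -
      have [measurable]: "ball (0 :: real ^ 3) q \<in> sets borel" for q
        by simp
      show ?thesis
        by (subst nn_integral_add, measurable) (subst nn_integral_sum, measurable, simp add: nn_integral_cmult)
    qed
    also have "\<dots> \<le> (\<Sum>j\<le>J. ennreal (c j) * ennreal (\<eta> * (2 ^ j / s) ^ 4)) + ennreal d * ennreal M"
    proof (intro add_mono sum_mono mult_left_mono)
      fix j
      assume "j \<in> {..J}"
      then have "(2::real) ^ j \<le> 2 ^ J"
        by (intro power_increasing) auto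
      then have "2 ^ j < \<delta> * s"
        using J(1) by (subst mult.commute) (rule le_less_trans)
      then have r: "0 < 2 ^ j / s" "2 ^ j / s < \<delta>"
        using s by (simp_all add: pos_divide_less_eq)
      have [measurable]: "ball (0 :: real ^ 3) q \<in> sets borel" for q
        by simp
      have "(\<integral>\<^sup>+y. \<Gamma> y * indicator (ball 0 (2 ^ j / s)) y \<partial>centred_measure) \<le> (\<integral>\<^sup>+y. \<Gamma> y * indicator (ball 0 (2 ^ j / s)) y \<partial>lborel)"
        by (subst nn_integral_centred_measure, measurable) (intro nn_integral_mono, simp add: indicator_def)
      also have "\<dots> \<le> ennreal (\<eta> * (2 ^ j / s) ^ 4)"
        by (rule \<delta>(2)[OF r])
      finally show "(\<integral>\<^sup>+y. \<Gamma> y * indicator (ball 0 (2 ^ j / s)) y \<partial>centred_measure) \<le> ennreal (\<eta> * (2 ^ j / s) ^ 4)" .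
    next
      have "(\<integral>\<^sup>+y. \<Gamma> y \<partial>centred_measure) \<le> (\<integral>\<^sup>+y. ennreal M \<partial>(centred_measure :: (real ^ 3) measure))"
        by (intro nn_integral_mono M)
      then show "(\<integral>\<^sup>+y. \<Gamma> y \<partial>centred_measure) \<le> ennreal M"
        by (simp add: emeasure_centred_measure_UNIV)
    qed auto
    also have "\<dots> = ennreal ((\<Sum>j\<le>J. c j * (\<eta> * (2 ^ j / s) ^ 4)) + d * M)"
      using cd \<eta> s M by (simp add: ennreal_plus sum_nonneg ennreal_mult flip: sum_ennreal)
    also have "\<dots> \<le> ennreal e"
    proof (rule ennreal_leI)
      have "c j * (\<eta> * (2 ^ j / s) ^ 4) = C * 32 * \<eta> * (1/2) ^ j" for j
      proof -
        have "(2::real) ^ (5 * j) = 2 ^ (4 * j) * 2 ^ j" "(2 ^ j) ^ 4 = (2::real) ^ (4 * j)"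
          by (simp_all add: power_add[symmetric] power_mult[symmetric] mult.commute)
        then show ?thesis
          using s by (simp add: c_def power_divide field_simps)
      qed
      then have "(\<Sum>j\<le>J. c j * (\<eta> * (2 ^ j / s) ^ 4)) = C * 32 * \<eta> * (\<Sum>j\<le>J. (1/2) ^ j)"
        by (simp only: sum_distrib_left)
      also have "\<dots> \<le> C * 32 * \<eta> * 2"
      proof (intro mult_left_mono)
        have "(\<Sum>j\<le>J. (1/2 :: real) ^ j) = 2 - (1/2) ^ J"
          by (induction J) (auto simp: field_simps)
        then show "(\<Sum>j\<le>J. (1/2 :: real) ^ j) \<le> 2"
          by simp
      qed (use \<eta> in \<open>auto simp: C_def\<close>)
      also have "\<dots> = e/2"
        by (simp add: \<eta>_def C_def)
      finally have 1: "(\<Sum>j\<le>J. c j * (\<eta> * (2 ^ j / s) ^ 4)) \<le> e/2" .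
      have "(s * \<delta>) ^ 5 \<le> (2 ^ Suc J) ^ 5"
        using J(2) s by (intro power_mono) auto
      also have "\<dots> = 32 * 2 ^ (5 * J)"
        by (simp add: power_mult_distrib power_mult[symmetric] mult.commute)
      finally have "1 / 2 ^ (5 * J) \<le> 32 / (s * \<delta>) ^ 5"
        using s \<delta>(1) by (simp add: field_simps)
      then have "d * M \<le> C * s ^ 4 * (32 / (s * \<delta>) ^ 5) * M"
        unfolding d_def using s M by (intro mult_right_mono mult_left_mono) (auto simp: C_def)
      also have "\<dots> = C * (32 * M / \<delta> ^ 5) / s"
        using s \<delta>(1) by (simp add: field_simps eval_nat_numeral)
      finally have "d * M \<le> e/2"
        using n1 by (simp add: s_def)
      with 1 show "(\<Sum>j\<le>J. c j * (\<eta> * (2 ^ j / s) ^ 4)) + d * M \<le> e"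
        by simp
    qed
    finally show "(\<integral>\<^sup>+y. ennreal (norm (grad (cos_kernel n) y)) * \<Gamma> y \<partial>centred_measure) \<le> ennreal e" .
  qed
qed

section \<open>Space-time integrals\<close>

definition time_measure :: "real \<Rightarrow> real measure"
  where "time_measure T = density lborel (indicator {0<..<T})"

lemma space_time_measure [simp]: "space (time_measure T) = UNIV"
  by (simp add: time_measure_def)

lemma sets_time_measure [simp, measurable_cong]: "sets (time_measure T) = sets borel"
  by (simp add: time_measure_def)

lemma integral_time_measure:
  fixes f :: "real \<Rightarrow> 'b::{banach, second_countable_topology}"
  assumes "f \<in> borel_measurable borel"
  shows "(LINT t:{0<..<T}|lborel. f t) = (LINT t|time_measure T. f t)"
proof -
  have "time_measure T = density lborel (\<lambda>t. ennreal (indicator {0<..<T} t))"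
    by (simp add: time_measure_def ennreal_indicator)
  then show ?thesis
    unfolding set_lebesgue_integral_def using assms by (simp add: integral_density)
qed

lemma nn_integral_time_measure:
  assumes "f \<in> borel_measurable borel"
  shows "(\<integral>\<^sup>+t. f t \<partial>time_measure T) = (\<integral>\<^sup>+t\<in>{0<..<T}. f t \<partial>lborel)"
  unfolding time_measure_def using assms by (subst nn_integral_density) (auto simp: mult.commute)

lemma AE_time_measure_iff: "(AE t in time_measure T. P t) \<longleftrightarrow> (AE t in lborel. t \<in> {0<..<T} \<longrightarrow> P t)"
  unfolding time_measure_def by (subst AE_density) (auto simp: indicator_def)

interpretation time_measure: finite_measure "time_measure T" for T
proof
  have "emeasure lborel {0<..<T} < \<infinity>"
    by (rule emeasure_bounded_finite) simp
  then show "emeasure (time_measure T) (space (time_measure T)) \<noteq> \<infinity>"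
    by (simp add: time_measure_def emeasure_density)
qed

interpretation time_torus_pair: pair_sigma_finite "time_measure T" torus_measure for T ..

interpretation time_lborel_pair: pair_sigma_finite "time_measure T" lborel for T ..

interpretation time_centred_pair: pair_sigma_finite "time_measure T" centred_measure for T ..

lemma integral_enn2real:
  assumes [measurable]: "f \<in> borel_measurable M" and fin: "(\<integral>\<^sup>+x. f x \<partial>M) < \<infinity>"
  shows "ennreal (LINT x|M. enn2real (f x)) = (\<integral>\<^sup>+x. f x \<partial>M)"
proof -
  have "AE x in M. f x \<noteq> \<infinity>"
    using fin by (intro nn_integral_PInf_AE) auto
  then have "(\<integral>\<^sup>+x. ennreal (enn2real (f x)) \<partial>M) = (\<integral>\<^sup>+x. f x \<partial>M)"
    by (intro nn_integral_cong_AE) (auto simp: less_top)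
  moreover have "(LINT x|M. enn2real (f x)) = enn2real (\<integral>\<^sup>+x. ennreal (enn2real (f x)) \<partial>M)"
    by (rule integral_eq_nn_integral) auto
  ultimately show ?thesis
    using fin by (simp add: less_top)
qed

text \<open>The cube of the space-time modulus of translation in L^3, with values in
  \<open>ennreal\<close> so that the integrals over time, space and shift can be exchanged without
  conditions.\<close>

definition increment_cube :: "real \<Rightarrow> (real \<Rightarrow> real ^ 3 \<Rightarrow> real ^ 3) \<Rightarrow> real ^ 3 \<Rightarrow> ennreal"
  where "increment_cube T u y = (\<integral>\<^sup>+t. \<integral>\<^sup>+x. ennreal (norm (u t (x - y) - u t x) ^ 3) \<partial>torus_measure \<partial>time_measure T)"

lemma increment_cube_borel:
  assumes [measurable]: "(\<lambda>(t, x). u t x) \<in> borel_measurable (borel \<Otimes>\<^sub>M borel)"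
  shows "increment_cube T u \<in> borel_measurable borel"
  unfolding increment_cube_def[abs_def] by measurable

text \<open>The cube of a sum is at most the cube of twice the larger term, hence at most 8 times
  the sum of cubes; translation invariance doubles this to 16.\<close>

lemma increment_cube_le:
  assumes [measurable]: "(\<lambda>(t, x). u t x) \<in> borel_measurable (borel \<Otimes>\<^sub>M borel)"
    and per: "\<And>t. torus_periodic (u t)"
  shows "increment_cube T u y \<le> 16 * (\<integral>\<^sup>+t. \<integral>\<^sup>+x. ennreal (norm (u t x) ^ 3) \<partial>torus_measure \<partial>time_measure T)"
proof -
  have "(\<integral>\<^sup>+x. ennreal (norm (u t (x - y) - u t x) ^ 3) \<partial>torus_measure)
      \<le> 16 * (\<integral>\<^sup>+x. ennreal (norm (u t x) ^ 3) \<partial>torus_measure)" for t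
  proof -
    have "(\<integral>\<^sup>+x. ennreal (norm (u t (x - y) - u t x) ^ 3) \<partial>torus_measure)
        \<le> (\<integral>\<^sup>+x. 8 * ennreal (norm (u t (x - y)) ^ 3) + 8 * ennreal (norm (u t x) ^ 3) \<partial>torus_measure)"
    proof (rule nn_integral_mono)
      fix x
      define a b where "a = norm (u t (x - y))" and "b = norm (u t x)"
      have ab: "a \<ge> 0" "b \<ge> 0"
        by (simp_all add: a_def b_def)
      have "norm (u t (x - y) - u t x) ^ 3 \<le> (a + b) ^ 3"
        unfolding a_def b_def by (intro power_mono norm_triangle_ineq4) auto
      also have "\<dots> \<le> (2 * max a b) ^ 3"
        using ab by (intro power_mono) auto
      also have "\<dots> \<le> 8 * a ^ 3 + 8 * b ^ 3"
        using ab by (auto simp: max_def power_mult_distrib)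
      finally have "ennreal (norm (u t (x - y) - u t x) ^ 3) \<le> ennreal (8 * a ^ 3 + 8 * b ^ 3)"
        by (rule ennreal_leI)
      then show "ennreal (norm (u t (x - y) - u t x) ^ 3) \<le> 8 * ennreal (norm (u t (x - y)) ^ 3) + 8 * ennreal (norm (u t x) ^ 3)"
        using ab by (simp add: ennreal_mult a_def b_def)
    qed
    also have "\<dots> = 8 * (\<integral>\<^sup>+x. ennreal (norm (u t (x - y)) ^ 3) \<partial>torus_measure) + 8 * (\<integral>\<^sup>+x. ennreal (norm (u t x) ^ 3) \<partial>torus_measure)"
      by (simp add: nn_integral_add nn_integral_cmult)
    also have "(\<integral>\<^sup>+x. ennreal (norm (u t (x - y)) ^ 3) \<partial>torus_measure) = (\<integral>\<^sup>+x. ennreal (norm (u t x) ^ 3) \<partial>torus_measure)"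
      by (rule nn_integral_torus_measure_translate) (use per in \<open>auto simp: torus_periodic_def\<close>)
    finally show ?thesis
      by (simp flip: distrib_right)
  qed
  then have "increment_cube T u y \<le> (\<integral>\<^sup>+t. 16 * (\<integral>\<^sup>+x. ennreal (norm (u t x) ^ 3) \<partial>torus_measure) \<partial>time_measure T)"
    unfolding increment_cube_def by (intro nn_integral_mono)
  also have "\<dots> = 16 * (\<integral>\<^sup>+t. \<integral>\<^sup>+x. ennreal (norm (u t x) ^ 3) \<partial>torus_measure \<partial>time_measure T)"
    by (rule nn_integral_cmult) measurable
  finally show ?thesis .
qed

lemma nn_integral_increment_kernel:
  assumes [measurable]: "(\<lambda>(t, x). u t x) \<in> borel_measurable (borel \<Otimes>\<^sub>M borel)" "k \<in> borel_measurable borel"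
    and per: "\<And>t. torus_periodic (u t)" "torus_periodic k"
  shows "(\<integral>\<^sup>+t. \<integral>\<^sup>+x. \<integral>\<^sup>+z. ennreal (k (x - z)) * ennreal (norm (u t z - u t x) ^ 3) \<partial>torus_measure \<partial>torus_measure \<partial>time_measure T)
    = (\<integral>\<^sup>+y. ennreal (k y) * increment_cube T u y \<partial>centred_measure)"
proof -
  have "(\<integral>\<^sup>+x. \<integral>\<^sup>+z. ennreal (k (x - z)) * ennreal (norm (u t z - u t x) ^ 3) \<partial>torus_measure \<partial>torus_measure)
      = (\<integral>\<^sup>+y. ennreal (k y) * (\<integral>\<^sup>+x. ennreal (norm (u t (x - y) - u t x) ^ 3) \<partial>torus_measure) \<partial>centred_measure)" for t
    using convolution_increment_swap[of "u t" "\<lambda>_. 1" "\<lambda>v. ennreal (norm v ^ 3)" k] per by simp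
  then have "(\<integral>\<^sup>+t. \<integral>\<^sup>+x. \<integral>\<^sup>+z. ennreal (k (x - z)) * ennreal (norm (u t z - u t x) ^ 3) \<partial>torus_measure \<partial>torus_measure \<partial>time_measure T)
      = (\<integral>\<^sup>+t. \<integral>\<^sup>+y. ennreal (k y) * (\<integral>\<^sup>+x. ennreal (norm (u t (x - y) - u t x) ^ 3) \<partial>torus_measure) \<partial>centred_measure \<partial>time_measure T)"
    by simp
  also have "\<dots> = (\<integral>\<^sup>+y. \<integral>\<^sup>+t. ennreal (k y) * (\<integral>\<^sup>+x. ennreal (norm (u t (x - y) - u t x) ^ 3) \<partial>torus_measure) \<partial>time_measure T \<partial>centred_measure)"
    by (rule time_centred_pair.Fubini'[symmetric]) measurable
  also have "\<dots> = (\<integral>\<^sup>+y. ennreal (k y) * increment_cube T u y \<partial>centred_measure)"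
    unfolding increment_cube_def by (intro nn_integral_cong nn_integral_cmult) measurable
  finally show ?thesis .
qed

text \<open>\<open>mean_increment\<close> consists of nested Bochner integrals, which are 0 when
  they diverge. The finite cubic integral shows that divergence is confined to a null set of times,
  so the value agrees with the nonnegative integral, where Tonelli moves the shift outside.\<close>

lemma mean_increment_time_integral:
  assumes [measurable]: "(\<lambda>(t, x). u t x) \<in> borel_measurable (borel \<Otimes>\<^sub>M borel)"
    and per: "\<And>t. torus_periodic (u t)"
    and fin: "(\<integral>\<^sup>+t. \<integral>\<^sup>+x. ennreal (norm (u t x) ^ 3) \<partial>torus_measure \<partial>time_measure T) < \<infinity>"
    and r: "r > 0"
  shows "(\<integral>\<^sup>+y\<in>ball 0 r. increment_cube T u y \<partial>lborel)
    = ennreal (measure lborel (ball (0 :: real ^ 3) r) * (LINT t|time_measure T. mean_increment 3 r (u t)))"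
proof -
  let ?B = "ball (0 :: real ^ 3) r"
  have [measurable]: "?B \<in> sets borel"
    by simp
  define b where "b = measure lborel ?B"
  have b: "b > 0"
    using r content_ball_pos[of r "0 :: real ^ 3"] by (simp add: b_def)
  define \<Phi> where "\<Phi> t x = (\<integral>\<^sup>+y\<in>?B. ennreal (norm (u t x - u t (x - y)) ^ 3) \<partial>lborel)" for t x
  define \<Psi> where "\<Psi> t = (\<integral>\<^sup>+x. \<Phi> t x \<partial>torus_measure)" for t
  have \<Phi>_meas [measurable]: "(\<lambda>(t, x). \<Phi> t x) \<in> borel_measurable (borel \<Otimes>\<^sub>M borel)"
    unfolding \<Phi>_def by measurable
  have [measurable]: "\<Psi> \<in> borel_measurable borel"
    unfolding \<Psi>_def by measurable
  have inner: "(LINT y:?B|lborel. norm (u t x - u t (x - y)) powr 3) = enn2real (\<Phi> t x)" for t x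
  proof -
    have "(LINT y:?B|lborel. norm (u t x - u t (x - y)) powr 3)
        = (LINT y|lborel. indicat_real ?B y * norm (u t x - u t (x - y)) ^ 3)"
      by (simp add: set_lebesgue_integral_def powr_numeral)
    also have "\<dots> = enn2real (\<integral>\<^sup>+y. ennreal (indicat_real ?B y * norm (u t x - u t (x - y)) ^ 3) \<partial>lborel)"
      by (rule integral_eq_nn_integral) auto
    also have "(\<integral>\<^sup>+y. ennreal (indicat_real ?B y * norm (u t x - u t (x - y)) ^ 3) \<partial>lborel) = \<Phi> t x"
      unfolding \<Phi>_def by (intro nn_integral_cong) (simp add: indicator_def)
    finally show ?thesis .
  qed
  have mean: "mean_increment 3 r (u t) = 1 / b * (LINT x|torus_measure. enn2real (\<Phi> t x))" for t
    unfolding mean_increment_def inner b_def[symmetric] by (subst integral_torus_measure) auto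
  have total: "(\<integral>\<^sup>+t. \<Psi> t \<partial>time_measure T) = (\<integral>\<^sup>+y\<in>?B. increment_cube T u y \<partial>lborel)"
  proof -
    have "\<Psi> t = (\<integral>\<^sup>+y. \<integral>\<^sup>+x. ennreal (norm (u t x - u t (x - y)) ^ 3) * indicator ?B y \<partial>torus_measure \<partial>lborel)" for t
      unfolding \<Psi>_def \<Phi>_def by (rule torus_lborel_pair.Fubini'[symmetric]) measurable
    then have "(\<integral>\<^sup>+t. \<Psi> t \<partial>time_measure T)
        = (\<integral>\<^sup>+t. \<integral>\<^sup>+y. \<integral>\<^sup>+x. ennreal (norm (u t x - u t (x - y)) ^ 3) * indicator ?B y \<partial>torus_measure \<partial>lborel \<partial>time_measure T)"
      by simp
    also have "\<dots> = (\<integral>\<^sup>+y. \<integral>\<^sup>+t. \<integral>\<^sup>+x. ennreal (norm (u t x - u t (x - y)) ^ 3) * indicator ?B y \<partial>torus_measure \<partial>time_measure T \<partial>lborel)"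
      by (rule time_lborel_pair.Fubini'[symmetric]) measurable
    also have "\<dots> = (\<integral>\<^sup>+y\<in>?B. increment_cube T u y \<partial>lborel)"
      unfolding increment_cube_def by (intro nn_integral_cong) (simp add: nn_integral_multc norm_minus_commute)
    finally show ?thesis .
  qed
  have finite: "(\<integral>\<^sup>+t. \<Psi> t \<partial>time_measure T) < \<infinity>"
  proof -
    define V where "V = 16 * (\<integral>\<^sup>+t. \<integral>\<^sup>+x. ennreal (norm (u t x) ^ 3) \<partial>torus_measure \<partial>time_measure T)"
    have "(\<integral>\<^sup>+y\<in>?B. increment_cube T u y \<partial>lborel) \<le> (\<integral>\<^sup>+y\<in>?B. V \<partial>lborel)"
      using increment_cube_le[OF assms(1) per] by (intro nn_integral_mono mult_right_mono) (auto simp: V_def)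
    also have "\<dots> = V * emeasure lborel ?B"
      by (simp add: nn_integral_cmult_indicator)
    also have "\<dots> < \<infinity>"
      using fin emeasure_lborel_ball_finite[of "0 :: real ^ 3" r] by (simp add: V_def ennreal_mult_less_top)
    finally show ?thesis
      by (simp add: total)
  qed
  then have "AE t in time_measure T. \<Psi> t \<noteq> \<infinity>"
    by (intro nn_integral_PInf_AE) auto
  then have "AE t in time_measure T. mean_increment 3 r (u t) = 1 / b * enn2real (\<Psi> t)"
  proof (rule AE_mp, intro AE_I2 impI)
    fix t
    assume "\<Psi> t \<noteq> \<infinity>"
    then have "ennreal (LINT x|torus_measure. enn2real (\<Phi> t x)) = \<Psi> t"
      unfolding \<Psi>_def by (intro integral_enn2real) (auto simp: less_top)
    moreover have "0 \<le> (LINT x|torus_measure. enn2real (\<Phi> t x))"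
      by (rule Bochner_Integration.integral_nonneg) simp
    ultimately have "(LINT x|torus_measure. enn2real (\<Phi> t x)) = enn2real (\<Psi> t)"
      by (metis enn2real_ennreal)
    then show "mean_increment 3 r (u t) = 1 / b * enn2real (\<Psi> t)"
      by (simp add: mean)
  qed
  then have "(LINT t|time_measure T. mean_increment 3 r (u t)) = (LINT t|time_measure T. 1 / b * enn2real (\<Psi> t))"
    by (intro integral_cong_AE) (auto simp: mean)
  then have "b * (LINT t|time_measure T. mean_increment 3 r (u t)) = (LINT t|time_measure T. enn2real (\<Psi> t))"
    using b by simp
  then show ?thesis
    using integral_enn2real[of \<Psi> "time_measure T"] finite by (simp add: total b_def)
qed

section \<open>Smooth cut-offs in time\<close>

text \<open>The standard flat function exp(-1/x) together with its quotients by powers of x. The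
  derivative of a member is a combination of members, so smoothness of the whole family follows by
  one induction.\<close>

definition flat :: "nat \<Rightarrow> real \<Rightarrow> real"
  where "flat n x = (if x > 0 then exp (- (1 / x)) / x ^ n else 0)"

lemma flat_tendsto_0: "(flat n \<longlongrightarrow> 0) (at 0)"
proof -
  have "((\<lambda>y. y ^ n / exp y) \<longlongrightarrow> 0) (at_top :: real filter)"
    by (rule tendsto_power_div_exp_0)
  then have "((\<lambda>x. inverse x ^ n / exp (inverse x)) \<longlongrightarrow> 0) (at_right (0::real))"
    by (rule filterlim_compose[OF _ filterlim_inverse_at_top_right])
  moreover have "eventually (\<lambda>x. inverse x ^ n / exp (inverse x) = flat n x) (at_right (0::real))"
    unfolding eventually_at_right_field
    by (intro exI[of _ 1]) (auto simp: flat_def exp_minus field_simps)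
  ultimately have "(flat n \<longlongrightarrow> 0) (at_right 0)"
    by (rule Lim_transform_eventually)
  moreover have "(flat n \<longlongrightarrow> 0) (at_left 0)"
    by (rule tendsto_eventually) (auto simp: eventually_at_left_field flat_def intro!: exI[of _ "-1"])
  ultimately show ?thesis
    by (simp add: filterlim_split_at)
qed

text \<open>Away from 0 this is calculus. At 0 the difference quotient of \<open>flat n\<close> is
  exactly \<open>flat (n + 1)\<close>, which tends to 0.\<close>

lemma flat_has_derivative:
  "(flat n has_vector_derivative (flat (n + 2) x - real n *\<^sub>R flat (n + 1) x)) (at x)"
proof (cases x "0::real" rule: linorder_cases)
  case less
  have "((\<lambda>x. 0) has_vector_derivative 0) (at x)"
    by simp
  then have "(flat n has_vector_derivative 0) (at x)"
    by (rule has_vector_derivative_transform_within_open[of _ _ _ "{..<0}"]) (use less in \<open>auto simp: flat_def\<close>)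
  then show ?thesis
    using less by (simp add: flat_def)
next
  case equal
  have "((\<lambda>h. flat (n + 1) h) \<longlongrightarrow> 0) (at 0)"
    by (rule flat_tendsto_0)
  moreover have "flat (n + 1) h = (flat n (0 + h) - flat n 0) / h" for h
    by (simp add: flat_def)
  ultimately have "(flat n has_real_derivative 0) (at 0)"
    by (simp add: DERIV_def)
  then show ?thesis
    using equal by (simp add: flat_def has_real_derivative_iff_has_vector_derivative)
next
  case greater
  have "((\<lambda>x. exp (- (1 / x)) / x ^ n) has_real_derivative (flat (n + 2) x - real n * flat (n + 1) x)) (at x)"
    using greater
    by (auto intro!: derivative_eq_intros simp: flat_def) (cases n; simp add: field_simps power2_eq_square)
  then have "(flat n has_real_derivative (flat (n + 2) x - real n * flat (n + 1) x)) (at x)"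
    by (rule has_field_derivative_transform_within_open[of _ _ _ "{0<..}"]) (use greater in \<open>auto simp: flat_def\<close>)
  then show ?thesis
    by (simp add: has_real_derivative_iff_has_vector_derivative)
qed

lemma smooth_flat: "smooth (flat n)"
  unfolding smooth_def
proof
  fix k
  show "Ck k (flat n)"
  proof (induction k arbitrary: n)
    case 0
    then show ?case
      using flat_has_derivative by (auto intro!: continuous_at_imp_continuous_on has_vector_derivative_continuous)
  next
    case (Suc k)
    have "Ck k (\<lambda>x. flat (n + 2) x + (- real n) *\<^sub>R flat (n + 1) x)"
      by (intro Ck_add Ck_scaleR Ck_const Suc)
    then show ?case
      using flat_has_derivative by (intro Ck_real_SucI[where f' = "\<lambda>x. flat (n + 2) x - real n *\<^sub>R flat (n + 1) x"]) auto
  qed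
qed

definition bump :: "real \<Rightarrow> real"
  where "bump x = flat 0 x * flat 0 (1 - x)"

lemma smooth_compose_affine:
  fixes f :: "real \<Rightarrow> 'b::real_normed_vector"
  assumes "smooth f"
  shows "smooth (\<lambda>x. f (c * x + d))"
  unfolding smooth_def
proof
  fix k
  have "Ck k g \<Longrightarrow> Ck k (\<lambda>x. g (c * x + d))" for g :: "real \<Rightarrow> 'b"
  proof (induction k arbitrary: g)
    case 0
    then show ?case
      by (auto intro!: continuous_on_compose2[of UNIV g] continuous_intros)
  next
    case (Suc k)
    let ?g' = "\<lambda>x. frechet_derivative g (at x) 1"
    have lin: "frechet_derivative g (at x) v = v *\<^sub>R ?g' x" for x v
      using linear_scale[OF has_derivative_linear[OF Ck_differentiable[OF Suc.prems, of x]], of v 1] by simp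
    have "((\<lambda>x. g (c * x + d)) has_vector_derivative c *\<^sub>R ?g' (c * x + d)) (at x)" for x
    proof -
      have "((\<lambda>x. c * x + d) has_derivative (\<lambda>v. c * v)) (at x)"
        by (auto intro!: derivative_eq_intros)
      from diff_chain_at[OF this Ck_differentiable[OF Suc.prems]]
      have "((\<lambda>x. g (c * x + d)) has_derivative (\<lambda>v. frechet_derivative g (at (c * x + d)) (c * v))) (at x)"
        by (simp add: o_def)
      moreover have "frechet_derivative g (at (c * x + d)) (c * v) = v *\<^sub>R c *\<^sub>R ?g' (c * x + d)" for v
        by (subst lin) (simp add: mult.commute)
      ultimately show ?thesis
        by (simp add: has_vector_derivative_def)
    qed
    then show ?case
      by (rule Ck_real_SucI) (intro Ck_scaleR Ck_const Suc.IH, use Suc.prems in auto)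
  qed
  then show "Ck k (\<lambda>x. f (c * x + d))"
    using assms by (simp add: smooth_def)
qed

lemma smooth_bump: "smooth bump"
proof -
  have "smooth (\<lambda>x. flat 0 x *\<^sub>R flat 0 ((-1) * x + 1))"
    by (intro smooth_scaleR smooth_flat smooth_compose_affine)
  then show ?thesis
    by (simp add: bump_def[abs_def])
qed

lemma bump_nonneg: "0 \<le> bump x" and bump_outside: "x \<le> 0 \<or> 1 \<le> x \<Longrightarrow> bump x = 0"
  and bump_pos: "0 < x \<Longrightarrow> x < 1 \<Longrightarrow> 0 < bump x"
  by (auto simp: bump_def flat_def)

definition bump_mass :: real
  where "bump_mass = integral {0..1} bump"

lemma bump_mass_pos: "0 < bump_mass"
proof -
  have c: "continuous_on {0..1} bump"
    by (rule smooth_continuous_on[OF smooth_bump])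
  have "integral {0..1} bump \<noteq> 0"
  proof
    assume "integral {0..1} bump = 0"
    then have "\<And>x. x \<in> {0..1} \<Longrightarrow> bump x = 0"
      using integral_eq_0_iff[OF c] bump_nonneg by auto
    from this[of "1/2"] show False
      using bump_pos[of "1/2"] by simp
  qed
  moreover have "0 \<le> integral {0..1} bump"
    by (intro Henstock_Kurzweil_Integration.integral_nonneg integrable_continuous_interval c bump_nonneg)
  ultimately show ?thesis
    by (simp add: bump_mass_def)
qed

text \<open>Rises from 0 to 1 entirely inside [0,1]. Since the transition lies to the right of 0,
  rescaled steps converge pointwise to the indicator of an open half-line.\<close>

definition smooth_step :: "real \<Rightarrow> real"
  where "smooth_step x = (if x \<le> 0 then 0 else integral {0..x} bump / bump_mass)"

lemma smooth_step_has_derivative: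
  "(smooth_step has_vector_derivative bump x / bump_mass) (at x)"
proof -
  have c: "continuous_on {a..b} bump" for a b
    by (rule smooth_continuous_on[OF smooth_bump])
  \<comment> \<open>Starting the integral at a point left of \<open>x\<close> removes the case
    distinction, so the fundamental theorem applies uniformly, including at the junction 0.\<close>
  have *: "smooth_step x = integral {-N..x} bump / bump_mass" if "-N \<le> x" "0 \<le> N" for N x
  proof -
    have neg: "integral {-N..y} bump = 0" if "y \<le> 0" for y
      using bump_outside that by (subst Henstock_Kurzweil_Integration.integral_cong[where g = "\<lambda>_. 0"]) auto
    show ?thesis
    proof (cases "x \<le> 0")
      case False
      then have "integral {-N..x} bump = integral {-N..0} bump + integral {0..x} bump"
        using that by (intro Henstock_Kurzweil_Integration.integral_combine[symmetric] integrable_continuous_interval c) auto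
      then show ?thesis
        using False neg[of 0] by (simp add: smooth_step_def)
    qed (simp add: smooth_step_def neg)
  qed
  define N where "N = \<bar>x\<bar> + 1"
  then have N: "0 \<le> N" "- N < x"
    by auto
  have "((\<lambda>y. integral {-N..y} bump) has_vector_derivative bump x) (at x within {-N..N})"
    by (rule integral_has_vector_derivative[OF c]) (auto simp: N_def)
  moreover have "at x within {-N..N} = at x"
    by (rule at_within_interior) (auto simp: N_def)
  ultimately have "((\<lambda>y. integral {-N..y} bump) has_vector_derivative bump x) (at x)"
    by simp
  then have "((\<lambda>y. integral {-N..y} bump / bump_mass) has_vector_derivative bump x / bump_mass) (at x)"
    by (simp add: has_real_derivative_iff_has_vector_derivative[symmetric] DERIV_cdivide)
  then show ?thesis
    by (rule has_vector_derivative_transform_within_open[of _ _ _ "{-N<..}"])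
      (use N in \<open>auto intro!: *[symmetric]\<close>)
qed

lemma smooth_smooth_step: "smooth smooth_step"
proof (rule smooth_realI[OF smooth_step_has_derivative])
  have "smooth (\<lambda>x. (1 / bump_mass) *\<^sub>R bump x)"
    by (intro smooth_scaleR smooth_const smooth_bump)
  then show "smooth (\<lambda>x. bump x / bump_mass)"
    by simp
qed

lemma smooth_step_0: "x \<le> 0 \<Longrightarrow> smooth_step x = 0"
  by (simp add: smooth_step_def)

lemma smooth_step_1:
  assumes "1 \<le> x"
  shows "smooth_step x = 1"
proof -
  have c: "continuous_on {a..b} bump" for a b
    by (rule smooth_continuous_on[OF smooth_bump])
  have "integral {0..x} bump = integral {0..1} bump + integral {1..x} bump"
    using assms by (intro Henstock_Kurzweil_Integration.integral_combine[symmetric] integrable_continuous_interval c) auto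
  moreover have "integral {1..x} bump = 0"
    using bump_outside by (subst Henstock_Kurzweil_Integration.integral_cong[where g = "\<lambda>_. 0"]) auto
  ultimately show ?thesis
    using assms bump_mass_pos by (simp add: smooth_step_def bump_mass_def)
qed

lemma smooth_step_bounds: "0 \<le> smooth_step x" "smooth_step x \<le> 1"
proof -
  have mono: "smooth_step x \<le> smooth_step y" if "x \<le> y" for x y
    using that
  proof (rule DERIV_nonneg_imp_nondecreasing)
    fix z
    show "\<exists>d. (smooth_step has_real_derivative d) (at z) \<and> 0 \<le> d"
      using smooth_step_has_derivative bump_nonneg[of z] bump_mass_pos
      by (auto simp: has_real_derivative_iff_has_vector_derivative intro!: exI[of _ "bump z / bump_mass"])
  qed
  show "0 \<le> smooth_step x"
    using mono[of "min x 0" x] smooth_step_0[of "min x 0"] by simp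
  show "smooth_step x \<le> 1"
    using mono[of x "max x 1"] smooth_step_1[of "max x 1"] by simp
qed

section \<open>Weak derivatives in time\<close>

lemma bump_integral:
  "integrable lborel (\<lambda>x. bump x / bump_mass)" "(LINT x|lborel. bump x / bump_mass) = 1"
proof -
  have c: "continuous_on {0..1} bump"
    by (rule smooth_continuous_on[OF smooth_bump])
  have eq: "bump x = indicat_real {0..1} x * bump x" for x
    by (cases "x \<in> {0..1}") (use bump_outside[of x] in auto)
  have si: "set_integrable lborel {0..1} bump"
    by (rule borel_integrable_atLeastAtMost'[OF c])
  then have i: "integrable lborel bump"
    unfolding set_integrable_def by (simp add: eq[symmetric])
  have "(LINT x|lborel. bump x) = (LINT x:{0..1}|lborel. bump x)"
    unfolding set_lebesgue_integral_def by (simp add: eq[symmetric])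
  also have "\<dots> = bump_mass"
    unfolding bump_mass_def by (rule set_borel_integral_eq_integral(2)[OF si])
  finally show "(LINT x|lborel. bump x / bump_mass) = 1"
    using bump_mass_pos by simp
  show "integrable lborel (\<lambda>x. bump x / bump_mass)"
    using i by simp
qed

text \<open>The derivative of the step of width 1/k starting at \<open>q\<close>, a smooth
  approximation of the point mass at \<open>q\<close> from the right. The argument is k(r - q),
  expanded to fit the affine composition rule.\<close>

definition bump_scaled :: "nat \<Rightarrow> real \<Rightarrow> real \<Rightarrow> real"
  where "bump_scaled k q r = real k * (bump (real k * r + - real k * q) / bump_mass)"

lemma bump_scaled_borel [measurable]: "bump_scaled k q \<in> borel_measurable borel"
proof -
  have [measurable]: "bump \<in> borel_measurable borel"
    by (rule borel_measurable_continuous_onI[OF smooth_continuous_on[OF smooth_bump]])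
  show ?thesis
    unfolding bump_scaled_def[abs_def] by measurable
qed

text \<open>The substitution r = s + x/k fixes the bump and moves the scaling into \<open>b\<close>;
  on the support of the bump the argument stays in [s, s+1], where \<open>b\<close> is
  bounded.\<close>

lemma bump_concentration:
  fixes b :: "real \<Rightarrow> real"
  assumes b: "continuous_on UNIV b"
  shows "(\<lambda>k. LINT r|lborel. bump_scaled k s r * b r) \<longlonglongrightarrow> b s"
proof -
  have [measurable]: "b \<in> borel_measurable borel" "bump \<in> borel_measurable borel"
    using b smooth_continuous_on[OF smooth_bump] by (auto intro: borel_measurable_continuous_onI)
  have ev: "eventually (\<lambda>k. (LINT r|lborel. bump_scaled k s r * b r)
      = (LINT x|lborel. bump x / bump_mass * b (s + x / real k))) sequentially"
    using eventually_gt_at_top[of 0]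
  proof eventually_elim
    fix k :: nat
    assume k: "0 < k"
    have "(LINT r|lborel. bump_scaled k s r * b r)
      = \<bar>1 / real k\<bar> *\<^sub>R (LINT x|lborel. bump_scaled k s (s + 1 / real k * x) * b (s + 1 / real k * x))"
      by (rule lborel_integral_real_affine) (use k in simp)
    also have "\<dots> = \<bar>1 / real k\<bar> *\<^sub>R (LINT x|lborel. (real k * (bump x / bump_mass)) * b (s + 1 / real k * x))"
    proof -
      have "real k * (s + 1 / real k * x) + - real k * s = x" for x
        using k by (simp add: field_simps)
      then show ?thesis
        by (simp only: bump_scaled_def)
    qed
    also have "\<bar>1 / real k\<bar> *\<^sub>R (LINT x|lborel. (real k * (bump x / bump_mass)) * b (s + 1 / real k * x))
        = (LINT x|lborel. \<bar>1 / real k\<bar> *\<^sub>R ((real k * (bump x / bump_mass)) * b (s + 1 / real k * x)))"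
      by (rule integral_scaleR_right[symmetric])
    also have "\<dots> = (LINT x|lborel. bump x / bump_mass * b (s + x / real k))"
      using k by (intro Bochner_Integration.integral_cong refl) simp
    finally show "(LINT r|lborel. bump_scaled k s r * b r)
      = (LINT x|lborel. bump x / bump_mass * b (s + x / real k))" .
  qed
  have lim: "(\<lambda>k. LINT x|lborel. bump x / bump_mass * b (s + x / real k)) \<longlonglongrightarrow> (LINT x|lborel. bump x / bump_mass * b s)"
  proof -
    have "compact (b ` {s..s + 1})"
      by (intro compact_continuous_image continuous_on_subset[OF b]) auto
    from compact_imp_bounded[OF this] obtain M where "\<forall>y\<in>b ` {s..s + 1}. norm y \<le> M"
      unfolding bounded_iff by blast
    then have M: "\<bar>b x\<bar> \<le> M" if "x \<in> {s..s + 1}" for x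
      using that by auto
    have "(\<lambda>k. LINT x|lborel. bump x / bump_mass * b (s + x / real (Suc k))) \<longlonglongrightarrow> (LINT x|lborel. bump x / bump_mass * b s)"
    proof (rule integral_dominated_convergence[where w = "\<lambda>x. bump x / bump_mass * M"])
      show "integrable lborel (\<lambda>x. bump x / bump_mass * M)"
        using bump_integral(1) by (rule integrable_mult_left)
      show "AE x in lborel. (\<lambda>k. bump x / bump_mass * b (s + x / real (Suc k))) \<longlonglongrightarrow> bump x / bump_mass * b s"
      proof (rule AE_I2)
        fix x :: real
        have "(\<lambda>k. s + x / real (Suc k)) \<longlonglongrightarrow> s + 0"
          by (intro tendsto_intros LIMSEQ_Suc[OF lim_const_over_n])
        then have "(\<lambda>k. b (s + x / real (Suc k))) \<longlonglongrightarrow> b s"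
          using continuous_on_tendsto_compose[OF b, of "\<lambda>k. s + x / real (Suc k)" s sequentially] by simp
        then show "(\<lambda>k. bump x / bump_mass * b (s + x / real (Suc k))) \<longlonglongrightarrow> bump x / bump_mass * b s"
          by (intro tendsto_intros)
      qed
      show "AE x in lborel. norm (bump x / bump_mass * b (s + x / real (Suc k))) \<le> bump x / bump_mass * M" for k
      proof (rule AE_I2)
        fix x :: real
        show "norm (bump x / bump_mass * b (s + x / real (Suc k))) \<le> bump x / bump_mass * M"
        proof (cases "x \<in> {0..1}")
          case True
          then have "0 \<le> x / real (Suc k)" "x / real (Suc k) \<le> 1"
            by (auto simp: divide_le_eq)
          then have "\<bar>b (s + x / real (Suc k))\<bar> \<le> M"
            by (intro M) auto
          then show ?thesis
            using bump_nonneg[of x] bump_mass_pos by (simp add: abs_mult mult_left_mono divide_right_mono)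
        qed (use bump_outside[of x] in auto)
      qed
    qed measurable
    then show ?thesis
      by (rule LIMSEQ_imp_Suc)
  qed
  have "(LINT x|lborel. bump x / bump_mass * b s) = (LINT x|lborel. bump x / bump_mass) * b s"
    by (rule integral_mult_left_zero)
  also have "\<dots> = b s"
    by (simp only: bump_integral mult_1)
  finally show ?thesis
    using lim tendsto_cong[OF ev, of "b s"] by (simp only:)
qed

lemma indicator_Ioc_integral_continuous:
  fixes g :: "real \<Rightarrow> real"
  assumes g: "integrable (time_measure T) g"
  shows "continuous_on A (\<lambda>t. LINT r|time_measure T. indicat_real {s<..t} r * g r)"
proof (rule continuous_at_imp_continuous_on, intro ballI)
  fix t
  note [measurable] = borel_measurable_integrable[OF g]
  have "AE r in time_measure T. r \<noteq> t"
    unfolding AE_time_measure_iff using AE_lborel_singleton[of t] by auto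
  then show "isCont (\<lambda>t. LINT r|time_measure T. indicat_real {s<..t} r * g r) t"
    unfolding continuous_at_sequentially o_def
  proof (intro allI impI)
    fix X :: "nat \<Rightarrow> real"
    assume X: "X \<longlonglongrightarrow> t"
    show "(\<lambda>n. LINT r|time_measure T. indicat_real {s<..X n} r * g r) \<longlonglongrightarrow> (LINT r|time_measure T. indicat_real {s<..t} r * g r)"
    proof (rule integral_dominated_convergence[where w = "\<lambda>r. \<bar>g r\<bar>"])
      show "AE r in time_measure T. (\<lambda>n. indicat_real {s<..X n} r * g r) \<longlonglongrightarrow> indicat_real {s<..t} r * g r"
        using \<open>AE r in time_measure T. r \<noteq> t\<close>
      proof (rule AE_mp, intro AE_I2 impI)
        fix r
        assume "r \<noteq> t"
        have "eventually (\<lambda>n. indicat_real {s<..X n} r = indicat_real {s<..t} r) sequentially"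
        proof (cases "r < t")
          case True
          from order_tendstoD(1)[OF X this] show ?thesis
            by eventually_elim (use True in \<open>auto simp: indicator_def\<close>)
        next
          case False
          with \<open>r \<noteq> t\<close> have "t < r"
            by simp
          from order_tendstoD(2)[OF X this] show ?thesis
            by eventually_elim (use \<open>t < r\<close> in \<open>auto simp: indicator_def\<close>)
        qed
        then have "eventually (\<lambda>n. indicat_real {s<..X n} r * g r = indicat_real {s<..t} r * g r) sequentially"
          by eventually_elim simp
        then show "(\<lambda>n. indicat_real {s<..X n} r * g r) \<longlonglongrightarrow> indicat_real {s<..t} r * g r"
          by (rule tendsto_eventually)
      qed
    qed (use g in \<open>auto simp: indicator_def\<close>)
  qed
qed

lemma integrable_indicator_Ioc:
  fixes g :: "real \<Rightarrow> real"
  assumes "integrable (time_measure T) g"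
  shows "integrable (time_measure T) (\<lambda>r. indicat_real {s<..t} r * g r)"
  using integrable_mult_indicator[of "{s<..t}" "time_measure T" g] assms by simp

lemma indicator_Ioc_integral_diff:
  fixes g :: "real \<Rightarrow> real"
  assumes g: "integrable (time_measure T) g" and "s \<le> t" "0 \<le> s"
  shows "(LINT r|time_measure T. indicat_real {s<..t} r * g r)
    = (LINT r|time_measure T. indicat_real {0<..t} r * g r) - (LINT r|time_measure T. indicat_real {0<..s} r * g r)"
proof -
  have "indicat_real {s<..t} r * g r = indicat_real {0<..t} r * g r - indicat_real {0<..s} r * g r" for r
    using assms(2,3) by (auto simp: indicator_def)
  then show ?thesis
    using integrable_indicator_Ioc[OF g] by simp
qed

text \<open>The test functions are smooth approximations of the indicator of (s,t]: their
  derivatives concentrate at the two ends and give the increment of \<open>b\<close>. They must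
  vanish near 0 and \<open>T\<close>, so interior times are treated first and the end points are
  reached by continuity.\<close>

lemma weak_time_derivative:
  fixes b g :: "real \<Rightarrow> real"
  assumes "T > 0" and b: "continuous_on UNIV b" and g: "integrable (time_measure T) g"
    and weak: "\<And>\<theta>. smooth \<theta> \<Longrightarrow> \<exists>c d. 0 < c \<and> d < T \<and> (\<forall>t. t \<notin> {c..d} \<longrightarrow> \<theta> t = 0) \<Longrightarrow>
      (LINT t|time_measure T. vector_derivative \<theta> (at t) * b t + \<theta> t * g t) = 0"
    and st: "0 \<le> s" "s \<le> t" "t \<le> T"
  shows "b t - b s = (LINT r|time_measure T. indicat_real {s<..t} r * g r)"
proof -
  note [measurable] = borel_measurable_integrable[OF g]
  have [measurable]: "b \<in> borel_measurable borel" "bump \<in> borel_measurable borel" "smooth_step \<in> borel_measurable borel"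
    using b smooth_continuous_on[OF smooth_bump] smooth_continuous_on[OF smooth_smooth_step]
    by (auto intro: borel_measurable_continuous_onI)
  have interior: "b t - b s = (LINT r|time_measure T. indicat_real {s<..t} r * g r)" if st: "0 < s" "s < t" "t < T" for s t
  proof -
    define \<theta> where "\<theta> k r = smooth_step (real k * r + - real k * s) - smooth_step (real k * r + - real k * t)" for k r
    define D where "D k r = bump_scaled k s r - bump_scaled k t r" for k r
    have \<theta>': "vector_derivative (\<theta> k) (at r) = D k r" for k r
    proof -
      have "((\<lambda>r. smooth_step (real k * r + - real k * q)) has_vector_derivative bump_scaled k q r) (at r)" for q
      proof -
        have "((\<lambda>r. real k * r + - real k * q) has_vector_derivative real k) (at r)"
          by (auto intro!: derivative_eq_intros simp: has_real_derivative_iff_has_vector_derivative[symmetric])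
        from vector_diff_chain_at[OF this smooth_step_has_derivative] show ?thesis
          by (simp add: o_def bump_scaled_def)
      qed
      then show ?thesis
        unfolding \<theta>_def D_def by (intro vector_derivative_at has_vector_derivative_diff)
    qed
    have \<theta>_smooth: "smooth (\<theta> k)" for k
    proof -
      have "smooth (\<lambda>r. smooth_step (real k * r + - real k * s) + (-1) *\<^sub>R smooth_step (real k * r + - real k * t))"
        by (intro smooth_add smooth_scaleR smooth_const smooth_compose_affine smooth_smooth_step)
      then show ?thesis
        by (simp add: \<theta>_def[abs_def])
    qed
    \<comment> \<open>The falling step occupies [t, t + 1/k], which has to end before
      \<open>T\<close> for the test function to be admissible.\<close>
    have "eventually (\<lambda>k. 1 / (T - t) < real k) sequentially"
      using filterlim_real_sequentially by (simp add: filterlim_at_top_dense)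
    then have ev: "eventually (\<lambda>k. 0 < k \<and> t + 1 / real k < T) sequentially"
      using eventually_gt_at_top[of 0]
      by eventually_elim (use st in \<open>auto simp: field_simps\<close>)
    have zero: "eventually (\<lambda>k. (LINT r|lborel. bump_scaled k s r * b r)
        - (LINT r|lborel. bump_scaled k t r * b r)
        + (LINT r|time_measure T. \<theta> k r * g r) = 0) sequentially"
      using ev
    proof eventually_elim
      fix k :: nat
      assume k: "0 < k \<and> t + 1 / real k < T"
      have bump0: "bump_scaled k q r = 0" if "r \<notin> {q..q + 1 / real k}" for r q
      proof -
        have "real k * r + - real k * q = real k * (r - q)"
          by (simp add: algebra_simps)
        moreover have "r \<le> q \<Longrightarrow> real k * (r - q) \<le> 0"
          by (simp add: mult_nonneg_nonpos)
        moreover have "q + 1 / real k < r \<Longrightarrow> 1 \<le> real k * (r - q)"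
          using k by (simp add: field_simps)
        ultimately have "real k * r + - real k * q \<le> 0 \<or> 1 \<le> real k * r + - real k * q"
          using that by fastforce
        then show ?thesis
          by (simp only: bump_scaled_def bump_outside div_0 mult_zero_right)
      qed
      have supp: "\<theta> k r = 0" if "r \<notin> {s..t + 1 / real k}" for r
      proof (cases "r < s")
        case True
        then show ?thesis
          using st by (simp add: \<theta>_def smooth_step_0 mult_left_mono)
      next
        case False
        then have "t + 1 / real k < r"
          using that by auto
        then have "1 \<le> real k * r + - real k * t"
          using k by (simp add: field_simps)
        moreover have "real k * r + - real k * t \<le> real k * r + - real k * s"
          using st by (simp add: mult_left_mono)
        ultimately show ?thesis
          by (simp add: \<theta>_def smooth_step_1)
      qed
      have "(LINT r|time_measure T. vector_derivative (\<theta> k) (at r) * b r + \<theta> k r * g r) = 0"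
        using k st supp by (intro weak \<theta>_smooth exI[of _ s] exI[of _ "t + 1 / real k"]) auto
      then have w: "(LINT r|time_measure T. D k r * b r + \<theta> k r * g r) = 0"
        by (simp add: \<theta>')
      have ib: "integrable lborel (\<lambda>r. bump_scaled k q r * b r)" for q
      proof -
        have "set_integrable lborel {q..q + 1 / real k} (\<lambda>r. bump_scaled k q r * b r)"
          unfolding bump_scaled_def
          by (intro borel_integrable_atLeastAtMost' continuous_intros continuous_on_subset[OF b]
              continuous_on_compose2[OF smooth_continuous_on[OF smooth_bump, of UNIV]]) (use bump_mass_pos in auto)
        moreover have "indicat_real {q..q + 1 / real k} r *\<^sub>R (bump_scaled k q r * b r)
            = bump_scaled k q r * b r" for r
          using bump0[of r q] by (auto simp: indicator_def)
        ultimately show ?thesis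
          by (simp only: set_integrable_def)
      qed
      have ti: "integrable (time_measure T) (\<lambda>r. bump_scaled k q r * b r)"
          "(LINT r|time_measure T. bump_scaled k q r * b r)
            = (LINT r|lborel. bump_scaled k q r * b r)"
        if q: "0 < q" "q + 1 / real k < T" for q
      proof -
        have eq: "indicat_real {0<..<T} r * (bump_scaled k q r * b r)
            = bump_scaled k q r * b r" for r
          by (cases "r \<in> {q..q + 1 / real k}") (use q bump0[of r q] in auto)
        have tm: "time_measure T = density lborel (\<lambda>t. ennreal (indicator {0<..<T} t))"
          by (simp add: time_measure_def ennreal_indicator)
        show "integrable (time_measure T) (\<lambda>r. bump_scaled k q r * b r)"
        proof -
          have "integrable lborel (\<lambda>r. indicat_real {0<..<T} r *\<^sub>R (bump_scaled k q r * b r))"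
            by (simp only: real_scaleR_def eq ib)
          then show ?thesis
            unfolding tm by (subst integrable_density) auto
        qed
        show "(LINT r|time_measure T. bump_scaled k q r * b r)
            = (LINT r|lborel. bump_scaled k q r * b r)"
        proof -
          have "(LINT r|time_measure T. bump_scaled k q r * b r)
              = (LINT r|lborel. indicat_real {0<..<T} r *\<^sub>R (bump_scaled k q r * b r))"
            unfolding tm by (rule integral_density) auto
          then show ?thesis
            by (simp only: real_scaleR_def eq)
        qed
      qed
      have i\<theta>: "integrable (time_measure T) (\<lambda>r. \<theta> k r * g r)"
      proof (rule Bochner_Integration.integrable_bound[OF g])
        show "AE r in time_measure T. norm (\<theta> k r * g r) \<le> norm (g r)"
        proof (rule AE_I2)
          fix r
          have "\<bar>\<theta> k r\<bar> \<le> 1"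
            using smooth_step_bounds[of "real k * r + - real k * s"] smooth_step_bounds[of "real k * r + - real k * t"]
            by (simp add: \<theta>_def abs_le_iff)
          then show "norm (\<theta> k r * g r) \<le> norm (g r)"
            by (simp add: abs_mult mult_left_le_one_le)
        qed
      qed (simp add: \<theta>_def)
      have "s + 1 / real k < T"
        using k st by linarith
      with w show "(LINT r|lborel. bump_scaled k s r * b r)
        - (LINT r|lborel. bump_scaled k t r * b r)
        + (LINT r|time_measure T. \<theta> k r * g r) = 0"
        using ti[of s] ti[of t] k st i\<theta> bump_mass_pos by (simp add: D_def left_diff_distrib)
    qed
    have lim\<theta>: "(\<lambda>k. LINT r|time_measure T. \<theta> k r * g r) \<longlonglongrightarrow> (LINT r|time_measure T. indicat_real {s<..t} r * g r)"
    proof (rule integral_dominated_convergence[where w = "\<lambda>r. \<bar>g r\<bar>"])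
      have step: "(\<lambda>k. smooth_step (real k * r + - real k * q)) \<longlonglongrightarrow> indicat_real {q<..} r" for r q
      proof (cases "q < r")
        case True
        have "eventually (\<lambda>k. 1 / (r - q) < real k) sequentially"
          using filterlim_real_sequentially by (simp add: filterlim_at_top_dense)
        then have "eventually (\<lambda>k. smooth_step (real k * r + - real k * q) = 1) sequentially"
        proof eventually_elim
          fix k :: nat
          assume "1 / (r - q) < real k"
          then have "1 < real k * (r - q)"
            using True by (simp add: field_simps)
          then show "smooth_step (real k * r + - real k * q) = 1"
            by (intro smooth_step_1) (simp add: algebra_simps)
        qed
        then show ?thesis
          using True by (simp add: tendsto_eventually)
      next
        case False
        then have "smooth_step (real k * r + - real k * q) = 0" for k
          by (intro smooth_step_0) (simp add: mult_left_mono)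
        then show ?thesis
          using False by simp
      qed
      show "AE r in time_measure T. (\<lambda>k. \<theta> k r * g r) \<longlonglongrightarrow> indicat_real {s<..t} r * g r"
      proof (rule AE_I2)
        fix r
        have "(\<lambda>k. \<theta> k r * g r) \<longlonglongrightarrow> (indicat_real {s<..} r - indicat_real {t<..} r) * g r"
          unfolding \<theta>_def by (intro tendsto_intros step)
        also have "indicat_real {s<..} r - indicat_real {t<..} r = indicat_real {s<..t} r"
          using st by (auto simp: indicator_def)
        finally show "(\<lambda>k. \<theta> k r * g r) \<longlonglongrightarrow> indicat_real {s<..t} r * g r" .
      qed
      show "AE r in time_measure T. norm (\<theta> k r * g r) \<le> \<bar>g r\<bar>" for k
      proof (rule AE_I2)
        fix r
        have "\<bar>\<theta> k r\<bar> \<le> 1"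
          using smooth_step_bounds[of "real k * r + - real k * s"] smooth_step_bounds[of "real k * r + - real k * t"]
          by (simp add: \<theta>_def abs_le_iff)
        then show "norm (\<theta> k r * g r) \<le> \<bar>g r\<bar>"
          by (simp add: abs_mult mult_left_le_one_le)
      qed
    qed (use g in \<open>auto simp: \<theta>_def\<close>)
    have "(\<lambda>k. (LINT r|lborel. bump_scaled k s r * b r)
        - (LINT r|lborel. bump_scaled k t r * b r)
        + (LINT r|time_measure T. \<theta> k r * g r)) \<longlonglongrightarrow> b s - b t + (LINT r|time_measure T. indicat_real {s<..t} r * g r)"
      by (intro tendsto_intros bump_concentration b lim\<theta>)
    moreover have "(\<lambda>k. (LINT r|lborel. bump_scaled k s r * b r)
        - (LINT r|lborel. bump_scaled k t r * b r)
        + (LINT r|time_measure T. \<theta> k r * g r)) \<longlonglongrightarrow> 0"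
      by (rule tendsto_eventually[OF zero])
    ultimately have "b s - b t + (LINT r|time_measure T. indicat_real {s<..t} r * g r) = 0"
      by (rule LIMSEQ_unique)
    then show ?thesis
      by simp
  qed
  \<comment> \<open>The interior identity says that \<open>F\<close> is constant on the open
    interval; being continuous, it is constant on the closure.\<close>
  define F where "F t = b t - (LINT r|time_measure T. indicat_real {0<..t} r * g r)" for t
  have "F r = F (T/2)" if r: "r \<in> {0<..<T}" for r
    using interior[of r "T/2"] interior[of "T/2" r] r indicator_Ioc_integral_diff[OF g, of r "T/2"]
      indicator_Ioc_integral_diff[OF g, of "T/2" r] \<open>T > 0\<close>
    by (cases r "T/2" rule: linorder_cases) (auto simp: F_def)
  moreover have "continuous_on (closure {0<..<T}) F"
    unfolding F_def by (intro continuous_intros continuous_on_subset[OF b] indicator_Ioc_integral_continuous g) auto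
  ultimately have const: "F r = F (T/2)" if "r \<in> closure {0<..<T}" for r
    using continuous_constant_on_closure[of "{0<..<T}" F "F (T/2)" r] that by blast
  have "s \<in> closure {0<..<T}" "t \<in> closure {0<..<T}"
    using st \<open>T > 0\<close> by simp_all
  from const[OF this(1)] const[OF this(2)] have "F t = F s"
    by (rule trans[OF _ sym, rotated])
  then show ?thesis
    using indicator_Ioc_integral_diff[OF g st(2,1)] by (simp add: F_def)
qed

text \<open>The right-hand side is itself an increment, so local estimates chain without loss over
  any number of short intervals.\<close>

lemma telescoping_bound:
  fixes F \<mu> :: "real \<Rightarrow> real"
  assumes "\<delta> > 0" and local: "\<And>s t. 0 \<le> s \<Longrightarrow> s \<le> t \<Longrightarrow> t \<le> T \<Longrightarrow> t - s < \<delta> \<Longrightarrow> \<bar>F t - F s\<bar> \<le> \<mu> t - \<mu> s"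
    and "0 \<le> s" "s \<le> t" "t \<le> T"
  shows "\<bar>F t - F s\<bar> \<le> \<mu> t - \<mu> s"
proof -
  have "\<bar>F t - F s\<bar> \<le> \<mu> t - \<mu> s" if "0 \<le> s" "s \<le> t" "t \<le> T" "t - s < real (Suc N) * \<delta>" for N s t
    using that
  proof (induction N arbitrary: t)
    case 0
    then show ?case
      using local by simp
  next
    case (Suc N)
    show ?case
    proof (cases "t - s < \<delta>")
      case False
      show ?thesis
      proof (cases "t - s < real (Suc N) * \<delta>")
        case True
        then show ?thesis
          using Suc by blast
      next
        case False
        \<comment> \<open>Cuts [s,t] into N + 2 equal pieces of length \<delta> c, each shorter than
          \<delta>; \<open>u\<close> is the start of the last one.\<close>
        define c where "c = (t - s) / (real (Suc (Suc N)) * \<delta>)"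
        define u where "u = s + real (Suc N) * (\<delta> * c)"
        have c: "0 \<le> c" "c < 1" "t - s = real (Suc (Suc N)) * (\<delta> * c)"
          using Suc.prems \<open>\<delta> > 0\<close> by (auto simp: c_def field_simps add_pos_nonneg)
        have dc: "0 \<le> \<delta> * c" "\<delta> * c < \<delta>"
          using c \<open>\<delta> > 0\<close> by auto
        have tu: "t - u = \<delta> * c"
          using c(3) by (simp add: u_def algebra_simps)
        have su: "u - s = real (Suc N) * (\<delta> * c)"
          by (simp add: u_def)
        have "real (Suc N) * (\<delta> * c) < real (Suc N) * \<delta>"
          using dc by (intro mult_strict_left_mono) auto
        moreover have "0 \<le> real (Suc N) * (\<delta> * c)"
          by (rule mult_nonneg_nonneg[OF of_nat_0_le_iff dc(1)])
        ultimately have "\<bar>F u - F s\<bar> \<le> \<mu> u - \<mu> s"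
          using Suc.prems tu su dc by (intro Suc.IH) linarith+
        moreover have "\<bar>F t - F u\<bar> \<le> \<mu> t - \<mu> u"
          using Suc.prems tu su dc \<open>0 \<le> real (Suc N) * (\<delta> * c)\<close> by (intro local) linarith+
        ultimately show ?thesis
          by linarith
      qed
    qed (use Suc local in auto)
  qed
  moreover obtain N :: nat where "(t - s) / \<delta> < real N"
    using reals_Archimedean2 by blast
  then have "t - s < real (Suc N) * \<delta>"
    using \<open>\<delta> > 0\<close> by (simp add: field_simps)
  ultimately show ?thesis
    using assms by blast
qed

text \<open>The symmetry of \<open>B\<close> turns an increment along the diagonal into two increments in the first
  argument, so that no differentiability of the diagonal has to be known in advance.\<close>

lemma diagonal_increment:
  fixes B :: "real \<Rightarrow> real \<Rightarrow> real" and Q A :: "nat \<Rightarrow> real \<Rightarrow> 'b::euclidean_space"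
  assumes "T > 0"
    and sym: "\<And>s t. s \<in> {0..T} \<Longrightarrow> t \<in> {0..T} \<Longrightarrow> B s t = B t s"
    and inc: "\<And>s t \<tau>. 0 \<le> s \<Longrightarrow> s \<le> t \<Longrightarrow> t \<le> T \<Longrightarrow> \<tau> \<in> {0..T} \<Longrightarrow>
      B t \<tau> - B s \<tau> = (LINT r|time_measure T. indicat_real {s<..t} r * (\<Sum>j<m. Q j r \<bullet> A j \<tau>))"
    and Q: "\<And>j. integrable (time_measure T) (Q j)"
    and A: "\<And>j. continuous_on UNIV (A j)"
    and t: "0 \<le> t" "t \<le> T"
  shows "integrable (time_measure T) (\<lambda>r. \<Sum>j<m. Q j r \<bullet> A j r)"
    "B t t - B 0 0 = 2 * (LINT r|time_measure T. indicat_real {0<..t} r * (\<Sum>j<m. Q j r \<bullet> A j r))"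
proof -
  define D where "D r = (\<Sum>j<m. Q j r \<bullet> A j r)" for r
  define M where "M r = (\<Sum>j<m. norm (Q j r))" for r
  have [measurable]: "A j \<in> borel_measurable borel" "Q j \<in> borel_measurable borel" for j
    using A borel_measurable_integrable[OF Q] by (auto intro: borel_measurable_continuous_onI simp: measurable_cong_sets[OF sets_time_measure refl])
  have AE_T: "AE r in time_measure T. r \<in> {0<..<T}"
    by (simp add: AE_time_measure_iff)
  have intM: "integrable (time_measure T) M"
    unfolding M_def using Q by auto
  have M0: "0 \<le> M r" for r
    by (simp add: M_def sum_nonneg)
  have intQA: "integrable (time_measure T) (\<lambda>r. \<Sum>j<m. Q j r \<bullet> A j \<tau>)" for \<tau>
    using Q by auto
  show intD': "integrable (time_measure T) (\<lambda>r. \<Sum>j<m. Q j r \<bullet> A j r)"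
  proof (intro Bochner_Integration.integrable_sum)
    fix j
    have "compact (A j ` {0..T})"
      by (intro compact_continuous_image continuous_on_subset[OF A]) auto
    from compact_imp_bounded[OF this] obtain C where "\<forall>y\<in>A j ` {0..T}. norm y \<le> C"
      unfolding bounded_iff by blast
    then have C: "norm (A j r) \<le> C" if "r \<in> {0..T}" for r
      using that by blast
    have "integrable (time_measure T) (\<lambda>r. C * norm (Q j r))"
      using Q by auto
    then show "integrable (time_measure T) (\<lambda>r. Q j r \<bullet> A j r)"
    proof (rule Bochner_Integration.integrable_bound)
      show "AE r in time_measure T. norm (Q j r \<bullet> A j r) \<le> norm (C * norm (Q j r))"
        using AE_T
      proof eventually_elim
        case (elim r)
        then have "norm (A j r) \<le> C"
          by (intro C) auto
        have "norm (Q j r \<bullet> A j r) \<le> norm (Q j r) * norm (A j r)"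
          using Cauchy_Schwarz_ineq2 by simp
        also have "\<dots> \<le> norm (Q j r) * C"
          by (rule mult_left_mono[OF \<open>norm (A j r) \<le> C\<close> norm_ge_zero])
        also have "\<dots> \<le> norm (C * norm (Q j r))"
          by (simp add: mult.commute)
        finally show ?case .
      qed
    qed simp
  qed
  then have intD: "integrable (time_measure T) D"
    by (simp add: D_def[abs_def])
  \<comment> \<open>The defect of the claimed identity. Its local increments are bounded by an
    arbitrarily small multiple of those of \<mu>, hence it is constant.\<close>
  define \<Phi> where "\<Phi> t = B t t - 2 * (LINT r|time_measure T. indicat_real {0<..t} r * D r)" for t
  define \<mu> where "\<mu> t = (LINT r|time_measure T. indicat_real {0<..t} r * M r)" for t
  have approx: "\<bar>\<Phi> t - \<Phi> 0\<bar> \<le> 2 * e * \<mu> t - 2 * e * \<mu> 0" if e: "e > 0" for e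
  proof -
    have "\<exists>d. d > 0 \<and> (\<forall>s\<in>{0..T}. \<forall>r\<in>{0..T}. dist r s < d \<longrightarrow> dist (A j r) (A j s) < e)" for j
    proof -
      have "uniformly_continuous_on {0..T} (A j)"
        by (intro compact_uniformly_continuous continuous_on_subset[OF A]) auto
      then show ?thesis
        using e unfolding uniformly_continuous_on_def by blast
    qed
    then obtain d where d: "\<And>j. d j > 0"
      "\<And>j s r. s \<in> {0..T} \<Longrightarrow> r \<in> {0..T} \<Longrightarrow> dist r s < d j \<Longrightarrow> dist (A j r) (A j s) < e"
      by metis
    \<comment> \<open>The element 1 keeps the minimum defined when there are no summands.\<close>
    define \<delta> where "\<delta> = Min (insert 1 (d ` {..<m}))"
    have \<delta>: "\<delta> > 0" "\<And>j. j < m \<Longrightarrow> \<delta> \<le> d j"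
      using d(1) by (auto simp: \<delta>_def)
    have local: "\<bar>\<Phi> t - \<Phi> s\<bar> \<le> 2 * e * \<mu> t - 2 * e * \<mu> s" if st: "0 \<le> s" "s \<le> t" "t \<le> T" "t - s < \<delta>" for s t
    proof -
      let ?I = "indicat_real {s<..t}"
      have close: "norm (?I r * ((\<Sum>j<m. Q j r \<bullet> A j \<tau>) - D r)) \<le> ?I r * (e * M r)"
        if "\<tau> \<in> {s..t}" for r \<tau>
      proof (cases "r \<in> {s<..t}")
        case True
        have "\<bar>Q j r \<bullet> A j \<tau> - Q j r \<bullet> A j r\<bar> \<le> e * norm (Q j r)" if "j < m" for j
        proof -
          have "dist \<tau> r < d j"
            using \<delta>(2)[OF that] True \<open>\<tau> \<in> {s..t}\<close> st(4) by (auto simp: dist_real_def)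
          then have "dist (A j \<tau>) (A j r) < e"
            using True \<open>\<tau> \<in> {s..t}\<close> st by (intro d) auto
          then have "norm (Q j r) * norm (A j \<tau> - A j r) \<le> norm (Q j r) * e"
            by (intro mult_left_mono) (auto simp: dist_norm)
          moreover have "\<bar>Q j r \<bullet> (A j \<tau> - A j r)\<bar> \<le> norm (Q j r) * norm (A j \<tau> - A j r)"
            by (rule Cauchy_Schwarz_ineq2)
          ultimately show ?thesis
            by (simp add: inner_diff_right mult.commute)
        qed
        then have "(\<Sum>j<m. \<bar>Q j r \<bullet> A j \<tau> - Q j r \<bullet> A j r\<bar>) \<le> (\<Sum>j<m. e * norm (Q j r))"
          by (intro sum_mono) auto
        moreover have "\<bar>(\<Sum>j<m. Q j r \<bullet> A j \<tau>) - D r\<bar> \<le> (\<Sum>j<m. \<bar>Q j r \<bullet> A j \<tau> - Q j r \<bullet> A j r\<bar>)"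
          unfolding D_def sum_subtractf[symmetric] by (rule sum_abs)
        ultimately show ?thesis
          using True by (simp add: M_def sum_distrib_left)
      qed simp
      \<comment> \<open>Replacing the moving argument of the continuous coefficients by a fixed end
        of the short interval costs at most \<open>e\<close> times the mass of the integrable
        ones.\<close>
      have half: "\<bar>(LINT r|time_measure T. ?I r * (\<Sum>j<m. Q j r \<bullet> A j \<tau>)) - (LINT r|time_measure T. ?I r * D r)\<bar>
          \<le> e * (\<mu> t - \<mu> s)" if "\<tau> \<in> {s..t}" for \<tau>
      proof -
        have i: "integrable (time_measure T) (\<lambda>r. ?I r * (\<Sum>j<m. Q j r \<bullet> A j \<tau>))" "integrable (time_measure T) (\<lambda>r. ?I r * D r)"
          by (intro integrable_indicator_Ioc intQA intD)+
        have "(LINT r|time_measure T. ?I r * (\<Sum>j<m. Q j r \<bullet> A j \<tau>)) - (LINT r|time_measure T. ?I r * D r)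
            = (LINT r|time_measure T. ?I r * ((\<Sum>j<m. Q j r \<bullet> A j \<tau>) - D r))"
          using Bochner_Integration.integral_diff[OF i] by (simp only: right_diff_distrib)
        moreover have "norm (LINT r|time_measure T. ?I r * ((\<Sum>j<m. Q j r \<bullet> A j \<tau>) - D r))
            \<le> (LINT r|time_measure T. ?I r * (e * M r))"
        proof (rule Bochner_Integration.integral_norm_bound_integral)
          show "integrable (time_measure T) (\<lambda>r. ?I r * ((\<Sum>j<m. Q j r \<bullet> A j \<tau>) - D r))"
            using Bochner_Integration.integrable_diff[OF i] by (simp only: right_diff_distrib)
          show "integrable (time_measure T) (\<lambda>r. ?I r * (e * M r))"
            by (intro integrable_indicator_Ioc integrable_mult_right intM)
        qed (rule close[OF that])
        moreover have "(LINT r|time_measure T. ?I r * (e * M r)) = e * (\<mu> t - \<mu> s)"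
          using indicator_Ioc_integral_diff[OF intM st(2,1)] by (simp add: \<mu>_def mult.left_commute[of _ e])
        ultimately show ?thesis
          by simp
      qed
      have "\<Phi> t - \<Phi> s = (B t t - B s t) + (B t s - B s s) - 2 * (LINT r|time_measure T. ?I r * D r)"
        using sym[of s t] st indicator_Ioc_integral_diff[OF intD st(2,1)] by (simp add: \<Phi>_def)
      also have "\<dots> = ((LINT r|time_measure T. ?I r * (\<Sum>j<m. Q j r \<bullet> A j t)) - (LINT r|time_measure T. ?I r * D r))
          + ((LINT r|time_measure T. ?I r * (\<Sum>j<m. Q j r \<bullet> A j s)) - (LINT r|time_measure T. ?I r * D r))"
        using st inc[of s t t] inc[of s t s] by simp
      finally show ?thesis
        using half[of t] half[of s] st(2) by (simp add: algebra_simps)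
    qed
    show ?thesis
      by (rule telescoping_bound[where F = \<Phi> and \<mu> = "\<lambda>t. 2 * e * \<mu> t", OF \<delta>(1) local]) (use t in auto)
  qed
  have "\<bar>\<Phi> t - \<Phi> 0\<bar> \<le> 0 + e" if e: "e > 0" for e
  proof -
    have m: "0 \<le> \<mu> t - \<mu> 0"
      unfolding \<mu>_def using M0 by (auto intro!: Bochner_Integration.integral_nonneg)
    define e' where "e' = e / (2 * (\<mu> t - \<mu> 0 + 1))"
    have "e' > 0" "2 * e' * (\<mu> t - \<mu> 0) \<le> e"
      using e m by (auto simp: e'_def field_simps)
    then show ?thesis
      using approx[of e'] by (simp add: right_diff_distrib)
  qed
  then have "\<bar>\<Phi> t - \<Phi> 0\<bar> \<le> 0"
    by (rule field_le_epsilon)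
  then show "B t t - B 0 0 = 2 * (LINT r|time_measure T. indicat_real {0<..t} r * (\<Sum>j<m. Q j r \<bullet> A j r))"
    by (simp add: \<Phi>_def D_def)
qed

section \<open>The mollified helicity balance\<close>

lemma torus_smooth_Lp:
  fixes f :: "real ^ 'n::finite \<Rightarrow> 'b::euclidean_space"
  assumes "f \<in> torus_smooth" "p > 0"
  shows "f \<in> torus_Lp p"
proof -
  obtain C where C: "\<And>x. norm (f x) \<le> C"
    by (rule torus_smooth_bounded[OF assms(1)], rule that)
  note [measurable] = torus_smoothD(4)[OF assms(1)]
  have "integrable torus_measure (\<lambda>x. norm (f x) powr p)"
    using C assms(2) by (intro torus_measure.integrable_const_bound[of _ "C powr p"]) (auto intro!: powr_mono2)
  then show ?thesis
    using torus_smoothD(1)[OF assms(1)] by (simp add: torus_Lp_def integrable_torus_measure_iff)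
qed

lemma torus_L1_I:
  fixes f :: "real ^ 'n::finite \<Rightarrow> 'b::euclidean_space"
  assumes "torus_periodic f" and [measurable]: "f \<in> borel_measurable borel" and "integrable torus_measure f"
  shows "f \<in> torus_Lp 1"
  using assms by (simp add: torus_Lp_def flip: integrable_torus_measure_iff)

lemma partial_scaleR_left:
  fixes f :: "real ^ 'n::finite \<Rightarrow> 'b::euclidean_space"
  assumes "f \<in> torus_smooth"
  shows "partial i (\<lambda>x. c *\<^sub>R f x) x = c *\<^sub>R partial i f x"
  by (subst partial_eqI[OF has_derivative_scaleR_right[OF torus_smoothD(5)[OF assms]]])
    (simp add: partial_def)

lemma partial_scaleR_right:
  fixes f :: "real ^ 'n::finite \<Rightarrow> real"
  assumes "f \<in> torus_smooth"
  shows "partial i (\<lambda>x. f x *\<^sub>R c) x = partial i f x *\<^sub>R c"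
  by (subst partial_eqI[OF has_derivative_scaleR_left[OF torus_smoothD(5)[OF assms]]])
    (simp add: partial_def)

lemma curl_scaleR:
  assumes "f \<in> torus_smooth"
  shows "curl (\<lambda>x. c *\<^sub>R f x) x = c *\<^sub>R curl f x"
  by (simp add: curl_def partial_scaleR_left[OF assms] vec_eq_iff forall_3 right_diff_distrib)

lemma divergence_scaleR:
  assumes "f \<in> torus_smooth"
  shows "divergence (\<lambda>x. c *\<^sub>R f x) x = c * divergence f x"
  by (simp add: divergence_def partial_scaleR_left[OF assms] sum_distrib_left)

section \<open>Weak divergence and weak curl in terms of the normalised measure\<close>

lemma weak_div_freeD:
  assumes "weak_div_free f" "\<psi> \<in> torus_smooth"
  shows "(LINT x|torus_measure. f x \<bullet> grad \<psi> x) = 0"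
proof -
  have [measurable]: "f \<in> borel_measurable borel"
    using assms(1) torus_Lp_D(2) by (auto simp: weak_div_free_def)
  have [measurable]: "grad \<psi> \<in> borel_measurable borel"
    unfolding grad_def
    by (intro borel_measurable_continuous_onI continuous_on_vec_lambda torus_smoothD(3) torus_smooth_partial assms(2))
  have "(LINT x:torus_cell|lborel. f x \<bullet> grad \<psi> x) = 0"
    using assms by (simp add: weak_div_free_def)
  then show ?thesis
    by (simp add: integral_torus_measure)
qed

lemma curl_borel: "\<phi> \<in> torus_smooth \<Longrightarrow> curl \<phi> \<in> borel_measurable borel"
proof -
  assume \<phi>: "\<phi> \<in> torus_smooth"
  have c: "continuous_on UNIV (\<lambda>x. partial i \<phi> x $ j)" for i j
    by (intro continuous_on_component torus_smoothD(3) torus_smooth_partial \<phi>)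
  have eq: "curl \<phi> = (\<lambda>x. (partial 2 \<phi> x $ 3 - partial 3 \<phi> x $ 2) *\<^sub>R axis 1 1
      + (partial 3 \<phi> x $ 1 - partial 1 \<phi> x $ 3) *\<^sub>R axis 2 1 + (partial 1 \<phi> x $ 2 - partial 2 \<phi> x $ 1) *\<^sub>R axis 3 1)"
    by (auto simp: fun_eq_iff curl_def vec_eq_iff forall_3 axis_def)
  show "curl \<phi> \<in> borel_measurable borel"
    unfolding eq by (intro borel_measurable_continuous_onI continuous_intros c)
qed

lemma has_weak_curlD:
  assumes "has_weak_curl f g" "\<phi> \<in> torus_smooth"
  shows "(LINT x|torus_measure. f x \<bullet> curl \<phi> x) = (LINT x|torus_measure. g x \<bullet> \<phi> x)"
proof -
  have [measurable]: "f \<in> borel_measurable borel" "g \<in> borel_measurable borel"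
    using assms(1) torus_Lp_D(2) by (auto simp: has_weak_curl_def)
  note [measurable] = torus_smoothD(4)[OF assms(2)] curl_borel[OF assms(2)]
  have "(LINT x:torus_cell|lborel. f x \<bullet> curl \<phi> x) = (LINT x:torus_cell|lborel. g x \<bullet> \<phi> x)"
    using assms by (simp add: has_weak_curl_def)
  then show ?thesis
    by (simp add: integral_torus_measure)
qed

text \<open>Two weak curls of the same field agree almost everywhere by the fundamental lemma, so
  the one picked by the choice operator may be replaced by \<open>h\<close>.\<close>

lemma integral_weak_curl:
  assumes H: "is_curl_inverse h H"
  shows "(LINT x:torus_cell|lborel. H x \<bullet> weak_curl H x) = (LINT x|torus_measure. H x \<bullet> h x)"
proof -
  have hc: "has_weak_curl H h"
    using H by (simp add: is_curl_inverse_def)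
  then have wc: "has_weak_curl H (weak_curl H)"
    unfolding weak_curl_def by (rule someI[where P = "has_weak_curl H"])
  have L1: "H \<in> torus_Lp 1" "h \<in> torus_Lp 1" "weak_curl H \<in> torus_Lp 1"
    using hc wc by (auto simp: has_weak_curl_def)
  note [measurable] = torus_Lp_D(2)[OF L1(1)] torus_Lp_D(2)[OF L1(2)] torus_Lp_D(2)[OF L1(3)]
  have "(\<lambda>x. weak_curl H x - h x) \<in> torus_Lp 1"
    using torus_Lp_D(1)[OF L1(2)] torus_Lp_D(1)[OF L1(3)] torus_L1_D[OF L1(2)] torus_L1_D[OF L1(3)]
    by (intro torus_L1_I) (auto simp: torus_periodic_def)
  then have "AE x in torus_measure. weak_curl H x - h x = 0"
  proof (rule torus_fundamental_lemma)
    fix \<phi> :: "real ^ 3 \<Rightarrow> real ^ 3"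
    assume \<phi>: "\<phi> \<in> torus_smooth"
    show "(LINT x|torus_measure. (weak_curl H x - h x) \<bullet> \<phi> x) = 0"
      using has_weak_curlD[OF hc \<phi>] has_weak_curlD[OF wc \<phi>]
        integrable_torus_smooth_inner[OF \<phi> torus_L1_D[OF L1(2)]] integrable_torus_smooth_inner[OF \<phi> torus_L1_D[OF L1(3)]]
      by (simp add: inner_diff_left)
  qed
  then have "(LINT x|torus_measure. H x \<bullet> weak_curl H x) = (LINT x|torus_measure. H x \<bullet> h x)"
    by (intro integral_cong_AE) auto
  then show ?thesis
    by (simp add: integral_torus_measure)
qed

section \<open>Pairing, flux and divergence in terms of finitely many coefficients\<close>

context torus_kernel
begin

text \<open>Both fields enter only through their coefficients against the \<open>a j\<close>, and
  symmetrically. Weak continuity in time of a field is exactly what makes these coefficients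
  continuous.\<close>

lemma torus_conv_pairing:
  fixes f g :: "real ^ 'n \<Rightarrow> 'b::euclidean_space"
  assumes f: "integrable torus_measure f" and g: "integrable torus_measure g"
  shows "(LINT x|torus_measure. f x \<bullet> torus_conv k g x)
    = (\<Sum>j<m. (LINT x|torus_measure. a j x *\<^sub>R f x) \<bullet> (LINT x|torus_measure. a j x *\<^sub>R g x))"
proof -
  let ?g = "\<lambda>j. LINT x|torus_measure. a j x *\<^sub>R g x"
  have i: "integrable torus_measure (\<lambda>x. a j x *\<^sub>R f x)" for j
    by (rule integrable_torus_smooth_scaleR[OF smooth_a f])
  have "(LINT x|torus_measure. f x \<bullet> torus_conv k g x) = (LINT x|torus_measure. (\<Sum>j<m. (a j x *\<^sub>R f x) \<bullet> ?g j))"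
    by (simp add: torus_conv_eq[OF g] inner_sum_right)
  also have "\<dots> = (\<Sum>j<m. LINT x|torus_measure. (a j x *\<^sub>R f x) \<bullet> ?g j)"
    using i by (intro Bochner_Integration.integral_sum integrable_inner_left) auto
  also have "\<dots> = (\<Sum>j<m. (LINT x|torus_measure. a j x *\<^sub>R f x) \<bullet> ?g j)"
    using i by (intro sum.cong refl integral_inner_left) auto
  finally show ?thesis .
qed

text \<open>The vector whose inner product with \<open>c\<close> is the nonlinear term for a test
  field whose curl is \<open>a j\<close> times the constant vector \<open>c\<close>. It collects
  everything quadratic in the field.\<close>

definition flux_coeff :: "(real ^ 'n \<Rightarrow> real ^ 'n) \<Rightarrow> nat \<Rightarrow> real ^ 'n"
  where "flux_coeff f j = (LINT x|torus_measure. (f x \<bullet> grad (a j) x) *\<^sub>R f x)"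

lemma grad_a_borel: "grad (a j) \<in> borel_measurable borel"
  unfolding grad_def
  by (intro borel_measurable_continuous_onI continuous_on_vec_lambda torus_smoothD(3) torus_smooth_partial smooth_a)

lemma grad_a_bounded:
  obtains C where "C \<ge> 0" "\<And>x. norm (grad (a j) x) \<le> C"
proof -
  have "\<exists>b. \<forall>y. norm (partial i (a j) y) \<le> b" for i
    using torus_smooth_bounded[OF torus_smooth_partial[OF smooth_a]] by metis
  then obtain b where b: "\<And>i y. norm (partial i (a j) y) \<le> b i"
    by metis
  have C: "norm (grad (a j) x) \<le> (\<Sum>i\<in>UNIV. b i)" for x
    by (rule order_trans[OF norm_le_l1_cart]) (use b in \<open>auto simp: grad_def intro!: sum_mono\<close>)
  show ?thesis
    using C order_trans[OF norm_ge_zero C] by (rule that[rotated])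
qed

lemma flux_coeff_bound:
  obtains C where "C \<ge> 0" "\<And>f x. norm ((f x \<bullet> grad (a j) x) *\<^sub>R f x) \<le> C * norm (f x :: real ^ 'n) ^ 2"
proof -
  obtain C where C: "C \<ge> 0" "\<And>x. norm (grad (a j) x) \<le> C"
    by (rule grad_a_bounded, rule that)
  have "norm ((v \<bullet> grad (a j) x) *\<^sub>R v) \<le> C * norm v ^ 2" for v x
  proof -
    have "norm ((v \<bullet> grad (a j) x) *\<^sub>R v) = \<bar>v \<bullet> grad (a j) x\<bar> * norm v"
      by simp
    also have "\<dots> \<le> (norm v * norm (grad (a j) x)) * norm v"
      by (intro mult_right_mono Cauchy_Schwarz_ineq2) auto
    also have "\<dots> \<le> (norm v * C) * norm v"
      by (intro mult_right_mono mult_left_mono C) auto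
    finally show ?thesis
      by (simp add: power2_eq_square mult_ac)
  qed
  with C(1) show ?thesis
    by (intro that) auto
qed

lemma flux_coeff_integrable:
  assumes [measurable]: "f \<in> borel_measurable borel" and "integrable torus_measure (\<lambda>x. norm (f x) ^ 2)"
  shows "integrable torus_measure (\<lambda>x. (f x \<bullet> grad (a j) x) *\<^sub>R f x)"
proof -
  note [measurable] = grad_a_borel
  obtain C where C: "C \<ge> 0" "\<And>f x. norm ((f x \<bullet> grad (a j) x) *\<^sub>R f x) \<le> C * norm (f x :: real ^ 'n) ^ 2"
    by (rule flux_coeff_bound, rule that)
  show ?thesis
    by (rule Bochner_Integration.integrable_bound[OF integrable_mult_right[OF assms(2), of C]])
      (use C(2)[of f] C(1) in auto)
qed

text \<open>The fields \<open>f\<close> and \<open>g\<close> are kept apart because the weak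
  equation first pairs the solution at one time with a mollification frozen at another.\<close>

lemma trilinear_eq:
  assumes f: "f \<in> borel_measurable borel" "integrable torus_measure (\<lambda>x. norm (f x) ^ 2)"
    and g: "integrable torus_measure g"
  shows "integrable torus_measure (\<lambda>x. \<Sum>i\<in>UNIV. \<Sum>l\<in>UNIV. f x $ i * f x $ l * partial l (torus_conv k g) x $ i)"
    "(LINT x|torus_measure. (\<Sum>i\<in>UNIV. \<Sum>l\<in>UNIV. f x $ i * f x $ l * partial l (torus_conv k g) x $ i))
      = (\<Sum>j<m. flux_coeff f j \<bullet> (LINT z|torus_measure. a j z *\<^sub>R g z))"
proof -
  let ?g = "\<lambda>j. LINT z|torus_measure. a j z *\<^sub>R g z"
  have eq: "(\<Sum>i\<in>UNIV. \<Sum>l\<in>UNIV. f x $ i * f x $ l * partial l (torus_conv k g) x $ i)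
      = (\<Sum>j<m. ((f x \<bullet> grad (a j) x) *\<^sub>R f x) \<bullet> ?g j)" for x
  proof -
    have "((f x \<bullet> grad (a j) x) *\<^sub>R f x) \<bullet> ?g j
        = (\<Sum>i\<in>UNIV. \<Sum>l\<in>UNIV. f x $ i * f x $ l * (partial l (a j) x * ?g j $ i))" for j
    proof -
      have "((f x \<bullet> grad (a j) x) *\<^sub>R f x) \<bullet> ?g j = (f x \<bullet> ?g j) * (f x \<bullet> grad (a j) x)"
        by simp
      also have "\<dots> = (\<Sum>i\<in>UNIV. f x $ i * ?g j $ i) * (\<Sum>l\<in>UNIV. f x $ l * partial l (a j) x)"
        by (simp add: inner_vec_def grad_def)
      also have "\<dots> = (\<Sum>i\<in>UNIV. \<Sum>l\<in>UNIV. (f x $ i * ?g j $ i) * (f x $ l * partial l (a j) x))"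
        by (rule sum_product)
      also have "\<dots> = (\<Sum>i\<in>UNIV. \<Sum>l\<in>UNIV. f x $ i * f x $ l * (partial l (a j) x * ?g j $ i))"
        by (intro sum.cong refl) (simp add: mult_ac)
      finally show ?thesis .
    qed
    then have "(\<Sum>j<m. ((f x \<bullet> grad (a j) x) *\<^sub>R f x) \<bullet> ?g j)
        = (\<Sum>j<m. \<Sum>i\<in>UNIV. \<Sum>l\<in>UNIV. f x $ i * f x $ l * (partial l (a j) x * ?g j $ i))"
      by simp
    also have "\<dots> = (\<Sum>i\<in>UNIV. \<Sum>l\<in>UNIV. \<Sum>j<m. f x $ i * f x $ l * (partial l (a j) x * ?g j $ i))"
      by (subst sum.swap) (intro sum.cong refl sum.swap)
    finally show ?thesis
      by (simp add: partial_torus_conv[OF g] sum_distrib_left)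
  qed
  have i: "integrable torus_measure (\<lambda>x. ((f x \<bullet> grad (a j) x) *\<^sub>R f x) \<bullet> ?g j)" for j
    using flux_coeff_integrable[OF f, of j] by (intro integrable_inner_left) auto
  then show "integrable torus_measure (\<lambda>x. \<Sum>i\<in>UNIV. \<Sum>l\<in>UNIV. f x $ i * f x $ l * partial l (torus_conv k g) x $ i)"
    unfolding eq by (rule Bochner_Integration.integrable_sum)
  show "(LINT x|torus_measure. (\<Sum>i\<in>UNIV. \<Sum>l\<in>UNIV. f x $ i * f x $ l * partial l (torus_conv k g) x $ i))
      = (\<Sum>j<m. flux_coeff f j \<bullet> ?g j)"
  proof -
    have "(LINT x|torus_measure. (\<Sum>j<m. ((f x \<bullet> grad (a j) x) *\<^sub>R f x) \<bullet> ?g j))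
        = (\<Sum>j<m. LINT x|torus_measure. ((f x \<bullet> grad (a j) x) *\<^sub>R f x) \<bullet> ?g j)"
      by (rule Bochner_Integration.integral_sum) (rule i)
    also have "\<dots> = (\<Sum>j<m. flux_coeff f j \<bullet> ?g j)"
      unfolding flux_coeff_def by (intro sum.cong refl integral_inner_left flux_coeff_integrable[OF f])
    finally show ?thesis
      by (simp only: eq)
  qed
qed

text \<open>The derivative of the kernel in \<open>x\<close> is minus its derivative in the
  integration variable, so the divergence is a weak divergence tested against a translate of the
  kernel. This makes the mollified potential an admissible test field.\<close>

lemma divergence_torus_conv:
  assumes f: "integrable torus_measure f" and div_free: "weak_div_free f"
  shows "divergence (torus_conv k f) x = 0"
proof -
  have i: "integrable torus_measure (\<lambda>z. partial i k (x - z) *\<^sub>R f z)" for i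
    by (rule integrable_torus_smooth_scaleR[OF partial_kernel_torus_smooth f])
  have "divergence (torus_conv k f) x = (\<Sum>i\<in>UNIV. LINT z|torus_measure. (partial i k (x - z) *\<^sub>R f z) $ i)"
    by (simp only: divergence_def partial_torus_conv'[OF f] integral_vec_nth[OF i])
  also have "\<dots> = (LINT z|torus_measure. (\<Sum>i\<in>UNIV. (partial i k (x - z) *\<^sub>R f z) $ i))"
    by (rule Bochner_Integration.integral_sum[symmetric]) (rule integrable_vec_nth[OF i])
  also have "\<dots> = (LINT z|torus_measure. - (f z \<bullet> grad (\<lambda>z. k (x - z)) z))"
    by (simp add: grad_kernel_reflect inner_vec_def grad_def mult.commute sum_negf)
  also have "\<dots> = 0"
    using weak_div_freeD[OF div_free kernel_translate_torus_smooth, of x] by simp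
  finally show ?thesis .
qed

end

text \<open>The weak curl relation is tested with a translate of the kernel times a basis vector;
  the sign from reflecting the kernel matches the one from the curl, and each component is compared
  separately.\<close>

lemma curl_torus_conv:
  fixes k :: "real ^ 3 \<Rightarrow> real"
  assumes "torus_kernel k m a" and H: "integrable torus_measure H" and h: "integrable torus_measure h"
    and "has_weak_curl H h"
  shows "curl (torus_conv k H) x = torus_conv k h x"
proof -
  interpret torus_kernel k m a
    by fact
  have int: "integrable torus_measure (\<lambda>z. partial l k (x - z) * H z $ i)" for l i
    using integrable_vec_nth[OF integrable_torus_smooth_scaleR[OF partial_kernel_torus_smooth H], of l x i] by simp
  have P: "partial l (torus_conv k H) x $ i = (LINT z|torus_measure. partial l k (x - z) * H z $ i)" for l i
    using integral_vec_nth[OF integrable_torus_smooth_scaleR[OF partial_kernel_torus_smooth H], of l x i]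
    by (simp add: partial_torus_conv'[OF H])
  have conv: "torus_conv k h x $ i = (LINT z|torus_measure. H z \<bullet> curl (\<lambda>z. k (x - z) *\<^sub>R axis i 1) z)" for i
  proof -
    have "(\<lambda>z. k (x - z) *\<^sub>R axis i 1 :: real ^ 3) \<in> torus_smooth"
      by (intro torus_smooth_scaleR kernel_translate_torus_smooth torus_smooth_const)
    from has_weak_curlD[OF assms(4) this]
    have "(LINT z|torus_measure. H z \<bullet> curl (\<lambda>z. k (x - z) *\<^sub>R axis i 1) z) = (LINT z|torus_measure. (k (x - z) *\<^sub>R h z) $ i)"
      by (simp add: inner_axis)
    also have "\<dots> = torus_conv k h x $ i"
      unfolding torus_conv_def
      by (rule integral_vec_nth[OF integrable_torus_smooth_scaleR[OF kernel_translate_torus_smooth h]])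
    finally show ?thesis ..
  qed
  have pc: "partial l (\<lambda>z. k (x - z) *\<^sub>R axis i 1 :: real ^ 3) z = - (partial l k (x - z) *\<^sub>R axis i 1)" for l i z
    using partial_scaleR_right[OF kernel_translate_torus_smooth, of l x "axis i 1" z] by (simp add: partial_kernel_reflect)
  have c: "H z \<bullet> curl (\<lambda>z. k (x - z) *\<^sub>R axis i 1) z
      = H z $ 1 * (partial 3 k (x - z) * axis i 1 $ 2 - partial 2 k (x - z) * axis i 1 $ 3)
      + H z $ 2 * (partial 1 k (x - z) * axis i 1 $ 3 - partial 3 k (x - z) * axis i 1 $ 1)
      + H z $ 3 * (partial 2 k (x - z) * axis i 1 $ 1 - partial 1 k (x - z) * axis i 1 $ 2)" for i z
    by (simp only: curl_def pc) (simp add: inner_vec_def sum_3 algebra_simps)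
  note conv' = conv[unfolded c]
  have "curl (torus_conv k H) x $ i = torus_conv k h x $ i" for i
  proof -
    consider "i = 1" | "i = 2" | "i = 3"
      using exhaust_3[of i] by blast
    then show ?thesis
      by cases (simp_all add: conv' axis_def curl_def P mult.commute[of "H _ $ _"] int)
  qed
  then show ?thesis
    by (simp add: vec_eq_iff)
qed

text \<open>The field \<open>u\<close> is the solution set to zero outside the open time interval,
  which makes it jointly measurable on the whole line. Square integrability in space-time makes the
  quadratic coefficients integrable in time, while the linear ones are continuous.\<close>

lemma mollified_helicity_increment:
  fixes h H :: "real \<Rightarrow> real ^ 3 \<Rightarrow> real ^ 3" and k :: "real ^ 3 \<Rightarrow> real"
  assumes "T > 0" and kernel: "torus_kernel k m a" and sol: "emhd_weak_solution T h"
    and inv: "\<And>t. t \<in> {0..T} \<Longrightarrow> is_curl_inverse (h t) (H t)"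
    and u_def: "\<And>t. u t = (if t \<in> {0<..<T} then h t else (\<lambda>x. 0))"
    and u_meas [measurable]: "(\<lambda>(t, x). u t x) \<in> borel_measurable (borel \<Otimes>\<^sub>M borel)"
    and u2: "integrable (time_measure T) (\<lambda>t. LINT x|torus_measure. norm (u t x) ^ 2)"
    and t: "t \<in> {0..T}"
  shows "integrable (time_measure T) (\<lambda>r. kernel_flux k (u r))"
    and "(LINT x|torus_measure. h t x \<bullet> torus_conv k (H t) x) - (LINT x|torus_measure. h 0 x \<bullet> torus_conv k (H 0) x)
      = 2 * (LINT r|time_measure T. indicat_real {0<..t} r * kernel_flux k (u r))"
proof -
  interpret torus_kernel k m a
    by (rule kernel)
  have h2: "h t \<in> torus_Lp 2" if "t \<in> {0..T}" for t
    using sol that by (simp add: emhd_weak_solution_def time_weak_C_L2_def)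
  have hm: "h t \<in> borel_measurable borel" and hi2: "integrable torus_measure (\<lambda>x. norm (h t x) ^ 2)" if "t \<in> {0..T}" for t
    using torus_Lp_D(2)[OF h2[OF that]] torus_L2_D[OF h2[OF that]] by auto
  have hi: "integrable torus_measure (h t)" if "t \<in> {0..T}" for t
    using integrable_torus_L2[OF hm hi2] that by auto
  have H2: "H t \<in> torus_Lp 2" and Hdiv: "weak_div_free (H t)" and Hcurl: "has_weak_curl (H t) (h t)" if "t \<in> {0..T}" for t
    using inv[OF that] by (simp_all add: is_curl_inverse_def)
  have Hi: "integrable torus_measure (H t)" if "t \<in> {0..T}" for t
    using integrable_torus_L2[OF torus_Lp_D(2)[OF H2] torus_L2_D[OF H2]] that by auto
  define A where "A j t = (LINT x|torus_measure. a j x *\<^sub>R h t x)" for j t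
  define E where "E j t = (LINT x|torus_measure. a j x *\<^sub>R H t x)" for j t
  \<comment> \<open>Time is clamped to [0,T], so that coefficients continuous there become
    continuous on the whole line, as the lemmas on time derivatives require.\<close>
  define c where "c t = max 0 (min T t)" for t
  have c: "c t \<in> {0..T}" "t \<in> {0..T} \<Longrightarrow> c t = t" for t
    using \<open>T > 0\<close> by (auto simp: c_def)
  define Q where "Q j r = flux_coeff (u r) j" for j r
  have A_cont: "continuous_on UNIV (\<lambda>t. A j (c t))" for j
  proof -
    have "continuous_on {0..T} (\<lambda>t. A j t $ i)" for i
    proof -
      let ?g = "\<lambda>x. a j x *\<^sub>R axis i 1 :: real ^ 3"
      have g: "?g \<in> torus_smooth"
        by (intro torus_smooth_scaleR smooth_a torus_smooth_const)
      have "continuous_on {0..T} (\<lambda>t. LINT x:torus_cell|lborel. h t x \<bullet> g x)" if "g \<in> torus_Lp 2" for g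
        using sol that by (simp add: emhd_weak_solution_def time_weak_C_L2_def)
      from this[OF torus_smooth_Lp[OF g]]
      have "continuous_on {0..T} (\<lambda>t. LINT x:torus_cell|lborel. h t x \<bullet> ?g x)"
        by (simp only: zero_less_numeral simp_thms)
      moreover have "(LINT x:torus_cell|lborel. h t x \<bullet> ?g x) = A j t $ i" if "t \<in> {0..T}" for t
      proof -
        note [measurable] = hm[OF that] torus_smoothD(4)[OF g]
        have "(LINT x:torus_cell|lborel. h t x \<bullet> ?g x) = (LINT x|torus_measure. h t x \<bullet> ?g x)"
          by (rule integral_torus_measure) measurable
        also have "\<dots> = (LINT x|torus_measure. (a j x *\<^sub>R h t x) $ i)"
          by (simp add: inner_axis)
        also have "\<dots> = A j t $ i"
          unfolding A_def by (rule integral_vec_nth[OF integrable_torus_smooth_scaleR[OF smooth_a hi[OF that]]])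
        finally show ?thesis .
      qed
      ultimately show ?thesis
        by (rule continuous_on_eq)
    qed
    then have "continuous_on {0..T} (\<lambda>t. \<chi> i. A j t $ i)"
      by (rule continuous_on_vec_lambda)
    then have "continuous_on {0..T} (A j)"
      by simp
    then show ?thesis
      by (rule continuous_on_compose2[of _ _ UNIV c]) (auto simp: c_def[abs_def] intro!: continuous_intros c(1)[unfolded c_def])
  qed
  have Q_int: "integrable (time_measure T) (Q j)" for j
  proof -
    note [measurable] = grad_a_borel
    have [measurable]: "Q j \<in> borel_measurable borel"
      unfolding Q_def flux_coeff_def by measurable
    obtain C where C: "C \<ge> 0" "\<And>f x. norm ((f x \<bullet> grad (a j) x) *\<^sub>R f x) \<le> C * norm (f x :: real ^ 3) ^ 2"
      by (rule flux_coeff_bound, rule that)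
    show ?thesis
    proof (rule Bochner_Integration.integrable_bound[OF integrable_mult_right[OF u2, of C]])
      have "norm (Q j r) \<le> norm (C * (LINT x|torus_measure. norm (u r x) ^ 2))" for r
      proof -
        have i2: "integrable torus_measure (\<lambda>x. norm (u r x) ^ 2)"
          using hi2[of r] by (simp add: u_def)
        have um: "u r \<in> borel_measurable borel"
          by measurable
        have "norm (Q j r) \<le> (LINT x|torus_measure. C * norm (u r x) ^ 2)"
          unfolding Q_def flux_coeff_def
          by (rule Bochner_Integration.integral_norm_bound_integral)
            (use flux_coeff_integrable[OF um i2] integrable_mult_right[OF i2] C(2)[of "u r"] in auto)
        then show ?thesis
          by simp
      qed
      then show "AE r in time_measure T. norm (Q j r) \<le> norm (C * (LINT x|torus_measure. norm (u r x) ^ 2))"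
        by simp
    qed simp
  qed
  define B where "B s t = (\<Sum>j<m. A j s \<bullet> E j t)" for s t
  have B_eq: "B s t = (LINT x|torus_measure. h s x \<bullet> torus_conv k (H t) x)" if "s \<in> {0..T}" "t \<in> {0..T}" for s t
    unfolding B_def A_def E_def by (rule torus_conv_pairing[OF hi Hi, symmetric]) (use that in auto)
  have B_sym: "B s t = B t s" if "s \<in> {0..T}" "t \<in> {0..T}" for s t
  proof -
    have "B s t = (LINT x|torus_measure. H s x \<bullet> curl (torus_conv k (H t)) x)"
      unfolding B_eq[OF that] by (rule has_weak_curlD[OF Hcurl[OF that(1)] torus_conv_torus_smooth[OF Hi[OF that(2)]], symmetric])
    also have "\<dots> = (LINT x|torus_measure. H s x \<bullet> torus_conv k (h t) x)"
      using curl_torus_conv[OF kernel Hi hi Hcurl] that by simp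
    also have "\<dots> = (\<Sum>j<m. E j s \<bullet> A j t)"
      unfolding A_def E_def by (rule torus_conv_pairing[OF Hi hi]) (use that in auto)
    finally show ?thesis
      by (simp add: B_def inner_commute)
  qed
  have inc: "B t \<tau> - B s \<tau> = (LINT r|time_measure T. indicat_real {s<..t} r * (\<Sum>j<m. Q j r \<bullet> A j (c \<tau>)))"
    if st: "0 \<le> s" "s \<le> t" "t \<le> T" and \<tau>: "\<tau> \<in> {0..T}" for s t \<tau>
  proof -
    define \<Psi> where "\<Psi> = torus_conv k (H \<tau>)"
    define \<Theta> where "\<Theta> = torus_conv k (h \<tau>)"
    have \<Psi>: "\<Psi> \<in> torus_smooth" and \<Theta>: "\<Theta> \<in> torus_smooth"
      unfolding \<Psi>_def \<Theta>_def by (intro torus_conv_torus_smooth Hi hi \<tau>)+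
    have curl: "curl \<Psi> = \<Theta>"
      unfolding \<Psi>_def \<Theta>_def using curl_torus_conv[OF kernel Hi hi Hcurl] \<tau> by auto
    have div: "divergence \<Psi> x = 0" for x
      unfolding \<Psi>_def by (intro divergence_torus_conv Hi Hdiv \<tau>)
    define b where "b r = (\<Sum>j<m. A j (c r) \<bullet> E j \<tau>)" for r
    define g where "g r = (\<Sum>j<m. Q j r \<bullet> A j (c \<tau>))" for r
    have b_cont: "continuous_on UNIV b"
      unfolding b_def by (intro continuous_intros A_cont)
    have g_int: "integrable (time_measure T) g"
      unfolding g_def using Q_int by (intro Bochner_Integration.integrable_sum integrable_inner_left) auto
    have "b t - b s = (LINT r|time_measure T. indicat_real {s<..t} r * g r)"
    proof (rule weak_time_derivative[OF \<open>T > 0\<close> b_cont g_int _ st])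
      fix \<theta> :: "real \<Rightarrow> real"
      assume \<theta>: "smooth \<theta>" and "\<exists>c d. 0 < c \<and> d < T \<and> (\<forall>t. t \<notin> {c..d} \<longrightarrow> \<theta> t = 0)"
      then obtain p q where pq: "0 < p" "q < T" "\<And>t. t \<notin> {p..q} \<Longrightarrow> \<theta> t = 0"
        by blast
      define \<phi> where "\<phi> t x = \<theta> t *\<^sub>R \<Psi> x" for t x
      have "smooth (\<lambda>p. \<theta> (fst p) *\<^sub>R \<Psi> (snd p))"
        by (intro smooth_scaleR smooth_compose_linear[OF bounded_linear_fst \<theta>]
            smooth_compose_linear[OF bounded_linear_snd torus_smoothD(2)[OF \<Psi>]])
      then have "smooth (case_prod \<phi>)"
        by (simp add: \<phi>_def case_prod_beta')
      moreover have "torus_periodic (\<phi> t)" for t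
        using torus_smoothD(1)[OF \<Psi>] by (simp add: torus_periodic_def \<phi>_def)
      moreover have "divergence (\<phi> t) x = 0" for t x
        unfolding \<phi>_def by (simp add: divergence_scaleR[OF \<Psi>] div)
      moreover have "\<exists>a b. 0 < a \<and> b < T \<and> (\<forall>t x. t \<notin> {a..b} \<longrightarrow> \<phi> t x = 0)"
        using pq by (intro exI[of _ p] exI[of _ q]) (simp add: \<phi>_def)
      ultimately have "\<phi> \<in> emhd_test T"
        by (simp add: emhd_test_def)
      then have weak: "(LINT t:{0<..<T}|lborel. LINT x:torus_cell|lborel.
         vector_derivative (\<lambda>s. \<phi> s x) (at t) \<bullet> h t x +
         (\<Sum>i\<in>UNIV. \<Sum>l\<in>UNIV. h t x $ i * h t x $ l * partial l (curl (\<phi> t)) x $ i)) = 0"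
        using sol by (simp add: emhd_weak_solution_def)
      have d\<phi>: "vector_derivative (\<lambda>s. \<phi> s x) (at t) = vector_derivative \<theta> (at t) *\<^sub>R \<Psi> x" for t x
      proof (rule vector_derivative_at)
        have "\<theta> differentiable at t"
          using smooth_differentiable[OF \<theta>] by (auto simp: differentiable_def)
        then have "(\<theta> has_vector_derivative vector_derivative \<theta> (at t)) (at t)"
          by (simp add: vector_derivative_works)
        from bounded_linear.has_vector_derivative[OF bounded_linear_scaleR_left this]
        show "((\<lambda>s. \<phi> s x) has_vector_derivative vector_derivative \<theta> (at t) *\<^sub>R \<Psi> x) (at t)"
          by (simp add: \<phi>_def)
      qed
      have p\<phi>: "partial l (curl (\<phi> t)) x = \<theta> t *\<^sub>R partial l \<Theta> x" for l t x
      proof -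
        have "curl (\<phi> t) = (\<lambda>x. \<theta> t *\<^sub>R \<Theta> x)"
          unfolding \<phi>_def by (simp add: fun_eq_iff curl_scaleR[OF \<Psi>] curl)
        then show ?thesis
          by (simp add: partial_scaleR_left[OF \<Theta>])
      qed
      have inner: "(LINT x:torus_cell|lborel.
         vector_derivative (\<lambda>s. \<phi> s x) (at t) \<bullet> h t x +
         (\<Sum>i\<in>UNIV. \<Sum>l\<in>UNIV. h t x $ i * h t x $ l * partial l (curl (\<phi> t)) x $ i))
         = vector_derivative \<theta> (at t) * b t + \<theta> t * g t" if t: "t \<in> {0<..<T}" for t
      proof -
        have t': "t \<in> {0..T}"
          using t by auto
        let ?S = "\<lambda>x. \<Sum>i\<in>UNIV. \<Sum>l\<in>UNIV. h t x $ i * h t x $ l * partial l \<Theta> x $ i"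
        have S: "integrable torus_measure ?S" "(LINT x|torus_measure. ?S x) = g t"
          using trilinear_eq[OF hm[OF t'] hi2[OF t'] hi[OF \<tau>]] c(2)[OF \<tau>] t
          by (simp_all add: \<Theta>_def g_def Q_def A_def u_def)
        have P: "integrable torus_measure (\<lambda>x. h t x \<bullet> \<Psi> x)" "(LINT x|torus_measure. h t x \<bullet> \<Psi> x) = b t"
          using integrable_torus_smooth_inner[OF \<Psi> hi[OF t']] torus_conv_pairing[OF hi[OF t'] Hi[OF \<tau>]] c(2)[OF t']
          by (simp_all add: \<Psi>_def b_def A_def E_def)
        note [measurable] = borel_measurable_integrable[OF S(1), unfolded measurable_cong_sets[OF sets_torus_measure refl]]
          borel_measurable_integrable[OF P(1), unfolded measurable_cong_sets[OF sets_torus_measure refl]]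
        have "(LINT x:torus_cell|lborel.
           vector_derivative (\<lambda>s. \<phi> s x) (at t) \<bullet> h t x +
           (\<Sum>i\<in>UNIV. \<Sum>l\<in>UNIV. h t x $ i * h t x $ l * partial l (curl (\<phi> t)) x $ i))
           = (LINT x:torus_cell|lborel. vector_derivative \<theta> (at t) * (h t x \<bullet> \<Psi> x) + \<theta> t * ?S x)"
          by (simp add: d\<phi> p\<phi> inner_commute sum_distrib_left mult_ac)
        also have "\<dots> = (LINT x|torus_measure. vector_derivative \<theta> (at t) * (h t x \<bullet> \<Psi> x) + \<theta> t * ?S x)"
          by (rule integral_torus_measure) measurable
        also have "\<dots> = vector_derivative \<theta> (at t) * b t + \<theta> t * g t"
          using S P by simp
        finally show ?thesis .
      qed
      have "vector_derivative \<theta> (at t) = frechet_derivative \<theta> (at t) 1" for t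
        using smooth_differentiable[OF \<theta>, of t]
        by (subst frechet_derivative_eq_vector_derivative) (auto simp: differentiable_def)
      then have "continuous_on UNIV (\<lambda>t. vector_derivative \<theta> (at t))"
        using smooth_continuous_on[OF smooth_frechet_derivative[OF \<theta>, of 1]] by simp
      then have [measurable]: "(\<lambda>t. vector_derivative \<theta> (at t)) \<in> borel_measurable borel"
        by (rule borel_measurable_continuous_onI)
      have [measurable]: "b \<in> borel_measurable borel" "\<theta> \<in> borel_measurable borel" "g \<in> borel_measurable borel"
        using b_cont smooth_continuous_on[OF \<theta>] borel_measurable_integrable[OF g_int]
        by (auto intro: borel_measurable_continuous_onI simp: measurable_cong_sets[OF sets_time_measure refl])
      have "(LINT t|time_measure T. vector_derivative \<theta> (at t) * b t + \<theta> t * g t)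
          = (LINT t:{0<..<T}|lborel. vector_derivative \<theta> (at t) * b t + \<theta> t * g t)"
        by (rule integral_time_measure[symmetric]) measurable
      also have "\<dots> = 0"
        by (rule trans[OF set_lebesgue_integral_cong weak]) (auto simp: inner)
      finally show "(LINT t|time_measure T. vector_derivative \<theta> (at t) * b t + \<theta> t * g t) = 0" .
    qed
    moreover have "b t = B t \<tau>" "b s = B s \<tau>"
      using c(2)[of t] c(2)[of s] st by (simp_all add: b_def B_def)
    ultimately show ?thesis
      by (simp add: g_def)
  qed
  have AE_T: "AE r in time_measure T. r \<in> {0<..<T}"
    by (simp add: AE_time_measure_iff)
  have flux: "(\<Sum>j<m. Q j r \<bullet> A j (c r)) = kernel_flux k (u r)" if "r \<in> {0<..<T}" for r
  proof -
    have r: "r \<in> {0..T}"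
      using that by auto
    show ?thesis
      using trilinear_eq(2)[OF hm[OF r] hi2[OF r] hi[OF r]] c(2)[OF r] that
      by (simp add: kernel_flux_def Q_def A_def u_def)
  qed
  have diag: "integrable (time_measure T) (\<lambda>r. \<Sum>j<m. Q j r \<bullet> A j (c r))"
    "B t t - B 0 0 = 2 * (LINT r|time_measure T. indicat_real {0<..t} r * (\<Sum>j<m. Q j r \<bullet> A j (c r)))"
    using t diagonal_increment[OF \<open>T > 0\<close> B_sym inc Q_int A_cont, of t] by auto
  \<comment> \<open>The flux agrees with the diagonal sum only on the open interval, that is almost
    everywhere, so its measurability has to be shown separately before integrability can be
    transferred.\<close>
  have cong_meas: "(\<lambda>r. kernel_flux k (u r)) \<in> borel_measurable (time_measure T)"
  proof -
    have "kernel_flux k (u r) = (\<Sum>j<m. Q j r \<bullet> (LINT z|torus_measure. a j z *\<^sub>R u r z))" for r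
    proof -
      have "integrable torus_measure (\<lambda>x. norm (u r x) ^ 2)"
        using hi2[of r] by (simp add: u_def)
      moreover have "integrable torus_measure (u r)"
        using hi[of r] by (simp add: u_def)
      moreover have "u r \<in> borel_measurable borel"
        by measurable
      ultimately show ?thesis
        unfolding kernel_flux_def Q_def by (intro trilinear_eq(2))
    qed
    moreover have "(\<lambda>r. \<Sum>j<m. Q j r \<bullet> (LINT z|torus_measure. a j z *\<^sub>R u r z)) \<in> borel_measurable (time_measure T)"
    proof -
      note [measurable] = torus_smoothD(4)[OF smooth_a] borel_measurable_integrable[OF Q_int]
      show ?thesis
        by measurable
    qed
    ultimately show ?thesis
      by simp
  qed
  have AE_flux: "AE r in time_measure T. (\<Sum>j<m. Q j r \<bullet> A j (c r)) = kernel_flux k (u r)"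
    using AE_T by eventually_elim (rule flux)
  show "integrable (time_measure T) (\<lambda>r. kernel_flux k (u r))"
    by (rule integrable_cong_AE_imp[OF diag(1) cong_meas AE_flux])
  have "(LINT r|time_measure T. indicat_real {0<..t} r * (\<Sum>j<m. Q j r \<bullet> A j (c r)))
      = (LINT r|time_measure T. indicat_real {0<..t} r * kernel_flux k (u r))"
  proof (rule integral_cong_AE)
    show "AE r in time_measure T. indicat_real {0<..t} r * (\<Sum>j<m. Q j r \<bullet> A j (c r)) = indicat_real {0<..t} r * kernel_flux k (u r)"
      using AE_flux by eventually_elim simp
  qed (use cong_meas borel_measurable_integrable[OF diag(1)] in measurable)
  then show "(LINT x|torus_measure. h t x \<bullet> torus_conv k (H t) x) - (LINT x|torus_measure. h 0 x \<bullet> torus_conv k (H 0) x)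
      = 2 * (LINT r|time_measure T. indicat_real {0<..t} r * kernel_flux k (u r))"
    using diag(2) B_eq[of t t] B_eq[of 0 0] t \<open>T > 0\<close> by simp
qed

section \<open>Conservation of magnetic helicity\<close>

text \<open>The space prescribes joint measurability on the open time strip alone; extending by zero
  gives a Borel function on the full product, as Tonelli needs.\<close>

lemma besov_joint_measurable:
  assumes "h \<in> Besov_VMO T 3 (1/3) 3"
  shows "(\<lambda>(t, x). if t \<in> {0<..<T} then h t x else 0) \<in> borel_measurable (borel \<Otimes>\<^sub>M borel)"
proof -
  have o: "open ({0<..<T} \<times> (UNIV :: (real ^ 'n) set))"
    by (intro open_Times) auto
  have "case_prod h \<in> borel_measurable (restrict_space borel ({0<..<T} \<times> UNIV))"
    using assms by (simp add: Besov_VMO_def time_Lr_Lq_def)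
  then have "(\<lambda>p. indicat_real ({0<..<T} \<times> UNIV) p *\<^sub>R case_prod h p) \<in> borel_measurable borel"
    using borel_open[OF o] by (subst (asm) borel_measurable_restrict_space_iff) auto
  also have "(\<lambda>p. indicat_real ({0<..<T} \<times> UNIV) p *\<^sub>R case_prod h p) = (\<lambda>(t, x). if t \<in> {0<..<T} then h t x else 0)"
    by (auto simp: fun_eq_iff indicator_def)
  finally show ?thesis
    by (simp add: borel_prod)
qed

lemma besov_cube_integrable:
  fixes h :: "real \<Rightarrow> real ^ 'n::finite \<Rightarrow> 'b::euclidean_space"
  assumes "h \<in> Besov_VMO T 3 (1/3) 3"
  shows "AE t in time_measure T. h t \<in> torus_Lp 3"
    "(\<integral>\<^sup>+t. \<integral>\<^sup>+x. ennreal (norm (if t \<in> {0<..<T} then h t x else 0) ^ 3) \<partial>torus_measure \<partial>time_measure T) < \<infinity>"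
proof -
  have L: "AE t in lborel. t \<in> {0<..<T} \<longrightarrow> h t \<in> torus_Lp 3"
    "set_integrable lborel {0<..<T} (\<lambda>t. torus_Lp_norm 3 (h t) powr 3)"
    using assms by (auto simp: Besov_VMO_def time_Lr_Lq_def)
  show AE: "AE t in time_measure T. h t \<in> torus_Lp 3"
    using L(1) by (simp only: AE_time_measure_iff)
  have eq: "(\<integral>\<^sup>+x. ennreal (norm (h t x) ^ 3) \<partial>torus_measure) = ennreal (torus_Lp_norm 3 (h t) powr 3)" if "h t \<in> torus_Lp 3" for t
  proof -
    note [measurable] = torus_Lp_D(2)[OF that]
    have "(LINT x:torus_cell|lborel. norm (h t x) powr 3) = (LINT x|torus_measure. norm (h t x) ^ 3)"
      by (subst integral_torus_measure) (auto simp: powr_numeral)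
    moreover have "0 \<le> (LINT x|torus_measure. norm (h t x) ^ 3)"
      by simp
    ultimately have "torus_Lp_norm 3 (h t) powr 3 = (LINT x|torus_measure. norm (h t x) ^ 3)"
      by (simp add: torus_Lp_norm_def powr_powr)
    then show ?thesis
      using nn_integral_eq_integral[OF torus_L3_D[OF that]] by simp
  qed
  have "(\<integral>\<^sup>+t. \<integral>\<^sup>+x. ennreal (norm (if t \<in> {0<..<T} then h t x else 0) ^ 3) \<partial>torus_measure \<partial>time_measure T)
      = (\<integral>\<^sup>+t. ennreal (indicat_real {0<..<T} t *\<^sub>R torus_Lp_norm 3 (h t) powr 3) \<partial>time_measure T)"
  proof (rule nn_integral_cong_AE)
    have "AE t in time_measure T. t \<in> {0<..<T}"
      by (simp add: AE_time_measure_iff)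
    with AE show "AE t in time_measure T. (\<integral>\<^sup>+x. ennreal (norm (if t \<in> {0<..<T} then h t x else 0) ^ 3) \<partial>torus_measure)
        = ennreal (indicat_real {0<..<T} t *\<^sub>R torus_Lp_norm 3 (h t) powr 3)"
      by eventually_elim (simp add: eq)
  qed
  also have "\<dots> = (\<integral>\<^sup>+t\<in>{0<..<T}. ennreal (indicat_real {0<..<T} t *\<^sub>R torus_Lp_norm 3 (h t) powr 3) \<partial>lborel)"
    using borel_measurable_integrable[OF L(2)[unfolded set_integrable_def]] by (intro nn_integral_time_measure) simp
  also have "\<dots> \<le> (\<integral>\<^sup>+t. ennreal (norm (indicat_real {0<..<T} t *\<^sub>R torus_Lp_norm 3 (h t) powr 3)) \<partial>lborel)"
    by (intro nn_integral_mono) (simp add: indicator_def)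
  also have "\<dots> < \<infinity>"
    using L(2) by (simp add: set_integrable_def integrable_iff_bounded)
  finally show "(\<integral>\<^sup>+t. \<integral>\<^sup>+x. ennreal (norm (if t \<in> {0<..<T} then h t x else 0) ^ 3) \<partial>torus_measure \<partial>time_measure T) < \<infinity>" .
qed

lemma mean_increment_nonneg: "0 \<le> mean_increment q r f"
  unfolding mean_increment_def set_lebesgue_integral_def
  by (intro Bochner_Integration.integral_nonneg scaleR_nonneg_nonneg mult_nonneg_nonneg) auto

text \<open>For exponents 3, 3 and 1/3 the Besov-VMO limit compares cube roots: the time integral of
  the mean cubed increment is o(r). Removing the normalisation multiplies it by the volume of the
  ball, of order r^3.\<close>

lemma besov_increment_small:
  fixes h u :: "real \<Rightarrow> real ^ 3 \<Rightarrow> real ^ 3"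
  assumes besov: "h \<in> Besov_VMO T 3 (1/3) 3"
    and u_def: "u = (\<lambda>t x. if t \<in> {0<..<T} then h t x else 0)"
    and per: "\<And>t. torus_periodic (u t)"
    and "\<eta> > 0"
  shows "eventually (\<lambda>r. (\<integral>\<^sup>+y\<in>ball 0 r. increment_cube T u y \<partial>lborel) \<le> ennreal (\<eta> * r ^ 4)) (at_right 0)"
proof -
  have u_meas [measurable]: "(\<lambda>(t, x). u t x) \<in> borel_measurable (borel \<Otimes>\<^sub>M borel)"
    using besov_joint_measurable[OF besov] by (simp add: u_def)
  define I where "I r = (LINT t|time_measure T. mean_increment 3 r (u t))" for r
  have I0: "0 \<le> I r" for r
    unfolding I_def by (intro Bochner_Integration.integral_nonneg mean_increment_nonneg)
  define v where "v = unit_ball_vol (real DIM(real ^ 3))"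
  have v: "v \<ge> 0"
    by (simp add: v_def)
  define \<eta>' where "\<eta>' = \<eta> / (v + 1)"
  have \<eta>': "\<eta>' > 0" "v * \<eta>' \<le> \<eta>"
    using \<open>\<eta> > 0\<close> v by (auto simp: \<eta>'_def field_simps)
  have I_eq: "(LINT t:{0<..<T}|lborel. mean_increment 3 r (h t) powr (3 / 3)) = I r" for r
  proof -
    have "(LINT t:{0<..<T}|lborel. mean_increment 3 r (h t) powr (3 / 3)) = (LINT t:{0<..<T}|lborel. mean_increment 3 r (u t))"
      by (rule set_lebesgue_integral_cong) (auto simp: u_def mean_increment_nonneg)
    also have "\<dots> = I r"
      unfolding I_def
    proof (rule integral_time_measure)
      have [measurable]: "ball (0 :: real ^ 3) r \<in> sets borel"
        by simp
      show "(\<lambda>t. mean_increment 3 r (u t)) \<in> borel_measurable borel"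
        unfolding mean_increment_def set_lebesgue_integral_def by measurable
    qed
    finally show ?thesis .
  qed
  have "((\<lambda>r. 1 / r powr (1/3) * I r powr (1/3)) \<longlongrightarrow> 0) (at_right 0)"
    using besov by (simp add: Besov_VMO_def I_eq[simplified])
  then have "eventually (\<lambda>r. 1 / r powr (1/3) * I r powr (1/3) < \<eta>' powr (1/3)) (at_right 0)"
    using \<eta>' by (intro order_tendstoD) auto
  then show ?thesis
    using eventually_at_right_less[of 0]
  proof eventually_elim
    fix r :: real
    assume small: "1 / r powr (1/3) * I r powr (1/3) < \<eta>' powr (1/3)" and r: "0 < r"
    have "I r \<le> \<eta>' * r"
    proof (rule ccontr)
      assume "\<not> I r \<le> \<eta>' * r"
      then have "(\<eta>' * r) powr (1/3) \<le> I r powr (1/3)"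
        using \<eta>' r by (intro powr_mono2) auto
      then show False
        using small \<eta>' r by (simp add: powr_mult field_simps)
    qed
    have "(\<integral>\<^sup>+y\<in>ball 0 r. increment_cube T u y \<partial>lborel) = ennreal (measure lborel (ball (0 :: real ^ 3) r) * I r)"
      unfolding I_def
      by (rule mean_increment_time_integral[OF u_meas per _ r]) (use besov_cube_integrable(2)[OF besov] in \<open>simp add: u_def\<close>)
    also have "measure lborel (ball (0 :: real ^ 3) r) = v * r ^ 3"
      using r by (simp add: content_ball v_def)
    also have "ennreal (v * r ^ 3 * I r) \<le> ennreal (\<eta> * r ^ 4)"
    proof (rule ennreal_leI)
      have "v * r ^ 3 * I r \<le> v * r ^ 3 * (\<eta>' * r)"
        using r v \<open>I r \<le> \<eta>' * r\<close> by (intro mult_left_mono) auto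
      also have "\<dots> = v * \<eta>' * r ^ 4"
        by (simp add: eval_nat_numeral)
      also have "\<dots> \<le> \<eta> * r ^ 4"
        using r by (intro mult_right_mono \<eta>') auto
      finally show "v * r ^ 3 * I r \<le> \<eta> * r ^ 4" .
    qed
    finally show "(\<integral>\<^sup>+y\<in>ball 0 r. increment_cube T u y \<partial>lborel) \<le> ennreal (\<eta> * r ^ 4)" .
  qed
qed

text \<open>At almost every time the solution lies in L^3 and the Duchon-Robert bound applies.
  Integrated over time, that bound is the kernel gradient paired with \<open>increment_cube\<close>,
  which is bounded and has small mass on small balls.\<close>

lemma besov_flux_tendsto:
  fixes h u :: "real \<Rightarrow> real ^ 3 \<Rightarrow> real ^ 3"
  assumes besov: "h \<in> Besov_VMO T 3 (1/3) 3"
    and u_def: "u = (\<lambda>t x. if t \<in> {0<..<T} then h t x else 0)"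
    and div_free: "\<And>t. t \<in> {0<..<T} \<Longrightarrow> weak_div_free (h t)"
  shows "(\<lambda>n. \<integral>\<^sup>+t. ennreal \<bar>kernel_flux (cos_kernel (Suc n)) (u t)\<bar> \<partial>time_measure T) \<longlonglongrightarrow> 0"
proof -
  have u_meas [measurable]: "(\<lambda>(t, x). u t x) \<in> borel_measurable (borel \<Otimes>\<^sub>M borel)"
    using besov_joint_measurable[OF besov] by (simp add: u_def)
  \<comment> \<open>Membership in L^3 gives periodicity only at almost every time; the divergence
    condition gives it at every time of the interval.\<close>
  have per: "torus_periodic (u t)" for t
    using div_free[of t] torus_Lp_D(1)[of "h t" 1]
    by (cases "t \<in> {0<..<T}") (auto simp: u_def weak_div_free_def torus_periodic_def)
  define V where "V = (\<integral>\<^sup>+t. \<integral>\<^sup>+x. ennreal (norm (u t x) ^ 3) \<partial>torus_measure \<partial>time_measure T)"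
  have V: "V < \<infinity>"
    using besov_cube_integrable(2)[OF besov] by (simp add: V_def u_def)
  define R where "R n = (\<integral>\<^sup>+t. \<integral>\<^sup>+x. \<integral>\<^sup>+z. ennreal (norm (grad (cos_kernel n) (x - z))) * ennreal (norm (u t z - u t x) ^ 3)
      \<partial>torus_measure \<partial>torus_measure \<partial>time_measure T)" for n
  have R_eq: "R n = (\<integral>\<^sup>+y. ennreal (norm (grad (cos_kernel n) y)) * increment_cube T u y \<partial>centred_measure)" if "n \<ge> 1" for n
  proof -
    have "torus_periodic (\<lambda>y. norm (grad (cos_kernel n) y))"
      using torus_smoothD(1)[OF torus_smooth_partial[OF cos_kernel_torus_smooth[OF that]]]
      by (simp add: torus_periodic_def grad_def)
    moreover note [measurable] = grad_cos_kernel_borel[OF that]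
    ultimately show ?thesis
      unfolding R_def by (intro nn_integral_increment_kernel per) measurable
  qed
  have "increment_cube T u y \<le> ennreal (enn2real (16 * V))" for y
    using increment_cube_le[OF u_meas per, of T y] V by (simp add: V_def[symmetric] ennreal_mult_less_top less_top)
  then have "(\<lambda>n. \<integral>\<^sup>+y. ennreal (norm (grad (cos_kernel n) y)) * increment_cube T u y \<partial>centred_measure) \<longlonglongrightarrow> 0"
    by (rule nn_integral_grad_cos_kernel_tendsto[OF increment_cube_borel[OF u_meas]])
      (auto intro: besov_increment_small[OF besov u_def per])
  then have lim: "(\<lambda>n. R (Suc n)) \<longlonglongrightarrow> 0"
    by (subst R_eq) (auto intro: LIMSEQ_Suc)
  have "(\<integral>\<^sup>+t. ennreal \<bar>kernel_flux (cos_kernel (Suc n)) (u t)\<bar> \<partial>time_measure T) \<le> R (Suc n)" for n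
    unfolding R_def
  proof (rule nn_integral_mono_AE)
    obtain m a where "torus_kernel (cos_kernel (Suc n)) m a"
      using torus_kernel_cos_kernel[of "Suc n"] by auto
    then interpret torus_kernel "cos_kernel (Suc n)" m a .
    have "AE t in time_measure T. t \<in> {0<..<T}"
      by (simp add: AE_time_measure_iff)
    with besov_cube_integrable(1)[OF besov]
    show "AE t in time_measure T. ennreal \<bar>kernel_flux (cos_kernel (Suc n)) (u t)\<bar>
      \<le> (\<integral>\<^sup>+x. \<integral>\<^sup>+z. ennreal (norm (grad (cos_kernel (Suc n)) (x - z))) * ennreal (norm (u t z - u t x) ^ 3)
          \<partial>torus_measure \<partial>torus_measure)"
    proof eventually_elim
      case (elim t)
      then have u: "u t = h t" and df: "weak_div_free (h t)"
        using div_free by (auto simp: u_def)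
      have "ennreal \<bar>kernel_flux (cos_kernel (Suc n)) (h t)\<bar> \<le> ennreal (4 * \<bar>kernel_flux (cos_kernel (Suc n)) (h t)\<bar>)"
        by (rule ennreal_leI) simp
      also have "\<dots> \<le> (\<integral>\<^sup>+x. \<integral>\<^sup>+z. ennreal (norm (grad (cos_kernel (Suc n)) (x - z))) * ennreal (norm (h t z - h t x) ^ 3)
          \<partial>torus_measure \<partial>torus_measure)"
        using df elim(1)
        by (intro duchon_robert_bound weak_div_freeD integral_cos_kernel torus_Lp_D(2) torus_L3_D torus_L1_D)
          (auto simp: weak_div_free_def)
      finally show ?case
        by (simp only: u)
    qed
  qed
  then show ?thesis
    by (intro tendsto_sandwich[OF _ _ tendsto_const lim]) auto
qed

theorem theorem1p2:
  fixes T :: real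
    and h j H :: "real \<Rightarrow> real ^ 3 \<Rightarrow> real ^ 3"
  assumes "T > 0"
    and "emhd_weak_solution T h"
    and "\<And>t. t \<in> {0..T} \<Longrightarrow> mean_zero (h t)"
    and "\<And>t. t \<in> {0..T} \<Longrightarrow> has_weak_curl (h t) (j t)"
    and "j \<in> time_C_Lp T (3/2)"
    and "h \<in> Besov_VMO T 3 (1/3) 3"
    and "\<And>t. t \<in> {0..T} \<Longrightarrow> is_curl_inverse (h t) (H t)"
  shows "\<forall>t\<in>{0..T}. (LINT x:torus_cell|lborel. H t x \<bullet> weak_curl (H t) x) =
                     (LINT x:torus_cell|lborel. H 0 x \<bullet> weak_curl (H 0) x)"
proof
  fix t
  assume t: "t \<in> {0..T}"
  note sol = assms(2) and besov = assms(6) and inv = assms(7)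
  define u where "u = (\<lambda>t x. if t \<in> {0<..<T} then h t x else 0)"
  have u_meas [measurable]: "(\<lambda>(t, x). u t x) \<in> borel_measurable (borel \<Otimes>\<^sub>M borel)"
    using besov_joint_measurable[OF besov] by (simp add: u_def)
  have h2: "h t \<in> torus_Lp 2" if "t \<in> {0..T}" for t
    using sol that by (simp add: emhd_weak_solution_def time_weak_C_L2_def)
  have H2: "H t \<in> torus_Lp 2" if "t \<in> {0..T}" for t
    using inv[OF that] by (simp add: is_curl_inverse_def)
  \<comment> \<open>The space-time cubic bound controls the square because p^2 \<le> 1 + p^3 and
    both measures are finite.\<close>
  have u2: "integrable (time_measure T) (\<lambda>t. LINT x|torus_measure. norm (u t x) ^ 2)"
  proof (subst integrable_iff_bounded, intro conjI)
    show "(\<lambda>t. LINT x|torus_measure. norm (u t x) ^ 2) \<in> borel_measurable (time_measure T)"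
      by measurable
    have "(\<integral>\<^sup>+t. ennreal (norm (LINT x|torus_measure. norm (u t x) ^ 2)) \<partial>time_measure T)
        \<le> (\<integral>\<^sup>+t. 1 + (\<integral>\<^sup>+x. ennreal (norm (u t x) ^ 3) \<partial>torus_measure) \<partial>time_measure T)"
    proof (rule nn_integral_mono)
      fix t
      have "integrable torus_measure (\<lambda>x. norm (u t x) ^ 2)"
        using torus_L2_D[OF h2[of t]] by (cases "t \<in> {0<..<T}") (auto simp: u_def)
      then have "ennreal (norm (LINT x|torus_measure. norm (u t x) ^ 2)) = (\<integral>\<^sup>+x. ennreal (norm (u t x) ^ 2) \<partial>torus_measure)"
        by (subst nn_integral_eq_integral) auto
      also have "\<dots> \<le> (\<integral>\<^sup>+x. 1 + ennreal (norm (u t x) ^ 3) \<partial>torus_measure)"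
      proof (rule nn_integral_mono)
        fix x
        have "p ^ 2 \<le> 1 + p ^ 3" if "0 \<le> p" for p :: real
        proof (cases "p \<le> 1")
          case True
          then show ?thesis
            using that power_le_one[of p 2] by (simp add: add_increasing2)
        next
          case False
          then have "p ^ 2 \<le> p ^ 3"
            by (intro power_increasing) auto
          then show ?thesis
            by linarith
        qed
        then have "ennreal (norm (u t x) ^ 2) \<le> ennreal (1 + norm (u t x) ^ 3)"
          by (intro ennreal_leI) simp
        then show "ennreal (norm (u t x) ^ 2) \<le> 1 + ennreal (norm (u t x) ^ 3)"
          by simp
      qed
      also have "\<dots> = 1 + (\<integral>\<^sup>+x. ennreal (norm (u t x) ^ 3) \<partial>torus_measure)"
        by (subst nn_integral_add) (auto simp: emeasure_torus_measure_UNIV)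
      finally show "ennreal (norm (LINT x|torus_measure. norm (u t x) ^ 2)) \<le> 1 + (\<integral>\<^sup>+x. ennreal (norm (u t x) ^ 3) \<partial>torus_measure)" .
    qed
    also have "\<dots> = emeasure (time_measure T) UNIV + (\<integral>\<^sup>+t. \<integral>\<^sup>+x. ennreal (norm (u t x) ^ 3) \<partial>torus_measure \<partial>time_measure T)"
      by (subst nn_integral_add) auto
    also have "\<dots> < \<infinity>"
    proof -
      have "emeasure (time_measure T) UNIV < top"
        using time_measure.emeasure_finite[of T UNIV] by (simp only: infinity_ennreal_def top.not_eq_extremum)
      then show ?thesis
        using besov_cube_integrable(2)[OF besov] by (simp add: u_def)
    qed
    finally show "(\<integral>\<^sup>+t. ennreal (norm (LINT x|torus_measure. norm (u t x) ^ 2)) \<partial>time_measure T) < \<infinity>" .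
  qed
  \<comment> \<open>The mollified helicity. For each level its increment over [0,t] is bounded by
    the integrated flux, and the two end values converge separately to the unmollified
    pairings.\<close>
  define hel where "hel n s = (LINT x|torus_measure. h s x \<bullet> torus_conv (cos_kernel (Suc n)) (H s) x)" for n s
  have bound: "ennreal \<bar>hel n t - hel n 0\<bar> \<le> 2 * (\<integral>\<^sup>+r. ennreal \<bar>kernel_flux (cos_kernel (Suc n)) (u r)\<bar> \<partial>time_measure T)" for n
  proof -
    obtain m a where K: "torus_kernel (cos_kernel (Suc n)) m a"
      using torus_kernel_cos_kernel[of "Suc n"] by auto
    have u': "u t = (if t \<in> {0<..<T} then h t else (\<lambda>x. 0))" for t
      by (auto simp: u_def)
    note inc = mollified_helicity_increment[OF assms(1) K sol inv u' u_meas u2 t]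
    have "ennreal \<bar>hel n t - hel n 0\<bar> = 2 * ennreal (norm (LINT r|time_measure T. indicat_real {0<..t} r * kernel_flux (cos_kernel (Suc n)) (u r)))"
      using inc(2) by (simp add: hel_def abs_mult ennreal_mult)
    also have "\<dots> \<le> 2 * (\<integral>\<^sup>+r. ennreal (norm (indicat_real {0<..t} r * kernel_flux (cos_kernel (Suc n)) (u r))) \<partial>time_measure T)"
      by (intro mult_left_mono integral_norm_bound_ennreal integrable_indicator_Ioc inc(1)) auto
    also have "\<dots> \<le> 2 * (\<integral>\<^sup>+r. ennreal \<bar>kernel_flux (cos_kernel (Suc n)) (u r)\<bar> \<partial>time_measure T)"
      by (intro mult_left_mono nn_integral_mono) (auto simp: indicator_def)
    finally show ?thesis .
  qed
  have "(\<lambda>n. 2 * (\<integral>\<^sup>+r. ennreal \<bar>kernel_flux (cos_kernel (Suc n)) (u r)\<bar> \<partial>time_measure T)) \<longlonglongrightarrow> 2 * 0"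
    using sol by (intro ennreal_tendsto_cmult besov_flux_tendsto[OF besov u_def]) (auto simp: emhd_weak_solution_def)
  then have lim0: "(\<lambda>n. 2 * (\<integral>\<^sup>+r. ennreal \<bar>kernel_flux (cos_kernel (Suc n)) (u r)\<bar> \<partial>time_measure T)) \<longlonglongrightarrow> 0"
    by simp
  have "(\<lambda>n. ennreal \<bar>hel n t - hel n 0\<bar>) \<longlonglongrightarrow> 0"
    by (rule tendsto_sandwich[OF _ _ tendsto_const lim0]) (use bound in auto)
  from this[folded ennreal_0] have "(\<lambda>n. \<bar>hel n t - hel n 0\<bar>) \<longlonglongrightarrow> 0"
    by (rule tendsto_ennrealD) auto
  then have zero: "(\<lambda>n. hel n t - hel n 0) \<longlonglongrightarrow> 0"
    by (rule tendsto_rabs_zero_cancel)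
  have hel_lim: "(\<lambda>n. hel n s) \<longlonglongrightarrow> (LINT x|torus_measure. h s x \<bullet> H s x)" if "s \<in> {0..T}" for s
    unfolding hel_def by (rule torus_conv_pairing_tendsto[OF H2[OF that] h2[OF that]])
  have "0 \<in> {0..T}"
    using assms(1) by simp
  have "(\<lambda>n. hel n t - hel n 0) \<longlonglongrightarrow> (LINT x|torus_measure. h t x \<bullet> H t x) - (LINT x|torus_measure. h 0 x \<bullet> H 0 x)"
    by (intro tendsto_diff hel_lim t \<open>0 \<in> {0..T}\<close>)
  from LIMSEQ_unique[OF this zero]
  have "(LINT x|torus_measure. h t x \<bullet> H t x) = (LINT x|torus_measure. h 0 x \<bullet> H 0 x)"
    by simp
  then show "(LINT x:torus_cell|lborel. H t x \<bullet> weak_curl (H t) x) = (LINT x:torus_cell|lborel. H 0 x \<bullet> weak_curl (H 0) x)"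
    by (simp only: integral_weak_curl[OF inv[OF t]] integral_weak_curl[OF inv[OF \<open>0 \<in> {0..T}\<close>]] inner_commute)
qed

end
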